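(* Let $d\ge 4$ be an integer, let $\omega\in[0,1)$, and let $X$ be a random vector in $\mathbb{R}^d$ with spherically symmetric Lebesgue density $x\mapsto f(\|x-\theta\|^2)$, where $f$ is known and $\theta\in\mathbb{R}^d$ is unknown. Suppose that $\mathbb{E}_0(\|X\|^2)<\infty$ and $\mathbb{E}_0(\|X\|^{-2})<\infty$. Let $\rho:[0,\infty)\to[0,\infty)$ be differentiable, increasing and concave with $\rho(0)=0$ and $0<\rho'(0)<\infty$. Consider estimating $\theta$ under the balanced loss $$L(\theta,\delta)=\omega\,\rho(\|\delta-\delta_0(X)\|^2)+(1-\omega)\,\rho(\|\delta-\theta\|^2),\qquad \delta_0(X)=X .$$ Let $s:[0,\infty)\to[0,1]$ be non-decreasing and concave, twice differentiable almost everywhere, and not identically zero, and for $a>0$ let $$\delta_{a,s}(X)=\left(1-a(1-\omega)\frac{s(\|X\|^2)}{\|X\|^2}\right)X .$$ Put $K=\mathbb{E}_0(\rho'(\|X\|^2))$ and $f^{*}(t)=\rho'(t)f(t)/K$, and let $\mathbb{E}^{*}_0$ denote expectation when $Y$ has density $y\mapsto f^{*}(\|y\|^2)$ on $\mathbb{R}^d$. Then $\delta_{a,s}(X)$ dominates $\delta_0(X)=X$ provided $$0<a<\frac{2K(d-2)/d}{\{\omega\rho'(0)+K(1-\omega)\}\,\mathbb{E}^{*}_0(\|Y\|^{-2})}.$$ Moreover, this condition on $a$ is equivalent to $$0<a<\frac{2K^2(d-2)/d}{\{\omega\rho'(0)+K(1-\omega)\}\,\mathbb{E}_0\!\left(\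frac{\rho'(\|X\|^2)}{\|X\|^2}\right)}.$$
   Context: $\|\cdot\|$ is the Euclidean norm on $\mathbb{R}^d$. $\mathbb{E}_\theta$ denotes expectation when $X$ has density $f(\|x-\theta\|^2)$; in particular $\mathbb{E}_0$ is the case $\theta=0$. The (frequentist) risk of an estimator $\delta(X)$ is $R(\theta,\delta)=\mathbb{E}_\theta[L(\theta,\delta(X))]$. An estimator $\delta$ dominates $\delta_0$ if $R(\theta,\delta)\le R(\theta,\delta_0)$ for all $\theta\in\mathbb{R}^d$, with strict inequality for at least one $\theta$. *)

theory Defs
  imports "HOL-Probability.Probability"
begin

definition prob_density :: "(real ^ 'n \<Rightarrow> real) \<Rightarrow> bool" where
  "prob_density g \<longleftrightarrow>
     g \<in> borel_measurable borel \<and> (\<forall>x. 0 \<le> g x) \<and> (\<integral>\<^sup>+ x. ennreal (g x) \<partial>lborel) = 1"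

definition sph_law :: "(real \<Rightarrow> real) \<Rightarrow> real ^ 'n \<Rightarrow> (real ^ 'n) measure" where
  "sph_law f \<theta> = density lborel (\<lambda>x. ennreal (f ((norm (x - \<theta>))\<^sup>2)))"

definition sph_expectation :: "(real \<Rightarrow> real) \<Rightarrow> real ^ 'n \<Rightarrow> (real ^ 'n \<Rightarrow> real) \<Rightarrow> real" where
  "sph_expectation f \<theta> g = (\<integral>x. g x \<partial>sph_law f \<theta>)"

text \<open>The loss of the decision \<open>d\<close> at the parameter \<open>\<theta>\<close>; since the target estimator is evaluated
  at the observation, the observation \<open>x\<close> is an argument as well.\<close>

definition balanced_loss ::
  "real \<Rightarrow> (real \<Rightarrow> real) \<Rightarrow> (real ^ 'n \<Rightarrow> real ^ 'n) \<Rightarrow> real ^ 'n \<Rightarrow> real ^ 'n \<Rightarrow> real ^ 'n \<Rightarrow> real" where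
  "balanced_loss \<omega> \<rho> \<delta>\<^sub>0 x \<theta> d =
     \<omega> * \<rho> ((norm (d - \<delta>\<^sub>0 x))\<^sup>2) + (1 - \<omega>) * \<rho> ((norm (d - \<theta>))\<^sup>2)"

text \<open>The risk is the expectation, with values in \<open>[0, \<infinity>]\<close>, of a nonnegative loss \<open>L x \<theta> d\<close>.
  The nonnegative integral is used because the Bochner integral of a non-integrable loss would
  be \<open>0\<close> instead of \<open>\<infinity>\<close>.\<close>

definition risk ::
  "(real \<Rightarrow> real) \<Rightarrow> (real ^ 'n \<Rightarrow> real ^ 'n \<Rightarrow> real ^ 'n \<Rightarrow> real) \<Rightarrow> real ^ 'n
     \<Rightarrow> (real ^ 'n \<Rightarrow> real ^ 'n) \<Rightarrow> ennreal" where
  "risk f L \<theta> \<delta> = (\<integral>\<^sup>+ x. ennreal (L x \<theta> (\<delta> x)) \<partial>sph_law f \<theta>)"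

definition dominates ::
  "(real \<Rightarrow> real) \<Rightarrow> (real ^ 'n \<Rightarrow> real ^ 'n \<Rightarrow> real ^ 'n \<Rightarrow> real)
     \<Rightarrow> (real ^ 'n \<Rightarrow> real ^ 'n) \<Rightarrow> (real ^ 'n \<Rightarrow> real ^ 'n) \<Rightarrow> bool" where
  "dominates f L \<delta> \<delta>' \<longleftrightarrow>
     (\<forall>\<theta>. risk f L \<theta> \<delta> \<le> risk f L \<theta> \<delta>') \<and> (\<exists>\<theta>. risk f L \<theta> \<delta> < risk f L \<theta> \<delta>')"

text \<open>At \<open>x = 0\<close>, a null set for every \<open>sph_law f \<theta>\<close>, the value is \<open>0\<close>.\<close>

definition shrink_est ::
  "real \<Rightarrow> real \<Rightarrow> (real \<Rightarrow> real) \<Rightarrow> real ^ 'n \<Rightarrow> real ^ 'n" where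
  "shrink_est \<omega> a s x = (1 - a * (1 - \<omega>) * (s ((norm x)\<^sup>2) / (norm x)\<^sup>2)) *\<^sub>R x"

definition twice_differentiable_at :: "(real \<Rightarrow> real) \<Rightarrow> real \<Rightarrow> bool" where
  "twice_differentiable_at s t \<longleftrightarrow>
     (\<forall>\<^sub>F u in nhds t. s differentiable (at u)) \<and> deriv s differentiable (at t)"

end

theory Submission
  imports Defs
begin

text \<open>
  Write \<open>h x = s (\<parallel>x\<parallel>\<^sup>2) / \<parallel>x\<parallel>\<^sup>2\<close>, \<open>b = a (1 - \<omega>)\<close>, so that the estimator is \<open>x - b h(x) x\<close>, and
  condition on \<open>r = \<parallel>X - \<theta>\<parallel>\<close>. Since \<open>\<rho>\<close> is concave and \<open>s\<^sup>2 \<le> s\<close>, the difference of the losses is at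
  most \<open>\<omega> \<rho>'(0) b\<^sup>2 h + (1 - \<omega>) \<rho>'(r\<^sup>2) (b\<^sup>2 h - 2 b h (X - \<theta>) \<bullet> X)\<close>. Let \<open>M r\<close> be the mean of \<open>h\<close> over the
  sphere of radius \<open>r\<close> about \<open>\<theta>\<close>. In dimension at least \<open>4\<close> the function \<open>h\<close> is superharmonic, so
  \<open>M\<close> decreases and, after rescaling, \<open>r\<^sup>2 M r\<close> increases; as \<open>div (h(x) x) \<ge> (d - 2) h\<close>, the
  conditional mean of \<open>h (X - \<theta>) \<bullet> X\<close> is at least \<open>(d - 2) / d * r\<^sup>2 M r\<close>. Chebyshev's integral inequality,
  once for \<open>\<rho>'(r\<^sup>2)\<close> and \<open>M r\<close>, once for \<open>1 / r\<^sup>2\<close> and \<open>r\<^sup>2 M r\<close> with weight \<open>\<rho>'(r\<^sup>2)\<close>, then bounds the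
  difference of the risks by a multiple of \<open>E (\<rho>'(r\<^sup>2) M r)\<close> that is negative under the condition on \<open>a\<close>.

  Superharmonicity is used without derivatives. The mean of \<open>h\<close> over the sphere of radius \<open>t\<close> about
  \<open>x\<close> depends only on the norms \<open>\<parallel>x\<parallel>\<close> and \<open>t\<close>, symmetrically. As a function of \<open>x\<close> it is thus radial, and,
  being an average of translates of \<open>h\<close>, it inherits from \<open>h\<close> the estimate that its mean over small spheres
  of radius \<open>q\<close> exceeds its value by \<open>O(q\<^sup>3)\<close> at most. The minimum principle makes it decreasing in \<open>\<parallel>x\<parallel>\<close>.
\<close>

section \<open>The uniform distribution on the sphere\<close>

lemma nn_integral_lborel_translate:
  fixes c :: "'a::euclidean_space" and g :: "'a \<Rightarrow> ennreal"
  assumes [measurable]: "g \<in> borel_measurable borel"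
  shows "(\<integral>\<^sup>+ x. g (c + x) \<partial>lborel) = (\<integral>\<^sup>+ x. g x \<partial>lborel)"
  by (subst (2) lborel_distr_plus[symmetric, of c]) (simp add: nn_integral_distr)

text \<open>Uniqueness of translation-invariant measures: Fubini against the indicator of the unit ball, which
  \<open>T\<close> preserves.\<close>

lemma lborel_distr_isometric_involution:
  fixes T :: "'a::euclidean_space \<Rightarrow> 'a"
  assumes lin: "linear T" and inv: "\<And>x. T (T x) = x" and nrm: "\<And>x. norm (T x) = norm x"
  shows "distr lborel borel T = lborel"
proof (rule measure_eqI)
  show "sets (distr lborel borel T) = sets lborel" by simp
  fix A assume "A \<in> sets (distr lborel borel T)"
  then have [measurable]: "A \<in> sets borel" by simp
  have [measurable]: "T \<in> borel_measurable borel"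
    using lin by (intro borel_measurable_continuous_onI linear_continuous_on linear_conv_bounded_linear[THEN iffD1])
  define B :: "'a set" where "B = cball 0 1"
  have [measurable]: "B \<in> sets borel" by (simp add: B_def)
  have add: "T (x + y) = T x + T y" for x y using lin by (rule linear_add)
  have sub: "T (x - y) = T x - T y" for x y using lin by (rule linear_diff)
  have B0: "emeasure lborel B \<noteq> 0" "emeasure lborel B \<noteq> \<infinity>"
    by (auto simp: B_def emeasure_cball less_imp_neq[symmetric])
  have dA: "(\<integral>\<^sup>+ y. indicator A (T y) \<partial>lborel) = emeasure (distr lborel borel T) A"
    using nn_integral_distr[of T lborel borel "indicator A"] by simp
  have "emeasure (distr lborel borel T) A * emeasure lborel B
      = (\<integral>\<^sup>+ x. (\<integral>\<^sup>+ y. indicator A (T y) \<partial>lborel) * indicator B x \<partial>lborel)"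
    by (simp add: nn_integral_cmult dA)
  also have "\<dots> = (\<integral>\<^sup>+ x. (\<integral>\<^sup>+ y. indicator A (T (T x + y)) \<partial>lborel) * indicator B x \<partial>lborel)"
    by (subst nn_integral_lborel_translate[of "\<lambda>y. indicator A (T y)"]) auto
  also have "\<dots> = (\<integral>\<^sup>+ x. (\<integral>\<^sup>+ y. indicator A (x + T y) * indicator B x \<partial>lborel) \<partial>lborel)"
    by (simp add: add inv nn_integral_multc)
  also have "\<dots> = (\<integral>\<^sup>+ y. (\<integral>\<^sup>+ x. indicator A (x + T y) * indicator B x \<partial>lborel) \<partial>lborel)"
    by (rule lborel_pair.Fubini') measurable
  \<comment> \<open>Shifting the inner variable by \<open>- T y\<close> moves the dependence on
    \<open>T y\<close> from \<open>A\<close> to the ball.\<close>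
  also have "\<dots> = (\<integral>\<^sup>+ y. (\<integral>\<^sup>+ x. indicator A (- T y + x + T y) * indicator B (- T y + x) \<partial>lborel) \<partial>lborel)"
  proof (rule nn_integral_cong)
    fix y
    show "(\<integral>\<^sup>+ x. indicator A (x + T y) * indicator B x \<partial>lborel)
        = (\<integral>\<^sup>+ x. indicator A (- T y + x + T y) * indicator B (- T y + x) \<partial>lborel)"
      using nn_integral_lborel_translate[of "\<lambda>x. indicator A (x + T y) * indicator B x" "- T y"] by simp
  qed
  also have "\<dots> = (\<integral>\<^sup>+ y. (\<integral>\<^sup>+ x. indicator A x * indicator B (x - T y) \<partial>lborel) \<partial>lborel)"
    by simp
  also have "\<dots> = (\<integral>\<^sup>+ x. (\<integral>\<^sup>+ y. indicator A x * indicator B (x - T y) \<partial>lborel) \<partial>lborel)"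
    by (rule lborel_pair.Fubini') measurable
  also have "\<dots> = (\<integral>\<^sup>+ x. indicator A x * (\<integral>\<^sup>+ y. indicator B (y - T x) \<partial>lborel) \<partial>lborel)"
  proof (rule nn_integral_cong)
    fix x
    have "(indicator B (x - T y) :: ennreal) = indicator B (y - T x)" for y
    proof -
      have "norm (x - T y) = norm (T x - y)"
        using nrm[of "x - T y"] by (simp add: sub inv)
      then show ?thesis by (auto simp: B_def indicator_def norm_minus_commute)
    qed
    then show "(\<integral>\<^sup>+ y. indicator A x * indicator B (x - T y) \<partial>lborel)
        = indicator A x * (\<integral>\<^sup>+ y. indicator B (y - T x) \<partial>lborel)"
      by (simp add: nn_integral_cmult)
  qed
  also have "\<dots> = (\<integral>\<^sup>+ x. indicator A x * emeasure lborel B \<partial>lborel)"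
  proof (rule nn_integral_cong)
    fix x
    show "indicator A x * (\<integral>\<^sup>+ y. indicator B (y - T x) \<partial>lborel) = indicator A x * emeasure lborel B"
      using nn_integral_lborel_translate[of "\<lambda>y. indicator B y" "- T x"] by simp
  qed
  also have "\<dots> = emeasure lborel A * emeasure lborel B"
    by (simp add: nn_integral_multc)
  finally show "emeasure (distr lborel borel T) A = emeasure lborel A"
    using B0 by (metis ennreal_mult_strict_right_mono linorder_neqE neq_iff not_gr_zero top.not_eq_extremum infinity_ennreal_def)
qed

section \<open>Reflections in hyperplanes\<close>

definition reflection :: "'a::real_inner \<Rightarrow> 'a \<Rightarrow> 'a" where
  "reflection w x = x - (2 * (x \<bullet> w) / (w \<bullet> w)) *\<^sub>R w"

lemma reflection_inner: "reflection w x \<bullet> y = x \<bullet> reflection w y"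
  by (simp add: reflection_def inner_diff inner_commute field_simps)

lemma linear_reflection: "linear (reflection w)"
  by (rule linearI) (auto simp: reflection_def inner_add algebra_simps add_divide_distrib)

text \<open>For \<open>w = 0\<close> the quotient in \<open>reflection\<close> is \<open>0\<close>
  by convention and the map is the identity, so the properties of reflections hold for every
  \<open>w\<close>.\<close>

lemma reflection_reflection [simp]: "reflection w (reflection w x) = x"
proof (cases "w = 0")
  case False
  then have "w \<bullet> w \<noteq> 0" by simp
  then show ?thesis
    by (simp add: reflection_def inner_diff algebra_simps diff_divide_distrib flip: scaleR_add_left)
qed (simp add: reflection_def)

lemma norm_reflection [simp]: "norm (reflection w x) = norm x"
  by (simp add: norm_eq_sqrt_inner reflection_inner)

text \<open>Equal norms put the origin on the hyperplane that bisects the segment from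
  \<open>x\<close> to \<open>y\<close>. Reflections alone thus act transitively on each sphere about
  the origin.\<close>

lemma reflection_swap:
  assumes "norm x = norm y"
  shows "reflection (x - y) x = y"
proof (cases "x = y")
  case False
  have "x \<bullet> x = y \<bullet> y" using assms by (simp add: norm_eq_sqrt_inner)
  then have "2 * (x \<bullet> (x - y)) = (x - y) \<bullet> (x - y)"
    by (simp add: inner_diff inner_commute)
  moreover have "(x - y) \<bullet> (x - y) \<noteq> 0" using False by simp
  ultimately show ?thesis by (simp add: reflection_def)
qed (simp add: reflection_def)

text \<open>Projecting the unit ball along rays lets invariance be inherited from Lebesgue measure.
  The measure lives on the whole space, so \<open>norm u = 1\<close> is available as an
  almost-everywhere fact; the exception \<open>sgn 0 = 0\<close> comes from a null set.\<close>

definition usphere :: "'a::euclidean_space measure" where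
  "usphere = distr (uniform_measure lborel (cball 0 1)) borel sgn"

lemma borel_measurable_sgn_vec [measurable]:
  "(sgn :: 'a::euclidean_space \<Rightarrow> 'a) \<in> borel_measurable borel"
  unfolding sgn_div_norm by measurable

lemma emeasure_unit_cball: 
  "emeasure lborel (cball (0::'a::euclidean_space) 1) \<noteq> 0"
  "emeasure lborel (cball (0::'a::euclidean_space) 1) \<noteq> \<infinity>"
    by (auto simp: emeasure_cball less_imp_neq[symmetric])

lemma sets_usphere [simp, measurable_cong]: "sets usphere = sets borel"
  by (simp add: usphere_def)

lemma space_usphere [simp]: "space usphere = UNIV"
  by (simp add: usphere_def)

lemma prob_space_usphere: "prob_space (usphere :: 'a::euclidean_space measure)"
  unfolding usphere_def
  by (intro prob_space.prob_space_distr prob_space_uniform_measure emeasure_unit_cball)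
     (simp add: measurable_cong_sets[OF sets_uniform_measure refl])

interpretation usphere: prob_space usphere by (rule prob_space_usphere)

lemma measure_usphere_UNIV [simp]: "measure usphere UNIV = 1"
  using usphere.prob_space by simp

lemma AE_lborel_neq: "AE x in lborel. x \<noteq> (c :: 'a::euclidean_space)"
  using AE_lborel_singleton[of c] by simp

lemma AE_usphere_norm: "AE u in usphere. norm u = 1"
proof -
  have "AE x::'a in uniform_measure lborel (cball 0 1). norm (sgn x) = 1"
    using AE_lborel_neq[of 0] by (intro AE_uniform_measureI) (auto simp: norm_sgn elim: AE_mp)
  then show ?thesis unfolding usphere_def
    by (subst AE_distr_iff) (auto simp: measurable_cong_sets[OF sets_uniform_measure refl])
qed

text \<open>The reflection preserves Lebesgue measure and the unit ball, and it commutes with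
  \<open>sgn\<close>.\<close>

lemma usphere_distr_reflection: "distr usphere borel (reflection w) = usphere"
proof -
  let ?T = "reflection w" and ?U = "uniform_measure lborel (cball (0::'a) 1)"
  have T[measurable]: "?T \<in> borel_measurable borel"
    using linear_reflection[of w] by (intro borel_measurable_continuous_onI linear_continuous_on linear_conv_bounded_linear[THEN iffD1])
  have [measurable_cong]: "sets ?U = sets borel" by simp
  have eq: "distr lborel borel ?T = lborel"
    by (intro lborel_distr_isometric_involution linear_reflection) auto
  have U: "distr ?U borel ?T = ?U"
  proof (rule measure_eqI)
    fix A assume "A \<in> sets (distr ?U borel ?T)"
    then have [measurable]: "A \<in> sets borel" by simp
    have "emeasure lborel (cball 0 1 \<inter> ?T -` A) = emeasure (distr lborel borel ?T) (cball 0 1 \<inter> A)"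
      by (subst emeasure_distr) (auto intro!: arg_cong[where f="emeasure lborel"])
    then show "emeasure (distr ?U borel ?T) A = emeasure ?U A"
      by (simp add: eq emeasure_distr measurable_sets_borel[OF T])
  qed simp
  have comm: "?T (sgn x) = sgn (?T x)" for x
    using linear_scale[OF linear_reflection] by (simp add: sgn_div_norm)
  have "distr usphere borel ?T = distr ?U borel (?T \<circ> sgn)"
    unfolding usphere_def by (rule distr_distr) measurable
  also have "?T \<circ> sgn = sgn \<circ> ?T" using comm by (auto simp: o_def)
  also have "distr ?U borel (sgn \<circ> ?T) = distr (distr ?U borel ?T) borel sgn"
    by (rule distr_distr[symmetric]) measurable
  finally show ?thesis by (simp add: U usphere_def)
qed

text \<open>The reflection that exchanges \<open>x\<close> and \<open>y\<close> is self-adjoint and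
  preserves \<open>usphere\<close>, so it can be moved from \<open>u\<close> to
  \<open>x\<close>.\<close>

lemma usphere_inner_law:
  fixes x y :: "'a::euclidean_space"
  assumes "norm x = norm y"
  shows "distr usphere borel (\<lambda>u. x \<bullet> u) = distr usphere borel (\<lambda>u. y \<bullet> u)"
proof -
  let ?T = "reflection (x - y)"
  have T[measurable]: "?T \<in> borel_measurable borel"
    using linear_reflection[of "x-y"] by (intro borel_measurable_continuous_onI linear_continuous_on linear_conv_bounded_linear[THEN iffD1])
  have "distr usphere borel (\<lambda>u. x \<bullet> u) = distr (distr usphere borel ?T) borel (\<lambda>u. x \<bullet> u)"
    by (simp add: usphere_distr_reflection)
  also have "\<dots> = distr usphere borel (\<lambda>u. x \<bullet> ?T u)"
    by (subst distr_distr) (auto simp: o_def)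
  also have "\<dots> = distr usphere borel (\<lambda>u. y \<bullet> u)"
    by (simp add: reflection_inner[symmetric] reflection_swap[OF assms])
  finally show ?thesis .
qed

lemma usphere_inner_integral:
  fixes x y :: "'a::euclidean_space" and F :: "real \<Rightarrow> real"
  assumes "norm x = norm y" and [measurable]: "F \<in> borel_measurable borel"
  shows "(\<integral>u. F (x \<bullet> u) \<partial>usphere) = (\<integral>u. F (y \<bullet> u) \<partial>usphere)"
proof -
  have "(\<integral>u. F (x \<bullet> u) \<partial>usphere) = (\<integral>z. F z \<partial>distr usphere borel (\<lambda>u. x \<bullet> u))"
    by (subst integral_distr) auto
  also have "\<dots> = (\<integral>z. F z \<partial>distr usphere borel (\<lambda>u. y \<bullet> u))"
    by (simp add: usphere_inner_law[OF assms(1)])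
  also have "\<dots> = (\<integral>u. F (y \<bullet> u) \<partial>usphere)"
    by (subst integral_distr) auto
  finally show ?thesis .
qed

lemma integrable_usphere_bounded:
  fixes g :: "'a::euclidean_space \<Rightarrow> real"
  assumes [measurable]: "g \<in> borel_measurable borel" and "\<And>u. norm u = 1 \<Longrightarrow> \<bar>g u\<bar> \<le> B"
  shows "integrable usphere g"
  using AE_usphere_norm by (intro usphere.integrable_const_bound[of _ B]) (auto elim!: eventually_mono intro: assms)

lemma integrable_usphere_inner_power [simp]:
  fixes x :: "'a::euclidean_space"
  shows "integrable usphere (\<lambda>u. (x \<bullet> u) ^ n)"
proof (rule integrable_usphere_bounded)
  fix u :: 'a assume "norm u = 1"
  then have "\<bar>x \<bullet> u\<bar> \<le> norm x" using Cauchy_Schwarz_ineq2[of x u] by simp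
  then show "\<bar>(x \<bullet> u) ^ n\<bar> \<le> norm x ^ n" by (simp add: power_abs power_mono)
qed measurable

lemma usphere_integral_inner [simp]:
  fixes x :: "'a::euclidean_space"
  shows "(\<integral>u. x \<bullet> u \<partial>usphere) = 0"
proof -
  have "(\<integral>u. x \<bullet> u \<partial>usphere) = (\<integral>u. (- x) \<bullet> u \<partial>usphere)"
    by (rule usphere_inner_integral[where F="\<lambda>z. z"]) auto
  then show ?thesis by simp
qed

text \<open>All basis directions have the same second moment, and these moments sum to the mean of
  \<open>u \<bullet> u\<close>, which is 1.\<close>

lemma usphere_integral_inner_sq:
  fixes x :: "'a::euclidean_space"
  shows "(\<integral>u. (x \<bullet> u)\<^sup>2 \<partial>usphere) = (norm x)\<^sup>2 / DIM('a)"
proof -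
  have unit: "(\<integral>u. (y \<bullet> u)\<^sup>2 \<partial>usphere) = (\<integral>u. (b \<bullet> u)\<^sup>2 \<partial>usphere)" 
    if "norm y = norm b" for y b :: 'a
    using that by (rule usphere_inner_integral[where F="\<lambda>z. z\<^sup>2"]) auto
  have "(\<Sum>b\<in>(Basis :: 'a set). \<integral>u. (b \<bullet> u)\<^sup>2 \<partial>usphere) = (\<integral>u. (\<Sum>b\<in>Basis. (b \<bullet> u)\<^sup>2) \<partial>(usphere :: 'a measure))"
    by (simp add: Bochner_Integration.integral_sum)
  also have "\<dots> = (\<integral>u. 1 \<partial>(usphere :: 'a measure))"
  proof (rule integral_cong_AE)
    show "AE u in usphere. (\<Sum>b\<in>Basis. (b \<bullet> u)\<^sup>2) = (1::real)"
      using AE_usphere_norm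
    proof eventually_elim
      case (elim u)
      then have "u \<bullet> u = 1" by (simp add: norm_eq_sqrt_inner)
      then show ?case using euclidean_inner[of u u] by (simp add: power2_eq_square inner_commute)
    qed
  qed auto
  finally have s: "(\<Sum>b\<in>(Basis :: 'a set). \<integral>u. (b \<bullet> u)\<^sup>2 \<partial>(usphere :: 'a measure)) = 1"
    by simp
  obtain b0 :: 'a where b0: "b0 \<in> Basis" using nonempty_Basis by blast
  have "(\<Sum>b\<in>(Basis :: 'a set). \<integral>u. (b \<bullet> u)\<^sup>2 \<partial>(usphere :: 'a measure)) = (\<Sum>b\<in>(Basis::'a set). \<integral>u. (b0 \<bullet> u)\<^sup>2 \<partial>usphere)"
    by (intro sum.cong refl unit) (simp add: b0)
  with s have e: "(\<integral>u. (b0 \<bullet> u)\<^sup>2 \<partial>usphere) = 1 / DIM('a)" 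
    by (simp add: field_simps)
  have "(\<integral>u. (x \<bullet> u)\<^sup>2 \<partial>usphere) = (\<integral>u. ((norm x *\<^sub>R b0) \<bullet> u)\<^sup>2 \<partial>usphere)"
    by (rule unit) (simp add: b0)
  also have "\<dots> = (norm x)\<^sup>2 * (\<integral>u. (b0 \<bullet> u)\<^sup>2 \<partial>usphere)"
    by (simp add: power_mult_distrib)
  finally show ?thesis by (simp add: e)
qed

section \<open>Sphere means of continuous functions\<close>

lemma integrable_usphere_continuous:
  fixes g :: "'a::euclidean_space \<Rightarrow> real"
  assumes "continuous_on UNIV g"
  shows "integrable usphere g"
proof -
  have "compact (g ` sphere 0 1)"
    using assms by (intro compact_continuous_image) (auto intro: continuous_on_subset)
  then obtain B where "\<And>u. norm u = 1 \<Longrightarrow> norm (g u) \<le> B"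
    by (force dest!: compact_imp_bounded simp: bounded_iff)
  then show ?thesis
    by (intro integrable_usphere_bounded[where B = B] borel_measurable_continuous_onI assms) auto
qed

lemma continuous_bounded_cball_sphere:
  fixes g :: "'a::euclidean_space \<Rightarrow> 'a \<Rightarrow> real"
  assumes "continuous_on UNIV (\<lambda>p. g (fst p) (snd p))"
  obtains B where "\<And>x u. norm x \<le> r \<Longrightarrow> norm u = 1 \<Longrightarrow> \<bar>g x u\<bar> \<le> B"
proof -
  have "compact ((\<lambda>p. g (fst p) (snd p)) ` (cball 0 r \<times> sphere 0 1))"
    using assms by (intro compact_continuous_image compact_Times) (auto intro: continuous_on_subset)
  then show ?thesis using that
    by (force dest!: compact_imp_bounded simp: bounded_iff)
qed

lemma continuous_curry:
  fixes g :: "'a::topological_space \<Rightarrow> 'b::topological_space \<Rightarrow> 'c::topological_space"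
  assumes "continuous_on UNIV (\<lambda>p. g (fst p) (snd p))"
  shows "continuous_on UNIV (\<lambda>x. g x u)" "continuous_on UNIV (\<lambda>u. g x u)"
  using continuous_on_compose2[OF assms, of UNIV "\<lambda>x. (x, u)"]
    continuous_on_compose2[OF assms, of UNIV "\<lambda>u. (x, u)"]
  by (auto simp: continuous_on_Pair continuous_on_id continuous_on_const)

lemma continuous_on_usphere_integral:
  fixes g :: "'a::euclidean_space \<Rightarrow> 'a \<Rightarrow> real"
  assumes "continuous_on UNIV (\<lambda>p. g (fst p) (snd p))"
  shows "continuous_on UNIV (\<lambda>x. \<integral>u. g x u \<partial>usphere)"
proof (rule continuous_at_imp_continuous_on, rule ballI, rule continuous_at_sequentiallyI)
  fix x :: 'a and X :: "nat \<Rightarrow> 'a"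
  assume X: "X \<longlonglongrightarrow> x"
  then obtain r where r: "\<And>n. norm (X n) \<le> r"
    using convergent_imp_Bseq[of X] by (auto simp: convergent_def Bseq_def)
  obtain B where B: "\<And>x u. norm x \<le> r \<Longrightarrow> norm u = 1 \<Longrightarrow> \<bar>g x u\<bar> \<le> B"
    using continuous_bounded_cball_sphere[OF assms] by metis
  note m = continuous_curry[OF assms, THEN borel_measurable_continuous_onI]
  show "(\<lambda>n. \<integral>u. g (X n) u \<partial>usphere) \<longlonglongrightarrow> (\<integral>u. g x u \<partial>usphere)"
  proof (rule integral_dominated_convergence[where w="\<lambda>_. B"])
    show "AE u in usphere. (\<lambda>n. g (X n) u) \<longlonglongrightarrow> g x u"
    proof (rule AE_I2)
      fix u
      have "isCont (\<lambda>x. g x u) x"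
        using continuous_curry(1)[OF assms] by (simp add: continuous_on_eq_continuous_at)
      then show "(\<lambda>n. g (X n) u) \<longlonglongrightarrow> g x u"
        using X by (rule isCont_tendsto_compose)
    qed
    show "AE u in usphere. norm (g (X n) u) \<le> B" for n
      using AE_usphere_norm by eventually_elim (use B r in auto)
  qed (use m in auto)
qed

text \<open>A jointly continuous integrand is bounded on the product of the unit spheres, which
  carries the product measure, so it is integrable there.\<close>

lemma usphere_Fubini:
  fixes g :: "'a::euclidean_space \<Rightarrow> 'a \<Rightarrow> real"
  assumes "continuous_on UNIV (\<lambda>p. g (fst p) (snd p))"
  shows "(\<integral>w. (\<integral>u. g w u \<partial>usphere) \<partial>usphere) = (\<integral>u. (\<integral>w. g w u \<partial>usphere) \<partial>usphere)"
proof -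
  interpret P: pair_prob_space "usphere :: 'a measure" "usphere :: 'a measure" ..
  obtain B where B: "\<And>x u. norm x \<le> 1 \<Longrightarrow> norm u = 1 \<Longrightarrow> \<bar>g x u\<bar> \<le> B"
    using continuous_bounded_cball_sphere[OF assms] by metis
  have "integrable (usphere \<Otimes>\<^sub>M usphere) (\<lambda>p. g (fst p) (snd p))"
  proof (rule P.integrable_const_bound)
    have "AE p in usphere \<Otimes>\<^sub>M usphere. norm (fst p :: 'a) = 1 \<and> norm (snd p :: 'a) = 1"
    proof (rule P.AE_pair_measure)
      show "AE x in usphere. AE y in usphere. norm (fst (x :: 'a, y :: 'a)) = 1 \<and> norm (snd (x, y)) = 1"
        using AE_usphere_norm by eventually_elim (use AE_usphere_norm in auto)
    qed measurable
    then show "AE p in usphere \<Otimes>\<^sub>M usphere. norm (g (fst p) (snd p)) \<le> B"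
      by eventually_elim (use B in auto)
    show "(\<lambda>p. g (fst p) (snd p)) \<in> borel_measurable (usphere \<Otimes>\<^sub>M usphere)"
      using borel_measurable_continuous_onI[OF assms]
      by (simp add: borel_prod[symmetric] cong: measurable_cong_sets sets_pair_measure_cong)
  qed
  then show ?thesis
    using P.Fubini_integral[of g] by (simp add: case_prod_beta')
qed

lemma norm_add_sq: "(norm (x + y))\<^sup>2 = (norm x)\<^sup>2 + 2 * (x \<bullet> y) + (norm (y :: 'a::real_inner))\<^sup>2"
  unfolding power2_norm_eq_inner by (simp add: inner_add inner_commute)

lemma norm_add_scaleR_sq:
  fixes x u :: "'a::real_inner"
  assumes "norm u = 1"
  shows "(norm (x + r *\<^sub>R u))\<^sup>2 = (norm x)\<^sup>2 + r\<^sup>2 + 2 * r * (x \<bullet> u)"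
  using assms by (simp add: norm_add_sq power_mult_distrib)

lemma usphere_integral_norm_sq:
  fixes x :: "'a::euclidean_space"
  shows "(\<integral>u. (norm (x + r *\<^sub>R u))\<^sup>2 \<partial>usphere) = (norm x)\<^sup>2 + r\<^sup>2"
proof -
  have i: "integrable usphere (\<lambda>u. x \<bullet> u)" using integrable_usphere_inner_power[of x 1] by simp
  have "(\<integral>u. (norm (x + r *\<^sub>R u))\<^sup>2 \<partial>usphere) = (\<integral>u. (norm x)\<^sup>2 + r\<^sup>2 + 2 * r * (x \<bullet> u) \<partial>usphere)"
    by (intro integral_cong_AE) (auto intro!: eventually_mono[OF AE_usphere_norm] simp: norm_add_scaleR_sq algebra_simps)
  also have "\<dots> = (norm x)\<^sup>2 + r\<^sup>2"
    using i by (simp add: Bochner_Integration.integral_add)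
  finally show ?thesis .
qed

text \<open>On the unit sphere \<open>(norm (x + r *\<^sub>R u))\<^sup>2\<close> is
  \<open>(norm x)\<^sup>2 + r\<^sup>2 + 2 * r * (x \<bullet> u)\<close>, whose law depends only on
  the two quantities in the hypotheses. In particular the norm of the center and the radius may be
  exchanged.\<close>

lemma usphere_mean_cong:
  fixes x y :: "'a::euclidean_space" and F :: "real \<Rightarrow> real"
  assumes [measurable]: "F \<in> borel_measurable borel"
    and "(norm x)\<^sup>2 + r\<^sup>2 = (norm y)\<^sup>2 + t\<^sup>2" and "\<bar>r\<bar> * norm x = \<bar>t\<bar> * norm y"
  shows "(\<integral>u. F ((norm (x + r *\<^sub>R u))\<^sup>2) \<partial>usphere) = (\<integral>u. F ((norm (y + t *\<^sub>R u))\<^sup>2) \<partial>usphere)"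
proof -
  have *: "(\<integral>u. F ((norm (x + r *\<^sub>R u))\<^sup>2) \<partial>usphere) 
      = (\<integral>u. F ((norm x)\<^sup>2 + r\<^sup>2 + 2 * ((r *\<^sub>R x) \<bullet> u)) \<partial>usphere)" for x :: 'a and r
    by (intro integral_cong_AE) (auto intro!: eventually_mono[OF AE_usphere_norm] simp: norm_add_scaleR_sq algebra_simps)
  show ?thesis
    unfolding * assms(2)
    by (rule usphere_inner_integral[where F = "\<lambda>z. F ((norm y)\<^sup>2 + t\<^sup>2 + 2 * z)"]) (use assms(3) in auto)
qed

section \<open>A minimum principle for radial functions\<close>

text \<open>Subtracting \<open>e\<close> times the squared norm lowers the mean over a small sphere
  by a further \<open>e * q\<^sup>2\<close>, which outweighs the cubic error
  \<open>C * q ^ 3\<close>. The perturbed function \<open>G\<close> therefore has no minimum inside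
  the ball through \<open>y\<close>; it is minimal on the boundary, hence at \<open>y\<close>
  because it is radial. Letting \<open>e\<close> tend to 0 gives the claim. The constants
  \<open>C\<close> and \<open>\<delta>\<close> may vary with the point.\<close>

lemma radially_antimono:
  fixes H :: "'a::euclidean_space \<Rightarrow> real"
  assumes cont: "continuous_on UNIV H"
    and radial: "\<And>x y. norm x = norm y \<Longrightarrow> H x = H y"
    and supermean: "\<And>x. norm x < R \<Longrightarrow> 
      \<exists>C. \<exists>\<delta>>0. \<forall>q. 0 < q \<and> q < \<delta> \<longrightarrow> (\<integral>u. H (x + q *\<^sub>R u) \<partial>usphere) \<le> H x + C * q ^ 3"
    and xy: "norm x \<le> norm y" "norm y \<le> R"
  shows "H y \<le> H x"
proof (rule field_le_epsilon)
  fix e' :: real assume "0 < e'"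
  \<comment> \<open>Scaled so that the final loss
    \<open>e * ((norm y)\<^sup>2 - (norm x)\<^sup>2)\<close> is at most \<open>e'\<close>.\<close>
  define e where "e = e' / ((norm y)\<^sup>2 + 1)"
  have e: "0 < e" using \<open>0 < e'\<close> by (simp add: e_def add_nonneg_pos)
  define G where "G x = H x - e * (norm x)\<^sup>2" for x
  have contG: "continuous_on UNIV G"
    unfolding G_def by (intro continuous_intros cont)
  obtain m where m: "m \<in> cball 0 (norm y)" "\<And>z. z \<in> cball 0 (norm y) \<Longrightarrow> G m \<le> G z"
    using continuous_attains_inf[of "cball 0 (norm y)" G] continuous_on_subset[OF contG]
    by force
  have "norm m = norm y"
  proof (rule ccontr)
    assume "norm m \<noteq> norm y"
    with m(1) have lt: "norm m < norm y" by simp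
    then have "norm m < R" using xy by simp
    then obtain C \<delta> where \<delta>: "\<delta> > 0" 
      and C: "\<And>q. 0 < q \<Longrightarrow> q < \<delta> \<Longrightarrow> (\<integral>u. H (m + q *\<^sub>R u) \<partial>usphere) \<le> H m + C * q ^ 3"
      using supermean by blast
    \<comment> \<open>The three bounds make the mean estimate applicable, keep the small sphere
      inside the ball where \<open>m\<close> is minimal, and force
      \<open>C * q \<le> e / 2\<close>.\<close>
    define q where "q = min (\<delta> / 2) (min (norm y - norm m) (e / (2 * (\<bar>C\<bar> + 1))))"
    have q: "0 < q" "q < \<delta>" "q \<le> norm y - norm m" "q \<le> e / (2 * (\<bar>C\<bar> + 1))"
      using \<delta> lt e by (auto simp: q_def add_nonneg_pos)
    have iH: "integrable usphere (\<lambda>u. H (m + q *\<^sub>R u))"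
      by (intro integrable_usphere_continuous continuous_on_compose2[OF cont] continuous_intros) auto
    have iG: "integrable usphere (\<lambda>u. G (m + q *\<^sub>R u))"
      by (intro integrable_usphere_continuous continuous_on_compose2[OF contG] continuous_intros) auto
    have iN: "integrable usphere (\<lambda>u. (norm (m + q *\<^sub>R u))\<^sup>2)"
      by (intro integrable_usphere_continuous continuous_intros)
    have "G m = (\<integral>u. G m \<partial>(usphere :: 'a measure))"
      by simp
    also have "\<dots> \<le> (\<integral>u. G (m + q *\<^sub>R u) \<partial>usphere)"
    proof (rule integral_mono_AE)
      show "AE u in usphere. G m \<le> G (m + q *\<^sub>R u)"
        using AE_usphere_norm
      proof eventually_elim
        case (elim u)
        have "norm (m + q *\<^sub>R u) \<le> norm y"
          using norm_triangle_ineq[of m "q *\<^sub>R u"] q elim by simp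
        then show ?case by (intro m(2)) simp
      qed
    qed (use iG in auto)
    also have "\<dots> = (\<integral>u. H (m + q *\<^sub>R u) \<partial>usphere) - e * ((norm m)\<^sup>2 + q\<^sup>2)"
      using iH iN by (simp add: G_def usphere_integral_norm_sq)
    also have "\<dots> \<le> H m + C * q ^ 3 - e * ((norm m)\<^sup>2 + q\<^sup>2)"
      using C[OF q(1,2)] by simp
    also have "\<dots> = G m + q\<^sup>2 * (C * q - e)"
      by (simp add: G_def algebra_simps power2_eq_square power3_eq_cube)
    finally have "0 \<le> C * q - e"
      using q(1) by (simp add: zero_le_mult_iff)
    moreover have "C * q \<le> e / 2"
    proof -
      have "C * q \<le> (\<bar>C\<bar> + 1) * q" using q(1) by (intro mult_right_mono) auto
      also have "\<dots> \<le> (\<bar>C\<bar> + 1) * (e / (2 * (\<bar>C\<bar> + 1)))"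
        using q(4) by (intro mult_left_mono) auto
      also have "\<dots> = e / 2" by (simp add: field_simps)
      finally show ?thesis .
    qed
    ultimately show False using e by simp
  qed
  then have "G y = G m" unfolding G_def by (simp add: radial[of m y])
  also have "G m \<le> G x" using xy by (intro m(2)) simp
  finally have "H y \<le> H x + e * ((norm y)\<^sup>2 - (norm x)\<^sup>2)"
    by (simp add: G_def algebra_simps)
  also have "e * ((norm y)\<^sup>2 - (norm x)\<^sup>2) \<le> e * ((norm y)\<^sup>2 + 1)"
    using e by (intro mult_left_mono) (auto simp: power2_eq_square intro: order_trans[of _ 0])
  also have "\<dots> = e'" by (simp add: e_def add_nonneg_eq_0_iff)
  finally show "H y \<le> H x + e'" by simp
qed

section \<open>Second-order estimates on small spheres\<close>

lemma usphere_integral_quadratic: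
  fixes x :: "'a::euclidean_space"
  shows "(\<integral>u. A + B * (x \<bullet> u) + D * (x \<bullet> u)\<^sup>2 \<partial>usphere) = A + D * (norm x)\<^sup>2 / DIM('a)"
    and "integrable usphere (\<lambda>u. A + B * (x \<bullet> u) + D * (x \<bullet> u)\<^sup>2)"
proof -
  have i: "integrable usphere (\<lambda>u. x \<bullet> u)" using integrable_usphere_inner_power[of x 1] by simp
  show "(\<integral>u. A + B * (x \<bullet> u) + D * (x \<bullet> u)\<^sup>2 \<partial>usphere) = A + D * (norm x)\<^sup>2 / DIM('a)"
    using i by (simp add: usphere_integral_inner_sq Bochner_Integration.integral_add)
  show "integrable usphere (\<lambda>u. A + B * (x \<bullet> u) + D * (x \<bullet> u)\<^sup>2)"
    using i by auto
qed

text \<open>The remainder of the geometric series is exactly \<open>- (y ^ 3) / (1 + y)\<close>, and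
  \<open>1 + y \<ge> 1/2\<close>.\<close>

lemma inverse_one_plus_le:
  fixes y :: real
  assumes "\<bar>y\<bar> \<le> 1/2"
  shows "1 / (1 + y) \<le> 1 - y + y\<^sup>2 + 2 * \<bar>y\<bar> ^ 3"
proof -
  have y: "1 + y \<ge> 1/2" using assms by linarith
  have "1 / (1 + y) = 1 - y + y\<^sup>2 + - (y ^ 3) / (1 + y)"
    using y by (simp add: field_simps power2_eq_square power3_eq_cube)
  also have "- (y ^ 3) / (1 + y) \<le> \<bar>y\<bar> ^ 3 / (1/2)"
    using y by (intro frac_le) (auto simp: power_abs[symmetric])
  finally show ?thesis by simp
qed

text \<open>For \<open>y \<ge> 0\<close> the quadratic Taylor polynomial is already a lower bound.
  For \<open>y < 0\<close> the cubic term is \<open>y ^ 3\<close>, and the difference is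
  nonincreasing on \<open>[y, 0]\<close> because
  \<open>x\<^sup>2 / (1 + x) \<le> 2 * x\<^sup>2\<close> there.\<close>

lemma ln_one_plus_ge:
  fixes y :: real
  assumes "\<bar>y\<bar> \<le> 1/2"
  shows "ln (1 + y) \<ge> y - y\<^sup>2 / 2 - \<bar>y\<bar> ^ 3"
proof (cases "y \<ge> 0")
  case True
  have "(\<lambda>y. ln (1 + y) - y + y\<^sup>2 / 2) 0 \<le> (\<lambda>y. ln (1 + y) - y + y\<^sup>2 / 2) y"
    using True
  proof (rule DERIV_nonneg_imp_nondecreasing)
    fix x :: real assume "0 \<le> x"
    then have "((\<lambda>y. ln (1 + y) - y + y\<^sup>2 / 2) has_real_derivative x\<^sup>2 / (1 + x)) (at x)"
      by (auto intro!: derivative_eq_intros simp: field_simps power2_eq_square)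
    then show "\<exists>D. ((\<lambda>y. ln (1 + y) - y + y\<^sup>2 / 2) has_real_derivative D) (at x) \<and> D \<ge> 0"
      using \<open>0 \<le> x\<close> by (intro exI[of _ "x\<^sup>2 / (1 + x)"]) auto
  qed
  then have "0 \<le> ln (1 + y) - y + y\<^sup>2 / 2" by simp
  moreover have "0 \<le> \<bar>y\<bar> ^ 3" by simp
  ultimately show ?thesis by linarith
next
  case False
  let ?g = "\<lambda>y::real. ln (1 + y) - y + y\<^sup>2 / 2 - y ^ 3"
  have "?g y \<ge> ?g 0"
  proof (rule DERIV_nonpos_imp_nonincreasing[of y 0 ?g])
    fix x :: real assume x: "y \<le> x" "x \<le> 0"
    then have x1: "1 + x \<ge> 1/2" using assms by linarith
    then have "(?g has_real_derivative 1 / (1 + x) - 1 + x - 3 * x\<^sup>2) (at x)"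
      by (auto intro!: derivative_eq_intros)
    also have "1 / (1 + x) - 1 + x - 3 * x\<^sup>2 = x\<^sup>2 / (1 + x) - 3 * x\<^sup>2"
      using x1 by (simp add: field_simps power2_eq_square)
    finally have "(?g has_real_derivative x\<^sup>2 / (1 + x) - 3 * x\<^sup>2) (at x)" .
    moreover have "x\<^sup>2 / (1 + x) \<le> x\<^sup>2 / (1/2)"
      using x1 by (intro frac_le) auto
    then have "x\<^sup>2 / (1 + x) \<le> 3 * x\<^sup>2"
      by (rule order_trans) simp
    ultimately show "\<exists>D. (?g has_real_derivative D) (at x) \<and> D \<le> 0"
      by (intro exI[of _ "x\<^sup>2 / (1 + x) - 3 * x\<^sup>2"]) auto
  qed (use False in simp)
  then show ?thesis using False by (simp add: power3_eq_cube)
qed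

lemma norm_add_scaleR_sq_relative:
  fixes x u :: "'a::real_inner" and q :: real
  assumes "norm u = 1" "x \<noteq> 0"
  defines "k \<equiv> q / norm x"
  shows "(norm (x + q *\<^sub>R u))\<^sup>2 = (norm x)\<^sup>2 * (1 + (2 * k * (sgn x \<bullet> u) + k\<^sup>2))"
proof -
  have "(norm x)\<^sup>2 * (1 + (2 * k * (sgn x \<bullet> u) + k\<^sup>2)) = (norm x)\<^sup>2 + q\<^sup>2 + 2 * q * (x \<bullet> u)"
    using \<open>x \<noteq> 0\<close> by (simp add: k_def sgn_div_norm field_simps power2_eq_square)
  then show ?thesis using assms(1) by (simp add: norm_add_scaleR_sq)
qed

text \<open>Here \<open>y\<close> is the relative change of the squared norm when a point
  \<open>x\<close> moves by \<open>k * norm x\<close> in a direction whose cosine with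
  \<open>x\<close> is \<open>z\<close>. All bounds come from
  \<open>\<bar>y\<bar> \<le> 3 * k\<close>.\<close>

lemma relative_increment_bounds:
  fixes k z :: real
  assumes "0 \<le> k" "k \<le> 1/6" "\<bar>z\<bar> \<le> 1"
  defines "y \<equiv> 2 * k * z + k\<^sup>2"
  shows "\<bar>y\<bar> \<le> 1/2" "\<bar>y\<bar> ^ 3 \<le> 27 * k ^ 3"
    and "y\<^sup>2 = 4 * k\<^sup>2 * z\<^sup>2 + 4 * k ^ 3 * z + k ^ 4" "k ^ 4 \<le> k ^ 3"
proof -
  have "\<bar>k * z\<bar> \<le> k" using assms mult_left_mono[of "\<bar>z\<bar>" 1 k] by (simp add: abs_mult)
  moreover have "k\<^sup>2 \<le> k" using assms mult_left_mono[of k 1 k] by (simp add: power2_eq_square)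
  ultimately have y: "\<bar>y\<bar> \<le> 3 * k" unfolding y_def using abs_triangle_ineq[of "2 * k * z" "k\<^sup>2"] by (simp add: abs_mult)
  then show "\<bar>y\<bar> \<le> 1/2" using assms by linarith
  show "\<bar>y\<bar> ^ 3 \<le> 27 * k ^ 3" using power_mono[OF y, of 3] by (simp add: power_mult_distrib)
  show "y\<^sup>2 = 4 * k\<^sup>2 * z\<^sup>2 + 4 * k ^ 3 * z + k ^ 4" unfolding y_def by algebra
  show "k ^ 4 \<le> k ^ 3" using assms by (intro power_decreasing) auto
qed

text \<open>By Fubini, averaging over the small sphere and averaging over translates commute. An
  estimate for \<open>F\<close> at every center thus passes to the sphere means of
  \<open>F\<close>.\<close>

lemma usphere_mean_shift:
  fixes F G :: "'a::euclidean_space \<Rightarrow> real"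
  assumes F: "continuous_on UNIV F" and G: "continuous_on UNIV G"
    and le: "\<And>x. (\<integral>w. F (x + q *\<^sub>R w) \<partial>usphere) \<le> G x"
  shows "(\<integral>w. (\<integral>u. F (x + q *\<^sub>R w + t *\<^sub>R u) \<partial>usphere) \<partial>usphere) \<le> (\<integral>u. G (x + t *\<^sub>R u) \<partial>usphere)"
proof -
  have c: "continuous_on UNIV (\<lambda>p. F (x + q *\<^sub>R fst p + t *\<^sub>R snd p))"
    by (intro continuous_on_compose2[OF F] continuous_intros) auto
  have c': "continuous_on UNIV (\<lambda>p. F (x + q *\<^sub>R snd p + t *\<^sub>R fst p))"
    by (intro continuous_on_compose2[OF F] continuous_intros) auto
  have "(\<integral>w. (\<integral>u. F (x + q *\<^sub>R w + t *\<^sub>R u) \<partial>usphere) \<partial>usphere)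
      = (\<integral>u. (\<integral>w. F (x + q *\<^sub>R w + t *\<^sub>R u) \<partial>usphere) \<partial>usphere)"
    using c by (rule usphere_Fubini)
  also have "\<dots> \<le> (\<integral>u. G (x + t *\<^sub>R u) \<partial>usphere)"
  proof (rule integral_mono)
    show "integrable usphere (\<lambda>u. \<integral>w. F (x + q *\<^sub>R w + t *\<^sub>R u) \<partial>usphere)"
      by (intro integrable_usphere_continuous continuous_on_usphere_integral c')
    show "integrable usphere (\<lambda>u. G (x + t *\<^sub>R u))"
      by (intro integrable_usphere_continuous continuous_on_compose2[OF G] continuous_intros) auto
    fix u
    show "(\<integral>w. F (x + q *\<^sub>R w + t *\<^sub>R u) \<partial>usphere) \<le> G (x + t *\<^sub>R u)"
      using le[of "x + t *\<^sub>R u"] by (simp add: algebra_simps)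
  qed
  finally show ?thesis .
qed

section \<open>Sphere means of truncated radial profiles\<close>

text \<open>The profile stands for \<open>v \<mapsto> s v / v\<close> frozen below \<open>\<epsilon>\<close>: the truncation makes the error terms below uniform
  in the center of the small sphere.\<close>

locale truncated_profile =
  fixes \<phi> :: "real \<Rightarrow> real" and \<epsilon> :: real
  assumes eps: "0 < \<epsilon>" 
    and cont: "continuous_on UNIV \<phi>" 
    and nonneg: "0 \<le> \<phi> v" 
    and antimono: "v \<le> w \<Longrightarrow> \<phi> w \<le> \<phi> v"
    and const: "v \<le> \<epsilon> \<Longrightarrow> \<phi> v = \<phi> 0"
    and numerator_mono: "0 \<le> v \<Longrightarrow> v \<le> w \<Longrightarrow> v * \<phi> v \<le> w * \<phi> w"
    and support: "\<epsilon> \<le> v \<Longrightarrow> \<exists>\<alpha>\<ge>0. \<exists>\<beta>\<ge>0. \<phi> v = \<alpha> / v + \<beta> \<and> (\<forall>w>0. \<phi> w \<le> \<alpha> / w + \<beta>)"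
begin

lemma continuous_on_profile:
  assumes "continuous_on S g"
  shows "continuous_on S (\<lambda>x. \<phi> (g x))"
  by (rule continuous_on_compose2[OF cont assms]) auto

lemma profile_le_0: "\<phi> v \<le> \<phi> 0"
proof (cases "0 \<le> v")
  case False
  then show ?thesis using const[of v] eps by simp
qed (rule antimono)

lemma measurable_profile [measurable]: "\<phi> \<in> borel_measurable borel"
  using cont by (rule borel_measurable_continuous_onI)

text \<open>Beyond \<open>\<epsilon>\<close> the bound from \<open>support\<close> touches
  \<open>\<phi>\<close> at the center and lies above it elsewhere, so it suffices to average
  \<open>\<alpha> / \<parallel>x\<parallel>\<^sup>2 + \<beta>\<close>, which is superharmonic from
  dimension 4 on. Up to \<open>\<epsilon>\<close> the center value is the maximum of
  \<open>\<phi>\<close>.\<close>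

lemma supermean:
  assumes d: "DIM('a::euclidean_space) \<ge> 4"
  shows "\<exists>C. \<exists>\<delta>>0. \<forall>(x :: 'a) q. 0 < q \<and> q < \<delta> \<longrightarrow>
    (\<integral>u. \<phi> ((norm (x + q *\<^sub>R u))\<^sup>2) \<partial>usphere) \<le> \<phi> ((norm x)\<^sup>2) + C * q ^ 3"
\<comment> \<open>With \<open>norm x > sqrt \<epsilon>\<close>, the radius bound gives
  \<open>k \<le> 1/6\<close>. The constant 55 is \<open>2 * 27\<close> from the cubic remainder plus
  1 from \<open>k ^ 4 \<le> k ^ 3\<close>.\<close>
proof (rule exI[of _ "55 * \<phi> 0 / sqrt \<epsilon> ^ 3"], rule exI[of _ "sqrt \<epsilon> / 6"], intro conjI allI impI)
  show "0 < sqrt \<epsilon> / 6" using eps by simp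
  fix x :: 'a and q :: real assume "0 < q \<and> q < sqrt \<epsilon> / 6"
  then have q: "0 < q" "q < sqrt \<epsilon> / 6" by auto
  have int: "integrable usphere (\<lambda>u. \<phi> ((norm (x + q *\<^sub>R u))\<^sup>2))"
    by (intro integrable_usphere_continuous continuous_on_profile continuous_intros)
  show "(\<integral>u. \<phi> ((norm (x + q *\<^sub>R u))\<^sup>2) \<partial>usphere) \<le> \<phi> ((norm x)\<^sup>2) + 55 * \<phi> 0 / sqrt \<epsilon> ^ 3 * q ^ 3"
  proof (cases "(norm x)\<^sup>2 \<le> \<epsilon>")
    case True
    have "(\<integral>u. \<phi> ((norm (x + q *\<^sub>R u))\<^sup>2) \<partial>usphere) \<le> (\<integral>u. \<phi> 0 \<partial>(usphere :: 'a measure))"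
      by (intro integral_mono int profile_le_0) auto
    also have "\<dots> = \<phi> ((norm x)\<^sup>2)" using const[OF True] by simp
    also have "\<dots> \<le> \<phi> ((norm x)\<^sup>2) + 55 * \<phi> 0 / sqrt \<epsilon> ^ 3 * q ^ 3"
      using q eps nonneg[of 0] by simp
    finally show ?thesis .
  next
    case False
    define v where "v = (norm x)\<^sup>2"
    define k where "k = q / norm x"
    have v: "v > \<epsilon>" "v > 0" using False eps by (auto simp: v_def)
    then have x0: "x \<noteq> 0" by (auto simp: v_def)
    have nx: "sqrt \<epsilon> < norm x" using v(1) eps by (simp add: v_def real_less_lsqrt)
    have k: "0 \<le> k" "k \<le> 1/6" using q nx x0 by (auto simp: k_def field_simps)
    obtain \<alpha> \<beta> where ab: "\<alpha> \<ge> 0" "\<beta> \<ge> 0" "\<phi> v = \<alpha> / v + \<beta>" "\<And>w. w > 0 \<Longrightarrow> \<phi> w \<le> \<alpha> / w + \<beta>"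
      using support[of v] v by auto
    define a where "a = \<alpha> / v"
    have a: "0 \<le> a" "a \<le> \<phi> 0" using ab v profile_le_0[of v] by (auto simp: a_def)
    let ?A = "a * (1 - k\<^sup>2 + k ^ 4 + 54 * k ^ 3) + \<beta>" and ?B = "a * (4 * k ^ 3 - 2 * k)" and ?D = "a * (4 * k\<^sup>2)"
    have "(\<integral>u. \<phi> ((norm (x + q *\<^sub>R u))\<^sup>2) \<partial>usphere) \<le> (\<integral>u. ?A + ?B * (sgn x \<bullet> u) + ?D * (sgn x \<bullet> u)\<^sup>2 \<partial>usphere)"
    proof (intro integral_mono_AE int usphere_integral_quadratic)
      show "AE u in usphere. \<phi> ((norm (x + q *\<^sub>R u))\<^sup>2) \<le> ?A + ?B * (sgn x \<bullet> u) + ?D * (sgn x \<bullet> u)\<^sup>2"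
        using AE_usphere_norm
      proof eventually_elim
        case (elim u)
        define z where "z = sgn x \<bullet> u"
        define y where "y = 2 * k * z + k\<^sup>2"
        have "\<bar>z\<bar> \<le> 1" using Cauchy_Schwarz_ineq2[of "sgn x" u] elim x0 by (simp add: z_def norm_sgn)
        note y = relative_increment_bounds[OF k this, folded y_def]
        have y1: "1 + y > 0" using y(1) by linarith
        have "(norm (x + q *\<^sub>R u))\<^sup>2 = v * (1 + y)"
          unfolding v_def y_def z_def k_def using elim x0 by (rule norm_add_scaleR_sq_relative)
        then have "\<phi> ((norm (x + q *\<^sub>R u))\<^sup>2) \<le> \<alpha> / (v * (1 + y)) + \<beta>"
          using ab(4)[of "v * (1 + y)"] v y1 by simp
        also have "\<alpha> / (v * (1 + y)) = a * (1 / (1 + y))" by (simp add: a_def)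
        also have "\<dots> \<le> a * (1 - y + y\<^sup>2 + 2 * \<bar>y\<bar> ^ 3)"
          using inverse_one_plus_le[OF y(1)] a by (intro mult_left_mono)
        also have "\<dots> \<le> a * (1 - y + y\<^sup>2 + 54 * k ^ 3)"
          using y(2) a by (intro mult_left_mono) auto
        also have "\<dots> + \<beta> = ?A + ?B * z + ?D * z\<^sup>2"
          unfolding y(3) unfolding y_def by (simp add: algebra_simps)
        finally show ?case by (simp add: z_def)
      qed
    qed
    also have "\<dots> = ?A + ?D / DIM('a)"
      using x0 by (simp only: usphere_integral_quadratic) (simp add: norm_sgn)
    \<comment> \<open>The dimension bound enters here: the positive term
      \<open>4 * k\<^sup>2 / DIM('a)\<close> is absorbed by \<open>- k\<^sup>2\<close> in
      \<open>?A\<close>.\<close>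
    also have "?D / DIM('a) \<le> ?D / 4"
      using d a by (intro divide_left_mono) auto
    also have "?A + ?D / 4 \<le> a * (1 - k\<^sup>2 + k ^ 3 + 54 * k ^ 3) + \<beta> + ?D / 4"
      using a k relative_increment_bounds(4)[OF k, of 0] by (intro add_mono mult_left_mono) auto
    also have "\<dots> = \<phi> v + 55 * a * k ^ 3" by (simp add: ab(3) a_def algebra_simps)
    also have "\<dots> \<le> \<phi> v + 55 * \<phi> 0 * (q ^ 3 / sqrt \<epsilon> ^ 3)"
    proof -
      have "k ^ 3 \<le> q ^ 3 / sqrt \<epsilon> ^ 3"
        unfolding k_def power_divide using nx q eps x0 by (intro divide_left_mono power_mono) auto
      then show ?thesis using a k by (intro add_left_mono mult_mono) auto
    qed
    finally show ?thesis by (simp add: v_def)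
  qed
qed

lemma mean_radial:
  fixes x y :: "'a::euclidean_space"
  assumes "norm x = norm y"
  shows "(\<integral>u. \<phi> ((norm (x + t *\<^sub>R u))\<^sup>2) \<partial>usphere) = (\<integral>u. \<phi> ((norm (y + t *\<^sub>R u))\<^sup>2) \<partial>usphere)"
  by (rule usphere_mean_cong) (use assms in auto)

text \<open>As a function of its center the sphere mean is radial and continuous, and by
  \<open>usphere_mean_shift\<close> it inherits the estimate \<open>supermean\<close>; the minimum
  principle then applies.\<close>

lemma mean_antimono:
  fixes x y :: "'a::euclidean_space"
  assumes d: "DIM('a::euclidean_space) \<ge> 4" and "norm x \<le> norm y"
  shows "(\<integral>u. \<phi> ((norm (y + t *\<^sub>R u))\<^sup>2) \<partial>usphere) \<le> (\<integral>u. \<phi> ((norm (x + t *\<^sub>R u))\<^sup>2) \<partial>usphere)"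
proof (rule radially_antimono[where R = "norm y" and H = "\<lambda>x. \<integral>u. \<phi> ((norm (x + t *\<^sub>R u))\<^sup>2) \<partial>usphere"])
  obtain C \<delta> where \<delta>: "\<delta> > 0" and C: "\<And>x q. 0 < q \<Longrightarrow> q < \<delta> \<Longrightarrow> 
    (\<integral>u. \<phi> ((norm ((x::'a) + q *\<^sub>R u))\<^sup>2) \<partial>usphere) \<le> \<phi> ((norm x)\<^sup>2) + C * q ^ 3"
    using supermean[OF d] by blast
  show "\<exists>C. \<exists>\<delta>>0. \<forall>q. 0 < q \<and> q < \<delta> \<longrightarrow> 
      (\<integral>w. (\<integral>u. \<phi> ((norm (z + q *\<^sub>R w + t *\<^sub>R u))\<^sup>2) \<partial>usphere) \<partial>usphere)
      \<le> (\<integral>u. \<phi> ((norm (z + t *\<^sub>R u))\<^sup>2) \<partial>usphere) + C * q ^ 3" for z :: 'a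
  proof (rule exI[of _ C], rule exI[of _ \<delta>], intro conjI allI impI \<delta>)
    fix q assume q: "0 < q \<and> q < \<delta>"
    have "(\<integral>w. (\<integral>u. \<phi> ((norm (z + q *\<^sub>R w + t *\<^sub>R u))\<^sup>2) \<partial>usphere) \<partial>usphere)
        \<le> (\<integral>u. \<phi> ((norm (z + t *\<^sub>R u))\<^sup>2) + C * q ^ 3 \<partial>usphere)"
      by (rule usphere_mean_shift[where F = "\<lambda>x. \<phi> ((norm x)\<^sup>2)" and G = "\<lambda>x. \<phi> ((norm x)\<^sup>2) + C * q ^ 3"])
         (use q C in \<open>auto intro!: continuous_on_profile continuous_intros\<close>)
    also have "\<dots> = (\<integral>u. \<phi> ((norm (z + t *\<^sub>R u))\<^sup>2) \<partial>usphere) + C * q ^ 3"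
      by (subst Bochner_Integration.integral_add)
         (auto intro!: integrable_usphere_continuous continuous_on_profile continuous_intros)
    finally show "(\<integral>w. (\<integral>u. \<phi> ((norm (z + q *\<^sub>R w + t *\<^sub>R u))\<^sup>2) \<partial>usphere) \<partial>usphere)
      \<le> (\<integral>u. \<phi> ((norm (z + t *\<^sub>R u))\<^sup>2) \<partial>usphere) + C * q ^ 3" .
  qed
qed (use assms in \<open>auto intro!: continuous_on_usphere_integral continuous_on_profile continuous_intros mean_radial\<close>)

section \<open>The potential of the shrinkage field\<close>

lemma antiderivative:
  obtains \<Phi> where "\<And>v. (\<Phi> has_real_derivative \<phi> v) (at v)"
proof -
  have "\<exists>F. \<forall>x. -\<infinity> < ereal x \<longrightarrow> ereal x < \<infinity> \<longrightarrow> (F has_vector_derivative \<phi> x) (at x)"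
    using cont by (intro einterval_antiderivative) (auto simp: continuous_on_eq_continuous_at)
  then show ?thesis using that by (auto simp: has_real_derivative_iff_has_vector_derivative)
qed

lemma antiderivative_concave:
  assumes \<Phi>: "\<And>v. (\<Phi> has_real_derivative \<phi> v) (at v)"
  shows "\<Phi> w - \<Phi> v \<le> \<phi> v * (w - v)"
proof (cases w v rule: linorder_cases)
  case less
  obtain z where "w < z" "z < v" "\<Phi> v - \<Phi> w = (v - w) * \<phi> z"
    using MVT2[OF less, of \<Phi> \<phi>] \<Phi> by blast
  moreover have "(v - w) * \<phi> v \<le> (v - w) * \<phi> z"
    using calculation less by (intro mult_left_mono antimono) auto
  ultimately show ?thesis by (simp add: algebra_simps)
next
  case greater
  obtain z where "v < z" "z < w" "\<Phi> w - \<Phi> v = (w - v) * \<phi> z"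
    using MVT2[OF greater, of \<Phi> \<phi>] \<Phi> by blast
  moreover have "(w - v) * \<phi> z \<le> (w - v) * \<phi> v"
    using calculation greater by (intro mult_left_mono antimono) auto
  ultimately show ?thesis by (simp add: algebra_simps)
qed simp

text \<open>Since \<open>v * \<phi> v\<close> is nondecreasing, \<open>\<Phi>\<close> is a convex
  function of \<open>ln v\<close> on the positive axis. This is its tangent inequality in that
  variable.\<close>

lemma antiderivative_ge_ln:
  assumes \<Phi>: "\<And>v. (\<Phi> has_real_derivative \<phi> v) (at v)" and vw: "0 < v" "0 < w"
  shows "v * \<phi> v * ln (w / v) \<le> \<Phi> w - \<Phi> v"
proof -
  let ?g = "\<lambda>x. \<Phi> x - v * \<phi> v * ln x"
  have D: "(?g has_real_derivative (x * \<phi> x - v * \<phi> v) / x) (at x)" if "0 < x" for x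
    using that by (auto intro!: derivative_eq_intros \<Phi> simp: field_simps)
  have "?g v \<le> ?g w"
  proof (cases "v \<le> w")
    case True
    then show ?thesis
    proof (rule DERIV_nonneg_imp_nondecreasing[of v w ?g])
      fix x assume "v \<le> x" "x \<le> w"
      then show "\<exists>y. (?g has_real_derivative y) (at x) \<and> 0 \<le> y"
        using D[of x] numerator_mono[of v x] vw
        by (intro exI[of _ "(x * \<phi> x - v * \<phi> v) / x"]) auto
    qed
  next
    case False
    show ?thesis
    proof (rule DERIV_nonpos_imp_nonincreasing[of w v ?g])
      fix x assume "w \<le> x" "x \<le> v"
      then show "\<exists>y. (?g has_real_derivative y) (at x) \<and> y \<le> 0"
        using D[of x] numerator_mono[of x v] vw
        by (intro exI[of _ "(x * \<phi> x - v * \<phi> v) / x"]) (auto simp: divide_nonpos_pos)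
    qed (use False in simp)
  qed
  then show ?thesis using vw by (simp add: ln_div algebra_simps)
qed

text \<open>Half of \<open>x \<mapsto> \<Phi> (\<parallel>x\<parallel>\<^sup>2)\<close> is a potential of the vector field \<open>\<phi> (\<parallel>x\<parallel>\<^sup>2) x\<close>, whose divergence is at
  least \<open>(d - 2) \<phi> (\<parallel>x\<parallel>\<^sup>2)\<close>.\<close>

lemma antiderivative_submean:
  assumes \<Phi>: "\<And>v. (\<Phi> has_real_derivative \<phi> v) (at v)"
  shows "\<exists>C. \<exists>\<delta>>0. \<forall>(x :: 'a::euclidean_space) q. 0 < q \<and> q < \<delta> \<longrightarrow>
    \<Phi> ((norm x)\<^sup>2) + (real DIM('a) - 2) / DIM('a) * q\<^sup>2 * \<phi> ((norm x)\<^sup>2) - C * q ^ 3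
    \<le> (\<integral>u. \<Phi> ((norm (x + q *\<^sub>R u))\<^sup>2) \<partial>usphere)"
\<comment> \<open>The case split is at \<open>norm x = sqrt \<epsilon> / 2\<close>; beyond it,
  \<open>q < sqrt \<epsilon> / 12\<close> gives \<open>k \<le> 1/6\<close>. The logarithmic error is
  at most \<open>28 * S * k ^ 3\<close>, and replacing \<open>norm x\<close> by
  \<open>sqrt \<epsilon> / 2\<close> doubles 28 to 56.\<close>
proof (rule exI[of _ "56 * \<phi> 0 / sqrt \<epsilon>"], rule exI[of _ "sqrt \<epsilon> / 12"], intro conjI allI impI)
  show "0 < sqrt \<epsilon> / 12" using eps by simp
  have contP: "continuous_on UNIV \<Phi>"
    using \<Phi> by (intro DERIV_continuous_on) auto
  fix x :: 'a and q :: real assume "0 < q \<and> q < sqrt \<epsilon> / 12"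
  then have q: "0 < q" "q < sqrt \<epsilon> / 12" by auto
  have int: "integrable usphere (\<lambda>u. \<Phi> ((norm (x + q *\<^sub>R u))\<^sup>2))"
    by (intro integrable_usphere_continuous continuous_on_compose2[OF contP] continuous_intros) auto
  have e0: "0 \<le> \<phi> 0 * q ^ 3 / sqrt \<epsilon>" using nonneg q eps by simp
  define v where "v = (norm x)\<^sup>2"
  show "\<Phi> ((norm x)\<^sup>2) + (real DIM('a) - 2) / DIM('a) * q\<^sup>2 * \<phi> ((norm x)\<^sup>2) - 56 * \<phi> 0 / sqrt \<epsilon> * q ^ 3
    \<le> (\<integral>u. \<Phi> ((norm (x + q *\<^sub>R u))\<^sup>2) \<partial>usphere)"
  proof (cases "norm x \<le> sqrt \<epsilon> / 2")
    case True
    \<comment> \<open>Near the origin the whole small sphere lies where \<open>\<phi>\<close> is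
      frozen. There \<open>\<Phi>\<close> is affine and its mean is computed exactly, with
      coefficient 1 in place of the smaller \<open>(d - 2) / d\<close>.\<close>
    have lin: "\<Phi> w = \<Phi> v + \<phi> 0 * (w - v)" if "v \<le> \<epsilon>" "w \<le> \<epsilon>" for v w
    proof -
      have "\<Phi> w - \<Phi> v \<le> \<phi> 0 * (w - v)" "\<Phi> v - \<Phi> w \<le> \<phi> 0 * (v - w)"
        using antiderivative_concave[OF \<Phi>, of w v] antiderivative_concave[OF \<Phi>, of v w] const that by auto
      then show ?thesis by (simp add: algebra_simps)
    qed
    have sq: "z\<^sup>2 \<le> \<epsilon>" if "0 \<le> z" "z \<le> sqrt \<epsilon>" for z
      using power_mono[OF that(2,1), of 2] eps by simp
    have ve: "v \<le> \<epsilon>" unfolding v_def using True q norm_ge_zero[of x] by (intro sq) linarith+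
    have "(\<integral>u. \<Phi> ((norm (x + q *\<^sub>R u))\<^sup>2) \<partial>usphere) 
        = (\<integral>u. (\<Phi> v - \<phi> 0 * v) + \<phi> 0 * (norm (x + q *\<^sub>R u))\<^sup>2 \<partial>usphere)"
    proof (rule integral_cong_AE)
      show "AE u in usphere. \<Phi> ((norm (x + q *\<^sub>R u))\<^sup>2) = (\<Phi> v - \<phi> 0 * v) + \<phi> 0 * (norm (x + q *\<^sub>R u))\<^sup>2"
        using AE_usphere_norm
      proof eventually_elim
        case (elim u)
        have "norm (x + q *\<^sub>R u) \<le> sqrt \<epsilon>"
          using norm_triangle_ineq[of x "q *\<^sub>R u"] elim q True by simp
        then have "(norm (x + q *\<^sub>R u))\<^sup>2 \<le> \<epsilon>" by (intro sq) auto
        then show ?case using lin[OF ve, of "(norm (x + q *\<^sub>R u))\<^sup>2"] by (simp add: algebra_simps)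
      qed
    qed (use int in auto)
    also have "\<dots> = (\<Phi> v - \<phi> 0 * v) + \<phi> 0 * (v + q\<^sup>2)"
      using usphere_integral_norm_sq[of x q]
      by (subst Bochner_Integration.integral_add)
         (auto simp: v_def intro!: integrable_usphere_continuous continuous_intros)
    also have "\<dots> = \<Phi> v + 1 * q\<^sup>2 * \<phi> 0" by (simp add: algebra_simps)
    also have "\<dots> \<ge> \<Phi> v + (real DIM('a) - 2) / DIM('a) * q\<^sup>2 * \<phi> 0"
      using nonneg by (intro add_left_mono mult_right_mono) (auto simp: field_simps)
    finally show ?thesis
      using e0 const[OF ve] by (simp add: v_def)
  next
    case False
    define k where "k = q / norm x"
    have nx: "sqrt \<epsilon> / 2 < norm x" using False by simp
    then have npos: "0 < norm x" using eps by (meson half_gt_zero less_trans real_sqrt_gt_zero)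
    then have x0: "x \<noteq> 0" and v: "v > 0" by (auto simp: v_def)
    have k: "0 \<le> k" "k \<le> 1/6" using q nx npos by (auto simp: k_def field_simps)
    define S where "S = v * \<phi> v"
    have S: "0 \<le> S" using v nonneg by (simp add: S_def)
    let ?A = "\<Phi> v + S * (k\<^sup>2 - k ^ 4 / 2 - 27 * k ^ 3)" and ?B = "S * (2 * k - 2 * k ^ 3)" and ?D = "- S * (2 * k\<^sup>2)"
    have "\<Phi> v + S * (k\<^sup>2 - 2 * k\<^sup>2 / DIM('a)) - 28 * S * k ^ 3 \<le> ?A + ?D / DIM('a)"
    proof -
      have "S * k ^ 4 \<le> S * k ^ 3" 
        using S relative_increment_bounds(4)[OF k, of 0] by (intro mult_left_mono) auto
      moreover have "0 \<le> S * k ^ 3" using S k by simp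
      ultimately show ?thesis by (simp add: algebra_simps)
    qed
    also have "?A + ?D / DIM('a) = (\<integral>u. ?A + ?B * (sgn x \<bullet> u) + ?D * (sgn x \<bullet> u)\<^sup>2 \<partial>usphere)"
      using x0 by (simp only: usphere_integral_quadratic) (simp add: norm_sgn)
    also have "\<dots> \<le> (\<integral>u. \<Phi> ((norm (x + q *\<^sub>R u))\<^sup>2) \<partial>usphere)"
    proof (intro integral_mono_AE int usphere_integral_quadratic)
      show "AE u in usphere. ?A + ?B * (sgn x \<bullet> u) + ?D * (sgn x \<bullet> u)\<^sup>2 \<le> \<Phi> ((norm (x + q *\<^sub>R u))\<^sup>2)"
        using AE_usphere_norm
      proof eventually_elim
        case (elim u)
        define z where "z = sgn x \<bullet> u"
        define y where "y = 2 * k * z + k\<^sup>2"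
        have "\<bar>z\<bar> \<le> 1" using Cauchy_Schwarz_ineq2[of "sgn x" u] elim x0 by (simp add: z_def norm_sgn)
        note y = relative_increment_bounds[OF k this, folded y_def]
        have y1: "1 + y > 0" using y(1) by linarith
        have "?A + ?B * z + ?D * z\<^sup>2 = \<Phi> v + S * (y - y\<^sup>2 / 2 - 27 * k ^ 3)"
          unfolding y(3) unfolding y_def by (simp add: algebra_simps)
        also have "\<dots> \<le> \<Phi> v + S * (y - y\<^sup>2 / 2 - \<bar>y\<bar> ^ 3)"
          using y(2) S by (intro add_left_mono mult_left_mono) auto
        also have "\<dots> \<le> \<Phi> v + S * ln (1 + y)"
          using ln_one_plus_ge[OF y(1)] S by (intro add_left_mono mult_left_mono)
        also have "\<dots> \<le> \<Phi> (v * (1 + y))"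
          using antiderivative_ge_ln[OF \<Phi>, of v "v * (1 + y)"] v y1 by (simp add: S_def)
        also have "v * (1 + y) = (norm (x + q *\<^sub>R u))\<^sup>2"
          unfolding v_def y_def z_def k_def using norm_add_scaleR_sq_relative[OF elim x0] by simp
        finally show ?case by (simp add: z_def)
      qed
    qed
    finally have main: "\<Phi> v + S * (k\<^sup>2 - 2 * k\<^sup>2 / DIM('a)) - 28 * S * k ^ 3 
      \<le> (\<integral>u. \<Phi> ((norm (x + q *\<^sub>R u))\<^sup>2) \<partial>usphere)" .
    have "S * k\<^sup>2 = q\<^sup>2 * \<phi> v"
      using x0 by (simp add: S_def k_def v_def power_divide)
    moreover have "S * (k\<^sup>2 - 2 * k\<^sup>2 / DIM('a)) = (real DIM('a) - 2) / DIM('a) * (S * k\<^sup>2)"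
      by (simp add: field_simps)
    ultimately have 1: "S * (k\<^sup>2 - 2 * k\<^sup>2 / DIM('a)) = (real DIM('a) - 2) / DIM('a) * q\<^sup>2 * \<phi> v"
      by simp
    have "S * k ^ 3 = \<phi> v * q ^ 3 / norm x"
      using x0 by (simp add: S_def k_def v_def field_simps power2_eq_square power3_eq_cube)
    also have "\<dots> \<le> \<phi> 0 * q ^ 3 / (sqrt \<epsilon> / 2)"
      using profile_le_0[of v] nonneg[of 0] nx q eps by (intro frac_le mult_right_mono) auto
    finally have 2: "28 * S * k ^ 3 \<le> 56 * \<phi> 0 / sqrt \<epsilon> * q ^ 3" by simp
    show ?thesis using main 1 2 unfolding v_def by linarith
  qed
qed

text \<open>The divergence theorem on a ball, as an inequality: the minimum principle applies to a multiple of
  \<open>\<parallel>x\<parallel>\<^sup>2\<close> minus the sphere means of the potential, and the claim is its one-sided derivative at radius \<open>r\<close>.\<close>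

lemma flux_ge:
  fixes \<theta> :: "'a::euclidean_space"
  assumes d: "DIM('a) \<ge> 4" and r: "0 < r"
  shows "(real DIM('a) - 2) / DIM('a) * r\<^sup>2 * (\<integral>u. \<phi> ((norm (\<theta> + r *\<^sub>R u))\<^sup>2) \<partial>usphere)
    \<le> (\<integral>u. \<phi> ((norm (\<theta> + r *\<^sub>R u))\<^sup>2) * (r * (\<theta> \<bullet> u) + r\<^sup>2) \<partial>usphere)"
proof -
  obtain \<Phi> where \<Phi>: "\<And>v. (\<Phi> has_real_derivative \<phi> v) (at v)"
    using antiderivative by blast
  have contP: "continuous_on UNIV \<Phi>"
    using \<Phi> by (intro DERIV_continuous_on) auto
  have contP': "continuous_on S (\<lambda>x. \<Phi> (g x))" if "continuous_on S g" for S :: "'c::topological_space set" and g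
    by (rule continuous_on_compose2[OF contP that]) auto
  obtain b :: 'a where "b \<in> Basis" using nonempty_Basis by blast
  then have b: "norm b = 1" by simp
  define t where "t = norm \<theta>"
  \<comment> \<open>The roles of center and radius are exchanged: \<open>\<theta>\<close> enters
    through the radius \<open>t\<close>, and the variable radius becomes the norm of the center
    \<open>x\<close>, where the minimum principle works.\<close>
  define Q where "Q x = (\<integral>u. \<Phi> ((norm (x + t *\<^sub>R u))\<^sup>2) \<partial>usphere)" for x :: 'a
  define H where "H x = (\<integral>u. \<phi> ((norm (x + t *\<^sub>R u))\<^sup>2) \<partial>usphere)" for x :: 'a
  define c where "c = (real DIM('a) - 2) / DIM('a) * H (r *\<^sub>R b)"
  define G where "G x = c * (norm x)\<^sup>2 - Q x" for x
  have contQ: "continuous_on UNIV Q"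
    unfolding Q_def by (intro continuous_on_usphere_integral contP' continuous_intros)
  obtain C \<delta> where \<delta>: "\<delta> > 0" and C: "\<And>x q. 0 < q \<Longrightarrow> q < \<delta> \<Longrightarrow> 
      \<Phi> ((norm (x::'a))\<^sup>2) + (real DIM('a) - 2) / DIM('a) * q\<^sup>2 * \<phi> ((norm x)\<^sup>2) - C * q ^ 3
      \<le> (\<integral>u. \<Phi> ((norm (x + q *\<^sub>R u))\<^sup>2) \<partial>usphere)"
    using antiderivative_submean[OF \<Phi>, where 'a = 'a] by blast
  have G: "G (r *\<^sub>R b) \<le> G (r' *\<^sub>R b)" if r': "0 < r'" "r' < r" for r'
  proof (rule radially_antimono[where R = r and H = G])
    show "continuous_on UNIV G"
      unfolding G_def by (intro continuous_intros contQ)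
    show "G x = G y" if "norm x = norm y" for x y
    proof -
      have "Q x = Q y" unfolding Q_def
        by (rule usphere_mean_cong) (use that contP in \<open>auto intro: borel_measurable_continuous_onI\<close>)
      then show ?thesis by (simp add: G_def that)
    qed
    show "\<exists>C. \<exists>\<delta>>0. \<forall>q. 0 < q \<and> q < \<delta> \<longrightarrow> (\<integral>w. G (x + q *\<^sub>R w) \<partial>usphere) \<le> G x + C * q ^ 3"
      if x: "norm x < r" for x
    proof (rule exI[of _ C], rule exI[of _ \<delta>], intro conjI allI impI \<delta>)
      fix q assume q: "0 < q \<and> q < \<delta>"
      define c' where "c' = (real DIM('a) - 2) / DIM('a) * q\<^sup>2"
      have c': "0 \<le> c'" using d by (simp add: c'_def)
      have "(\<integral>w. (\<integral>u. - \<Phi> ((norm (x + q *\<^sub>R w + t *\<^sub>R u))\<^sup>2) \<partial>usphere) \<partial>usphere)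
        \<le> (\<integral>u. (- \<Phi> ((norm (x + t *\<^sub>R u))\<^sup>2) - c' * \<phi> ((norm (x + t *\<^sub>R u))\<^sup>2)) + C * q ^ 3 \<partial>usphere)"
      proof (rule usphere_mean_shift[where F = "\<lambda>x. - \<Phi> ((norm x)\<^sup>2)" 
            and G = "\<lambda>x. (- \<Phi> ((norm x)\<^sup>2) - c' * \<phi> ((norm x)\<^sup>2)) + C * q ^ 3"])
        show "(\<integral>w. - \<Phi> ((norm (x + q *\<^sub>R w))\<^sup>2) \<partial>usphere)
            \<le> (- \<Phi> ((norm x)\<^sup>2) - c' * \<phi> ((norm x)\<^sup>2)) + C * q ^ 3" for x :: 'a
          using C[of q x] q by (simp add: c'_def)
      qed (intro continuous_intros contP' continuous_on_profile)+
      also have "\<dots> = - Q x - c' * H x + C * q ^ 3"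
        unfolding Q_def H_def
        by (subst Bochner_Integration.integral_add Bochner_Integration.integral_diff;
            (subst Bochner_Integration.integral_diff)?;
            (intro integrable_usphere_continuous continuous_intros contP' continuous_on_profile)?)
           auto
      finally have 1: "- (\<integral>w. Q (x + q *\<^sub>R w) \<partial>usphere) \<le> - Q x - c' * H x + C * q ^ 3"
        by (simp add: Q_def)
      \<comment> \<open>Sphere means decrease with the norm of the center, so the constant
        \<open>c\<close> taken on the boundary bounds the divergence term throughout the
        ball.\<close>
      have "H (r *\<^sub>R b) \<le> H x"
        unfolding H_def using x r b by (intro mean_antimono d) auto
      then have "c' * H (r *\<^sub>R b) \<le> c' * H x" using c' by (rule mult_left_mono)
      then have 2: "c * q\<^sup>2 \<le> c' * H x" by (simp add: c_def c'_def mult_ac)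
      have "(\<integral>w. G (x + q *\<^sub>R w) \<partial>usphere) = c * ((norm x)\<^sup>2 + q\<^sup>2) - (\<integral>w. Q (x + q *\<^sub>R w) \<partial>usphere)"
        unfolding G_def
        by (subst Bochner_Integration.integral_diff)
           (auto simp: usphere_integral_norm_sq intro!: integrable_usphere_continuous continuous_intros 
             continuous_on_compose2[OF contQ])
      also have "\<dots> \<le> G x + C * q ^ 3"
        using 1 2 by (simp add: G_def algebra_simps)
      finally show "(\<integral>w. G (x + q *\<^sub>R w) \<partial>usphere) \<le> G x + C * q ^ 3" .
    qed
  qed (use r' b in auto)
  have Q\<theta>: "Q (s *\<^sub>R b) = (\<integral>u. \<Phi> ((norm (\<theta> + s *\<^sub>R u))\<^sup>2) \<partial>usphere)" for s
    unfolding Q_def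
    by (rule usphere_mean_cong) (use b contP in \<open>auto simp: t_def intro: borel_measurable_continuous_onI\<close>)
  have H\<theta>: "H (r *\<^sub>R b) = (\<integral>u. \<phi> ((norm (\<theta> + r *\<^sub>R u))\<^sup>2) \<partial>usphere)"
    unfolding H_def by (rule usphere_mean_cong) (use b in \<open>auto simp: t_def\<close>)
  \<comment> \<open>Concavity of \<open>\<Phi>\<close> bounds the increment of \<open>Q\<close> from
    \<open>s\<close> to \<open>r\<close> by \<open>(r - s) * J s\<close>. At \<open>s = r\<close>,
    \<open>J\<close> is \<open>2 / r\<close> times the flux in the claim.\<close>
  define J where "J s = (\<integral>u. \<phi> ((norm (\<theta> + s *\<^sub>R u))\<^sup>2) * (r + s + 2 * (\<theta> \<bullet> u)) \<partial>usphere)" for s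
  have J: "c * (r + s) \<le> J s" if s: "0 < s" "s < r" for s
  proof -
    have "c * (r\<^sup>2 - s\<^sup>2) \<le> Q (r *\<^sub>R b) - Q (s *\<^sub>R b)"
      using G[OF s] b s r by (simp add: G_def power_mult_distrib algebra_simps)
    also have "\<dots> = (\<integral>u. \<Phi> ((norm (\<theta> + r *\<^sub>R u))\<^sup>2) - \<Phi> ((norm (\<theta> + s *\<^sub>R u))\<^sup>2) \<partial>usphere)"
      unfolding Q\<theta> by (rule Bochner_Integration.integral_diff[symmetric];
        intro integrable_usphere_continuous continuous_intros contP')
    also have "\<dots> \<le> (\<integral>u. (r - s) * (\<phi> ((norm (\<theta> + s *\<^sub>R u))\<^sup>2) * (r + s + 2 * (\<theta> \<bullet> u))) \<partial>usphere)"
    proof (rule integral_mono_AE)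
      show "AE u in usphere. \<Phi> ((norm (\<theta> + r *\<^sub>R u))\<^sup>2) - \<Phi> ((norm (\<theta> + s *\<^sub>R u))\<^sup>2) 
          \<le> (r - s) * (\<phi> ((norm (\<theta> + s *\<^sub>R u))\<^sup>2) * (r + s + 2 * (\<theta> \<bullet> u)))"
        using AE_usphere_norm
      proof eventually_elim
        case (elim u)
        have "(norm (\<theta> + r *\<^sub>R u))\<^sup>2 - (norm (\<theta> + s *\<^sub>R u))\<^sup>2 = (r - s) * (r + s + 2 * (\<theta> \<bullet> u))"
          unfolding norm_add_scaleR_sq[OF elim] by (simp add: algebra_simps power2_eq_square)
        then show ?case
          using antiderivative_concave[OF \<Phi>, of "(norm (\<theta> + r *\<^sub>R u))\<^sup>2" "(norm (\<theta> + s *\<^sub>R u))\<^sup>2"]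
          by (simp add: mult_ac)
      qed
    qed (intro integrable_usphere_continuous continuous_intros contP' continuous_on_profile)+
    also have "\<dots> = (r - s) * J s" by (simp add: J_def)
    finally have "(r - s) * (c * (r + s)) \<le> (r - s) * J s"
      by (simp add: algebra_simps power2_eq_square)
    then show ?thesis using s by simp
  qed
  \<comment> \<open>The real parameter is encoded as \<open>x \<bullet> b\<close>, because
    \<open>continuous_on_usphere_integral\<close> takes a vector parameter.\<close>
  have "continuous_on UNIV (\<lambda>x. \<integral>u. \<phi> ((norm (\<theta> + (x \<bullet> b) *\<^sub>R u))\<^sup>2) * (r + x \<bullet> b + 2 * (\<theta> \<bullet> u)) \<partial>usphere)"
    by (intro continuous_on_usphere_integral continuous_intros continuous_on_profile)
  from continuous_on_compose2[OF this, of UNIV "\<lambda>s. s *\<^sub>R b"]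
  have "continuous_on UNIV J"
    using b by (simp add: J_def[abs_def] norm_eq_sqrt_inner continuous_on_scaleR continuous_on_id continuous_on_const)
  then have "isCont J r" by (simp add: continuous_on_eq_continuous_at)
  then have "(J \<longlongrightarrow> J r) (at_left r)"
    unfolding continuous_at by (rule filterlim_mono) (auto simp: at_le)
  moreover have "((\<lambda>s. c * (r + s)) \<longlongrightarrow> c * (r + r)) (at_left r)"
    by (intro tendsto_intros)
  moreover have "eventually (\<lambda>s. c * (r + s) \<le> J s) (at_left r)"
    using eventually_at_left_real[OF r] by eventually_elim (use J in auto)
  ultimately have "c * (r + r) \<le> J r"
    by (intro tendsto_le[OF trivial_limit_at_left_real])
  then have "(r / 2) * (c * (r + r)) \<le> (r / 2) * J r"
    using r by (intro mult_left_mono) auto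
  also have "(r / 2) * (c * (r + r)) = c * r\<^sup>2" by (simp add: power2_eq_square)
  also have "(r / 2) * J r = (\<integral>u. (r / 2) * (\<phi> ((norm (\<theta> + r *\<^sub>R u))\<^sup>2) * (r + r + 2 * (\<theta> \<bullet> u))) \<partial>usphere)"
    by (simp add: J_def)
  also have "\<dots> = (\<integral>u. \<phi> ((norm (\<theta> + r *\<^sub>R u))\<^sup>2) * (r * (\<theta> \<bullet> u) + r\<^sup>2) \<partial>usphere)"
    by (rule Bochner_Integration.integral_cong) (auto simp: algebra_simps power2_eq_square)
  finally show ?thesis
    by (simp add: c_def H\<theta> mult_ac)
qed

end

section \<open>Sphere means of concave profiles\<close>

locale concave_profile =
  fixes s :: "real \<Rightarrow> real"
  assumes nonneg: "0 \<le> t \<Longrightarrow> 0 \<le> s t"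
    and mono: "mono_on {0..} s"
    and concave: "concave_on {0..} s"
begin

text \<open>A supporting line of the concave graph at \<open>v\<close> has nonnegative slope because
  \<open>s\<close> increases, and nonnegative intercept because it lies above
  \<open>s 0 \<ge> 0\<close>.\<close>

lemma supporting_line:
  assumes "0 < v"
  shows "\<exists>\<alpha>\<ge>0. \<exists>\<beta>\<ge>0. s v = \<alpha> + \<beta> * v \<and> (\<forall>w\<ge>0. s w \<le> \<alpha> + \<beta> * w)"
proof -
  \<comment> \<open>The right derivative of \<open>s\<close> at \<open>v\<close>, expressed as an
    infimum of difference quotients of the convex function \<open>- s\<close>.\<close>
  define \<beta> where "\<beta> = - Inf ((\<lambda>t. (- s v - - s t) / (v - t)) ` ({v<..} \<inter> {0..}))"
  have "convex_on {0..} (\<lambda>t. - s t)" using concave by (simp add: concave_on_def)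
  moreover have "v \<in> interior {0..}" using assms by (simp add: interior_real_atLeast)
  ultimately have line: "s w \<le> s v + \<beta> * (w - v)" if "0 \<le> w" for w
    using convex_le_Inf_differential[of "{0..}" "\<lambda>t. - s t" v w] that by (simp add: \<beta>_def)
  have "s v \<le> s (v + 1)" using assms by (intro mono_onD[OF mono]) auto
  also have "\<dots> \<le> s v + \<beta> * 1" using line[of "v + 1"] assms by simp
  finally have "0 \<le> \<beta>" by simp
  moreover have "0 \<le> s v - \<beta> * v"
    using line[of 0] nonneg[of 0] by simp
  ultimately show ?thesis using line 
    by (intro exI[of _ "s v - \<beta> * v"] conjI exI[of _ \<beta>] allI impI) (auto simp: algebra_simps)
qed

lemma ratio_antimono:
  assumes "0 < v" "v \<le> w"
  shows "s w / w \<le> s v / v"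
proof -
  obtain \<alpha> \<beta> where ab: "\<alpha> \<ge> 0" "\<beta> \<ge> 0" "s v = \<alpha> + \<beta> * v" "\<And>w. w \<ge> 0 \<Longrightarrow> s w \<le> \<alpha> + \<beta> * w"
    using supporting_line[OF assms(1)] by blast
  have "s w / w \<le> (\<alpha> + \<beta> * w) / w" using ab(4)[of w] assms by (intro divide_right_mono) auto
  also have "\<dots> = \<alpha> / w + \<beta>" using assms by (simp add: field_simps)
  also have "\<dots> \<le> \<alpha> / v + \<beta>" using assms ab by (intro add_right_mono divide_left_mono) auto
  also have "\<dots> = s v / v" using assms ab by (simp add: field_simps)
  finally show ?thesis .
qed

text \<open>The field \<open>support\<close> of \<open>truncated_profile\<close> is the supporting
  line of \<open>s\<close> divided by its argument. Below \<open>\<epsilon>\<close> the product in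
  \<open>numerator_mono\<close> is linear, above it is \<open>s\<close> itself.\<close>

lemma truncated:
  assumes e: "0 < \<epsilon>"
  shows "truncated_profile (\<lambda>v. s (max v \<epsilon>) / max v \<epsilon>) \<epsilon>"
proof
  \<comment> \<open>Concavity yields continuity on the open half-line only, and \<open>s\<close> may
    jump at 0; the arguments \<open>max v \<epsilon>\<close> stay away from 0.\<close>
  have "convex_on {0<..} (\<lambda>t. - s t)" 
    using concave unfolding concave_on_def by (rule convex_on_subset) auto
  then have "continuous_on {0<..} (\<lambda>t. - s t)" by (intro convex_on_continuous) auto
  then have c: "continuous_on {0<..} s" using continuous_on_minus by fastforce
  have p: "0 < max v \<epsilon>" for v using e by simp
  show "continuous_on UNIV (\<lambda>v. s (max v \<epsilon>) / max v \<epsilon>)"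
    using p by (intro continuous_intros continuous_on_compose2[OF c]) (auto simp: less_imp_neq[symmetric])
  show "0 \<le> s (max v \<epsilon>) / max v \<epsilon>" for v using p[of v] nonneg[of "max v \<epsilon>"] by simp
  show "s (max w \<epsilon>) / max w \<epsilon> \<le> s (max v \<epsilon>) / max v \<epsilon>" if "v \<le> w" for v w
    using p that by (intro ratio_antimono) auto
  show "s (max v \<epsilon>) / max v \<epsilon> = s (max 0 \<epsilon>) / max 0 \<epsilon>" if "v \<le> \<epsilon>" for v
    using that e by (simp add: max_def)
  show "v * (s (max v \<epsilon>) / max v \<epsilon>) \<le> w * (s (max w \<epsilon>) / max w \<epsilon>)" if "0 \<le> v" "v \<le> w" for v w
  proof -
    have "v * s (max v \<epsilon>) / max v \<epsilon> \<le> w * s (max w \<epsilon>) / max w \<epsilon>"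
    proof (cases "w \<le> \<epsilon>")
      case True
      then show ?thesis using that e nonneg[of \<epsilon>]
        by (simp add: max_def divide_right_mono mult_right_mono)
    next
      case w: False
      have "v * s (max v \<epsilon>) / max v \<epsilon> \<le> s (max v \<epsilon>)"
        using p[of v] nonneg[of "max v \<epsilon>"] mult_right_mono[of v "max v \<epsilon>" "s (max v \<epsilon>)"]
        by (simp add: divide_le_eq mult.commute)
      also have "\<dots> \<le> s w" using w that e by (intro mono_onD[OF mono]) auto
      also have "\<dots> = w * s (max w \<epsilon>) / max w \<epsilon>" using w e by (simp add: max_def)
      finally show ?thesis .
    qed
    then show ?thesis by simp
  qed
  show "\<exists>\<alpha>\<ge>0. \<exists>\<beta>\<ge>0. s (max v \<epsilon>) / max v \<epsilon> = \<alpha> / v + \<beta> \<and> (\<forall>w>0. s (max w \<epsilon>) / max w \<epsilon> \<le> \<alpha> / w + \<beta>)"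
    if v: "\<epsilon> \<le> v" for v
  proof -
    obtain \<alpha> \<beta> where ab: "\<alpha> \<ge> 0" "\<beta> \<ge> 0" "s v = \<alpha> + \<beta> * v" "\<And>w. w \<ge> 0 \<Longrightarrow> s w \<le> \<alpha> + \<beta> * w"
      using supporting_line[of v] e v by auto
    have "s (max v \<epsilon>) / max v \<epsilon> = \<alpha> / v + \<beta>"
      using ab(3) v e by (simp add: max_def field_simps)
    moreover have "s (max w \<epsilon>) / max w \<epsilon> \<le> \<alpha> / w + \<beta>" if "w > 0" for w
    proof -
      have "s (max w \<epsilon>) / max w \<epsilon> \<le> (\<alpha> + \<beta> * max w \<epsilon>) / max w \<epsilon>"
        using ab(4)[of "max w \<epsilon>"] p[of w] by (intro divide_right_mono) auto
      also have "\<dots> = \<alpha> / max w \<epsilon> + \<beta>" using p[of w] by (simp add: add_divide_distrib)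
      also have "\<dots> \<le> \<alpha> / w + \<beta>" using that ab by (intro add_right_mono divide_left_mono) auto
      finally show ?thesis .
    qed
    ultimately show ?thesis using ab(1,2) by blast
  qed
qed fact

lemma measurable_norm_sq [measurable]:
  "(\<lambda>x :: 'a::euclidean_space. s ((norm x)\<^sup>2)) \<in> borel_measurable borel"
proof -
  have "mono (\<lambda>t. s (max 0 t))" by (intro monoI mono_onD[OF mono]) auto
  then have [measurable]: "(\<lambda>t. s (max 0 t)) \<in> borel_measurable borel" by (rule borel_measurable_mono)
  have "(\<lambda>x :: 'a. s (max 0 ((norm x)\<^sup>2))) \<in> borel_measurable borel" by measurable
  then show ?thesis by simp
qed

end

text \<open>The mean of \<open>1 / max (\<parallel>x\<parallel>\<^sup>2) \<epsilon>\<close> over the sphere is at most \<open>1 / r\<^sup>2\<close> for every \<open>\<epsilon>\<close>, which leaves no mass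
  at the origin.\<close>

lemma AE_usphere_neq:
  fixes \<theta> :: "'a::euclidean_space"
  assumes d: "DIM('a) \<ge> 4" and r: "0 < r"
  shows "AE u in usphere. \<theta> + r *\<^sub>R u \<noteq> 0"
proof -
  \<comment> \<open>With constant numerator 1 the truncated profile is
    \<open>1 / max v \<epsilon>\<close>, which equals \<open>1 / \<epsilon>\<close> at the
    origin.\<close>
  interpret concave_profile "\<lambda>_. 1"
    by standard (auto simp: mono_on_def concave_on_const)
  let ?P = "{u. \<theta> + r *\<^sub>R u = 0}"
  have P: "?P \<in> sets borel"
    by (intro borel_closed closed_Collect_eq continuous_intros)
  have "measure usphere ?P \<le> \<epsilon> / r\<^sup>2" if e: "0 < \<epsilon>" for \<epsilon>
  proof -
    interpret t: truncated_profile "\<lambda>v. 1 / max v \<epsilon>" \<epsilon> using truncated[OF e] .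
    have "measure usphere ?P / \<epsilon> = (\<integral>u. indicator ?P u / \<epsilon> \<partial>usphere)"
      by simp
    also have "\<dots> \<le> (\<integral>u. 1 / max ((norm (\<theta> + r *\<^sub>R u))\<^sup>2) \<epsilon> \<partial>usphere)"
    proof (rule integral_mono)
      show "integrable usphere (\<lambda>u. 1 / max ((norm (\<theta> + r *\<^sub>R u))\<^sup>2) \<epsilon>)"
        by (intro integrable_usphere_continuous t.continuous_on_profile continuous_intros)
      show "indicator ?P u / \<epsilon> \<le> 1 / max ((norm (\<theta> + r *\<^sub>R u))\<^sup>2) \<epsilon>" for u
        using e by (auto simp: indicator_def less_imp_le)
      show "integrable usphere (\<lambda>u. indicator ?P u / \<epsilon>)"
        using P e by (intro integrable_usphere_bounded[where B = "1 / \<epsilon>"]) (auto simp: indicator_def)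
    qed
    also have "\<dots> \<le> (\<integral>u. 1 / max ((norm (0 + r *\<^sub>R (u :: 'a)))\<^sup>2) \<epsilon> \<partial>usphere)"
      by (rule t.mean_antimono[OF d]) simp
    also have "\<dots> = (\<integral>u. 1 / max (r\<^sup>2) \<epsilon> \<partial>(usphere :: 'a measure))"
      by (intro integral_cong_AE) (auto intro!: eventually_mono[OF AE_usphere_norm])
    also have "\<dots> \<le> 1 / r\<^sup>2" using r by (simp add: frac_le)
    finally show ?thesis using e by (simp add: field_simps)
  qed
  \<comment> \<open>Apply the bound with \<open>\<epsilon> = e * r\<^sup>2\<close>.\<close>
  then have "measure usphere ?P \<le> 0 + e" if "0 < e" for e
    using that r by (metis add_0 mult_pos_pos nonzero_mult_div_cancel_right less_numeral_extra(3) zero_less_power)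
  then have "measure usphere ?P \<le> 0" by (rule field_le_epsilon)
  then have "measure usphere ?P = 0" by (simp add: measure_le_0_iff)
  then have "emeasure usphere ?P = 0" by (simp add: usphere.emeasure_eq_measure)
  then show ?thesis by (intro AE_I[where N = ?P]) auto
qed

section \<open>Removal of the truncation\<close>

context concave_profile
begin

text \<open>This is \<open>M r\<close> of the outline. For \<open>r > 0\<close> in dimension at
  least 4, the default value 0 of the quotient at the origin concerns a null set, by
  \<open>AE_usphere_neq\<close>.\<close>

definition sphere_mean :: "'a::euclidean_space \<Rightarrow> real \<Rightarrow> real" where
  "sphere_mean \<theta> r = (\<integral>u. s ((norm (\<theta> + r *\<^sub>R u))\<^sup>2) / (norm (\<theta> + r *\<^sub>R u))\<^sup>2 \<partial>usphere)"

context
  fixes \<theta> :: "'a::euclidean_space" and r :: real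
  assumes d: "DIM('a) \<ge> 4" and r: "0 < r"
begin

private abbreviation (input) "tr n v \<equiv> s (max v (1 / Suc n)) / max v (1 / Suc n)"

private lemma tr: "truncated_profile (tr n) (1 / Suc n)"
  by (rule truncated) simp

text \<open>The mean is largest when the sphere is centered at the origin, where the integrand is
  constant. The resulting bound does not depend on \<open>n\<close>.\<close>

lemma truncated_mean_le: "(\<integral>u. tr n ((norm (\<theta> + r *\<^sub>R u))\<^sup>2) \<partial>usphere) \<le> s (r\<^sup>2) / r\<^sup>2"
proof -
  interpret t: truncated_profile "tr n" "1 / Suc n" by (rule tr)
  have "(\<integral>u. tr n ((norm (\<theta> + r *\<^sub>R u))\<^sup>2) \<partial>usphere) \<le> (\<integral>u. tr n ((norm (0 + r *\<^sub>R (u :: 'a)))\<^sup>2) \<partial>usphere)"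
    by (rule t.mean_antimono[OF d]) simp
  also have "\<dots> = (\<integral>u. tr n (r\<^sup>2) \<partial>(usphere :: 'a measure))"
  proof (rule integral_cong_AE)
    show "AE u :: 'a in usphere. tr n ((norm (0 + r *\<^sub>R u))\<^sup>2) = tr n (r\<^sup>2)"
      using AE_usphere_norm by eventually_elim simp
  qed measurable
  also have "\<dots> \<le> s (r\<^sup>2) / r\<^sup>2" using r by (simp add: ratio_antimono)
  finally show ?thesis .
qed

lemma truncated_tendsto:
  assumes "0 < v"
  shows "(\<lambda>n. tr n v) \<longlonglongrightarrow> s v / v"
proof (rule tendsto_eventually)
  have "eventually (\<lambda>n. 1 / Suc n < v) sequentially"
    using assms by (rule order_tendstoD(2)[OF LIMSEQ_inverse_real_of_nat[unfolded inverse_eq_divide]])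
  then show "eventually (\<lambda>n. tr n v = s v / v) sequentially"
    by eventually_elim (simp add: max_def)
qed

lemma truncated_tendsto_AE:
  "AE u in usphere. (\<lambda>n. tr n ((norm (\<theta> + r *\<^sub>R u))\<^sup>2)) \<longlonglongrightarrow> s ((norm (\<theta> + r *\<^sub>R u))\<^sup>2) / (norm (\<theta> + r *\<^sub>R u))\<^sup>2"
  using AE_usphere_neq[OF d r, of \<theta>] by eventually_elim (intro truncated_tendsto, simp)

text \<open>The integrand can be unbounded when the sphere passes through the origin, so
  integrability comes from Fatou's lemma and the uniform bound
  \<open>truncated_mean_le\<close>.\<close>

lemma integrable_sphere_mean:
  "integrable usphere (\<lambda>u. s ((norm (\<theta> + r *\<^sub>R u))\<^sup>2) / (norm (\<theta> + r *\<^sub>R u))\<^sup>2)"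
proof (rule integrableI_nonneg)
  have m: "(\<lambda>u. tr n ((norm (\<theta> + r *\<^sub>R u))\<^sup>2)) \<in> borel_measurable borel" for n
    using truncated_profile.measurable_profile[OF tr, measurable, of n] by measurable
  have "(\<integral>\<^sup>+ u. s ((norm (\<theta> + r *\<^sub>R u))\<^sup>2) / (norm (\<theta> + r *\<^sub>R u))\<^sup>2 \<partial>usphere)
      = (\<integral>\<^sup>+ u. liminf (\<lambda>n. ennreal (tr n ((norm (\<theta> + r *\<^sub>R u))\<^sup>2))) \<partial>usphere)"
  proof (rule nn_integral_cong_AE)
    show "AE u in usphere. ennreal (s ((norm (\<theta> + r *\<^sub>R u))\<^sup>2) / (norm (\<theta> + r *\<^sub>R u))\<^sup>2)
        = liminf (\<lambda>n. ennreal (tr n ((norm (\<theta> + r *\<^sub>R u))\<^sup>2)))"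
      using truncated_tendsto_AE
      by eventually_elim (intro lim_imp_Liminf[symmetric] tendsto_ennrealI, auto)
  qed
  also have "\<dots> \<le> liminf (\<lambda>n. \<integral>\<^sup>+ u. tr n ((norm (\<theta> + r *\<^sub>R u))\<^sup>2) \<partial>usphere)"
    using m by (intro nn_integral_liminf) simp
  also have "\<dots> \<le> liminf (\<lambda>n::nat. ennreal (s (r\<^sup>2) / r\<^sup>2))"
  proof (intro Liminf_mono always_eventually allI)
    fix n
    interpret t: truncated_profile "tr n" "1 / Suc n" by (rule tr)
    have "integrable usphere (\<lambda>u. tr n ((norm (\<theta> + r *\<^sub>R u))\<^sup>2))"
      by (intro integrable_usphere_continuous t.continuous_on_profile continuous_intros)
    then have "(\<integral>\<^sup>+ u. tr n ((norm (\<theta> + r *\<^sub>R u))\<^sup>2) \<partial>usphere) = (\<integral>u. tr n ((norm (\<theta> + r *\<^sub>R u))\<^sup>2) \<partial>usphere)"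
      by (intro nn_integral_eq_integral AE_I2 t.nonneg)
    then show "(\<integral>\<^sup>+ u. tr n ((norm (\<theta> + r *\<^sub>R u))\<^sup>2) \<partial>usphere) \<le> ennreal (s (r\<^sup>2) / r\<^sup>2)"
      using truncated_mean_le[of n] by (simp add: ennreal_leI)
  qed
  also have "\<dots> < \<infinity>" by (simp add: Liminf_const)
  finally show "(\<integral>\<^sup>+ u. s ((norm (\<theta> + r *\<^sub>R u))\<^sup>2) / (norm (\<theta> + r *\<^sub>R u))\<^sup>2 \<partial>usphere) < \<infinity>" .
qed (auto intro!: AE_I2 divide_nonneg_nonneg nonneg)

text \<open>Dominated convergence: the truncated profiles lie below the untruncated one by
  \<open>ratio_antimono\<close>, and \<open>w\<close> is bounded on the unit sphere.\<close>

lemma truncated_weighted_tendsto: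
  assumes w: "continuous_on UNIV w"
  shows "(\<lambda>n. \<integral>u. tr n ((norm (\<theta> + r *\<^sub>R u))\<^sup>2) * w u \<partial>usphere)
    \<longlonglongrightarrow> (\<integral>u. s ((norm (\<theta> + r *\<^sub>R u))\<^sup>2) / (norm (\<theta> + r *\<^sub>R u))\<^sup>2 * w u \<partial>usphere)"
    and "integrable usphere (\<lambda>u. s ((norm (\<theta> + r *\<^sub>R u))\<^sup>2) / (norm (\<theta> + r *\<^sub>R u))\<^sup>2 * w u)"
proof -
  have mw[measurable]: "w \<in> borel_measurable borel" using w by (rule borel_measurable_continuous_onI)
  have m: "(\<lambda>u. tr n ((norm (\<theta> + r *\<^sub>R u))\<^sup>2)) \<in> borel_measurable borel" for n
    using truncated_profile.measurable_profile[OF tr, measurable, of n] by measurable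
  have "compact (w ` sphere 0 1)"
    using w by (intro compact_continuous_image) (auto intro: continuous_on_subset)
  then obtain B where B: "\<And>u. norm u = 1 \<Longrightarrow> norm (w u) \<le> B"
    by (force dest!: compact_imp_bounded simp: bounded_iff)
  let ?d = "\<lambda>u. s ((norm (\<theta> + r *\<^sub>R u))\<^sup>2) / (norm (\<theta> + r *\<^sub>R u))\<^sup>2"
  have iB: "integrable usphere (\<lambda>u. ?d u * B)"
    by (intro integrable_mult_left integrable_sphere_mean)
  have "AE u in usphere. norm (?d u * w u) \<le> norm (?d u * B)"
    using AE_usphere_norm
  proof eventually_elim
    case (elim u)
    show ?case unfolding norm_mult using B[OF elim] by (intro mult_left_mono) auto
  qed
  then show "integrable usphere (\<lambda>u. ?d u * w u)"
    by (intro Bochner_Integration.integrable_bound[OF iB]) auto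
  show "(\<lambda>n. \<integral>u. tr n ((norm (\<theta> + r *\<^sub>R u))\<^sup>2) * w u \<partial>usphere) \<longlonglongrightarrow> (\<integral>u. ?d u * w u \<partial>usphere)"
  proof (rule integral_dominated_convergence[OF _ _ iB])
    show "AE u in usphere. (\<lambda>n. tr n ((norm (\<theta> + r *\<^sub>R u))\<^sup>2) * w u) \<longlonglongrightarrow> ?d u * w u"
      using truncated_tendsto_AE by eventually_elim (intro tendsto_mult tendsto_const)
    show "AE u in usphere. norm (tr n ((norm (\<theta> + r *\<^sub>R u))\<^sup>2) * w u) \<le> ?d u * B" for n
      using AE_usphere_norm AE_usphere_neq[OF d r, of \<theta>]
    proof eventually_elim
      case (elim u)
      have "0 \<le> tr n ((norm (\<theta> + r *\<^sub>R u))\<^sup>2)" by (rule truncated_profile.nonneg[OF tr])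
      moreover have "tr n ((norm (\<theta> + r *\<^sub>R u))\<^sup>2) \<le> ?d u"
        using elim by (intro ratio_antimono) auto
      ultimately show ?case using B[OF elim(1)] unfolding norm_mult by (intro mult_mono) auto
    qed
  qed (use m in measurable)
qed

lemma truncated_mean_tendsto:
  "(\<lambda>n. \<integral>u. tr n ((norm (\<theta> + r *\<^sub>R u))\<^sup>2) \<partial>usphere) \<longlonglongrightarrow> sphere_mean \<theta> r"
  using truncated_weighted_tendsto(1)[of "\<lambda>_. 1"] by (simp add: sphere_mean_def)

lemma sphere_mean_le: "sphere_mean \<theta> r \<le> s (r\<^sup>2) / r\<^sup>2"
  by (rule LIMSEQ_le_const2[OF truncated_mean_tendsto]) (use truncated_mean_le in blast)

lemma sphere_flux_ge:
  "(real DIM('a) - 2) / DIM('a) * r\<^sup>2 * sphere_mean \<theta> r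
    \<le> (\<integral>u. s ((norm (\<theta> + r *\<^sub>R u))\<^sup>2) / (norm (\<theta> + r *\<^sub>R u))\<^sup>2 * (r * (\<theta> \<bullet> u) + r\<^sup>2) \<partial>usphere)"
proof (rule LIMSEQ_le)
  show "(\<lambda>n. (real DIM('a) - 2) / DIM('a) * r\<^sup>2 * (\<integral>u. tr n ((norm (\<theta> + r *\<^sub>R u))\<^sup>2) \<partial>usphere))
      \<longlonglongrightarrow> (real DIM('a) - 2) / DIM('a) * r\<^sup>2 * sphere_mean \<theta> r"
    by (intro tendsto_intros truncated_mean_tendsto)
  show "(\<lambda>n. \<integral>u. tr n ((norm (\<theta> + r *\<^sub>R u))\<^sup>2) * (r * (\<theta> \<bullet> u) + r\<^sup>2) \<partial>usphere)
      \<longlonglongrightarrow> (\<integral>u. s ((norm (\<theta> + r *\<^sub>R u))\<^sup>2) / (norm (\<theta> + r *\<^sub>R u))\<^sup>2 * (r * (\<theta> \<bullet> u) + r\<^sup>2) \<partial>usphere)"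
    by (intro truncated_weighted_tendsto continuous_intros)
  show "\<exists>N. \<forall>n\<ge>N. (real DIM('a) - 2) / DIM('a) * r\<^sup>2 * (\<integral>u. tr n ((norm (\<theta> + r *\<^sub>R u))\<^sup>2) \<partial>usphere)
    \<le> (\<integral>u. tr n ((norm (\<theta> + r *\<^sub>R u))\<^sup>2) * (r * (\<theta> \<bullet> u) + r\<^sup>2) \<partial>usphere)"
    using truncated_profile.flux_ge[OF tr d r] by blast
qed

end

lemma sphere_mean_antimono_center:
  fixes \<theta> \<theta>' :: "'a::euclidean_space"
  assumes d: "DIM('a) \<ge> 4" and r: "0 < r" and "norm \<theta> \<le> norm \<theta>'"
  shows "sphere_mean \<theta>' r \<le> sphere_mean \<theta> r"
  using truncated_profile.mean_antimono[OF truncated d assms(3)]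
  by (intro LIMSEQ_le[OF truncated_mean_tendsto[OF d r] truncated_mean_tendsto[OF d r]]) auto

text \<open>The fact \<open>swap\<close> exchanges the radius with the norm of the center, so
  monotonicity in the center becomes monotonicity in the radius.\<close>

lemma sphere_mean_antimono:
  fixes \<theta> :: "'a::euclidean_space"
  assumes d: "DIM('a) \<ge> 4" and r: "0 < r" and "r \<le> r'"
  shows "sphere_mean \<theta> r' \<le> sphere_mean \<theta> r"
proof -
  have r': "0 < r'" using assms by simp
  obtain b :: 'a where "b \<in> Basis" using nonempty_Basis by blast
  then have b: "norm b = 1" by simp
  show ?thesis
  proof (rule LIMSEQ_le[OF truncated_mean_tendsto[OF d r'] truncated_mean_tendsto[OF d r]], intro exI allI impI)
    fix n :: nat
    interpret t: truncated_profile "\<lambda>v. s (max v (1 / Suc n)) / max v (1 / Suc n)" "1 / Suc n"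
      by (rule truncated) simp
    have swap: "(\<integral>u. s (max ((norm (\<theta> + r *\<^sub>R u))\<^sup>2) (1 / Suc n)) / max ((norm (\<theta> + r *\<^sub>R u))\<^sup>2) (1 / Suc n) \<partial>usphere)
      = (\<integral>u. s (max ((norm (r *\<^sub>R b + norm \<theta> *\<^sub>R u))\<^sup>2) (1 / Suc n)) / max ((norm (r *\<^sub>R b + norm \<theta> *\<^sub>R u))\<^sup>2) (1 / Suc n) \<partial>usphere)" for r
      by (rule usphere_mean_cong[where F = "\<lambda>v. s (max v (1 / Suc n)) / max v (1 / Suc n)", OF t.measurable_profile]) (auto simp: b)
    show "(\<integral>u. s (max ((norm (\<theta> + r' *\<^sub>R u))\<^sup>2) (1 / Suc n)) / max ((norm (\<theta> + r' *\<^sub>R u))\<^sup>2) (1 / Suc n) \<partial>usphere)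
      \<le> (\<integral>u. s (max ((norm (\<theta> + r *\<^sub>R u))\<^sup>2) (1 / Suc n)) / max ((norm (\<theta> + r *\<^sub>R u))\<^sup>2) (1 / Suc n) \<partial>usphere)"
      unfolding swap using assms b by (intro t.mean_antimono d) auto
  qed
qed

lemma scaled: 
  assumes "0 \<le> c"
  shows "concave_profile (\<lambda>v. s (c * v))"
proof
  show "0 \<le> s (c * t)" if "0 \<le> t" for t using assms that by (intro nonneg) simp
  show "mono_on {0..} (\<lambda>v. s (c * v))"
    using assms by (intro mono_onI mono_onD[OF mono]) (auto intro: mult_left_mono)
  show "concave_on {0..} (\<lambda>v. s (c * v))"
    unfolding concave_on_iff
  proof (intro conjI ballI allI impI)
    fix x y u v :: real assume *: "x \<in> {0..}" "y \<in> {0..}" "0 \<le> u" "0 \<le> v" "u + v = 1"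
    have "u * s (c * x) + v * s (c * y) \<le> s (u *\<^sub>R (c * x) + v *\<^sub>R (c * y))"
      using concave * assms unfolding concave_on_iff by auto
    then show "u * s (c * x) + v * s (c * y) \<le> s (c * (u *\<^sub>R x + v *\<^sub>R y))"
      by (simp add: algebra_simps)
  qed simp
qed

lemma sphere_mean_scaled:
  fixes \<theta> :: "'a::euclidean_space"
  assumes r: "0 < r"
  shows "r\<^sup>2 * sphere_mean \<theta> r = concave_profile.sphere_mean (\<lambda>v. s (r\<^sup>2 * v)) (\<theta> /\<^sub>R r) 1"
proof -
  interpret sc: concave_profile "\<lambda>v. s (r\<^sup>2 * v)" using r by (intro scaled) simp
  have eq: "(norm (\<theta> + r *\<^sub>R u))\<^sup>2 = r\<^sup>2 * (norm (\<theta> /\<^sub>R r + 1 *\<^sub>R u))\<^sup>2" for u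
  proof -
    have "\<theta> + r *\<^sub>R u = r *\<^sub>R (\<theta> /\<^sub>R r + 1 *\<^sub>R u)" using r by (simp add: scaleR_add_right)
    then show ?thesis using r by (simp add: power_mult_distrib)
  qed
  show ?thesis
    unfolding sphere_mean_def sc.sphere_mean_def eq using r
    by (subst integral_mult_right_zero[symmetric]) (simp add: field_simps)
qed

text \<open>Rescaling to the unit sphere replaces the profile by \<open>s (r\<^sup>2 * v)\<close>
  and the center by \<open>\<theta> /\<^sub>R r\<close>. A larger \<open>r\<close> moves the center
  inward and raises the profile, and both increase the mean.\<close>

lemma sq_sphere_mean_mono:
  fixes \<theta> :: "'a::euclidean_space"
  assumes d: "DIM('a) \<ge> 4" and r: "0 < r" and rr: "r \<le> r'"
  shows "r\<^sup>2 * sphere_mean \<theta> r \<le> r'\<^sup>2 * sphere_mean \<theta> r'"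
proof -
  have r': "0 < r'" using assms by simp
  interpret a: concave_profile "\<lambda>v. s (r\<^sup>2 * v)" using r by (intro scaled) simp
  interpret b: concave_profile "\<lambda>v. s (r'\<^sup>2 * v)" using r by (intro scaled) simp
  have "r\<^sup>2 * sphere_mean \<theta> r = a.sphere_mean (\<theta> /\<^sub>R r) 1" by (rule sphere_mean_scaled[OF r])
  also have "\<dots> \<le> a.sphere_mean (\<theta> /\<^sub>R r') 1"
    using r rr by (intro a.sphere_mean_antimono_center d) (auto simp: field_simps intro!: mult_right_mono)
  also have "\<dots> \<le> b.sphere_mean (\<theta> /\<^sub>R r') 1"
    unfolding a.sphere_mean_def b.sphere_mean_def
  proof (intro integral_mono a.integrable_sphere_mean b.integrable_sphere_mean d)
    fix u :: 'a
    show "s (r\<^sup>2 * (norm (\<theta> /\<^sub>R r' + 1 *\<^sub>R u))\<^sup>2) / (norm (\<theta> /\<^sub>R r' + 1 *\<^sub>R u))\<^sup>2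
      \<le> s (r'\<^sup>2 * (norm (\<theta> /\<^sub>R r' + 1 *\<^sub>R u))\<^sup>2) / (norm (\<theta> /\<^sub>R r' + 1 *\<^sub>R u))\<^sup>2"
      using r rr by (intro divide_right_mono mono_onD[OF mono]) (auto intro: mult_right_mono power_mono)
  qed auto
  also have "\<dots> = r'\<^sup>2 * sphere_mean \<theta> r'" by (rule sphere_mean_scaled[OF r', symmetric])
  finally show ?thesis .
qed

end

section \<open>Polar coordinates\<close>

lemma emeasure_lborel_scale:
  fixes A :: "'a::euclidean_space set"
  assumes [measurable]: "A \<in> sets borel" and c: "0 < c"
  shows "emeasure lborel A = ennreal (c ^ DIM('a)) * emeasure lborel {x. c *\<^sub>R x \<in> A}"
proof -
  have "emeasure lborel A = emeasure (density (distr lborel borel (\<lambda>x. 0 + c *\<^sub>R x)) (\<lambda>_. \<bar>c\<bar> ^ DIM('a))) A"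
    using lborel_affine[of c "0 :: 'a"] c by simp
  also have "\<dots> = ennreal (c ^ DIM('a)) * emeasure lborel {x. c *\<^sub>R x \<in> A}"
    using c by (simp add: emeasure_density_const emeasure_distr vimage_def)
  finally show ?thesis .
qed

text \<open>Scaling by \<open>a\<close> reduces the sector to the unit ball, where the identity is
  the definition of \<open>usphere\<close>. For \<open>a \<le> 0\<close> both sets lie in the null
  set consisting of the origin.\<close>

lemma emeasure_cone:
  fixes B :: "'a::euclidean_space set"
  assumes [measurable]: "B \<in> sets borel"
  shows "emeasure lborel {x. norm x \<le> a \<and> sgn x \<in> B} = emeasure lborel (cball (0::'a) a) * emeasure usphere B"
proof (cases "0 < a")
  case True
  let ?V = "emeasure lborel (cball (0::'a) 1)"
  have "emeasure lborel {x. norm x \<le> a \<and> sgn x \<in> B} 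
      = ennreal (a ^ DIM('a)) * emeasure lborel {x. norm (a *\<^sub>R x) \<le> a \<and> sgn (a *\<^sub>R x) \<in> B}"
    using True by (subst emeasure_lborel_scale[of _ a]) auto
  also have "{x. norm (a *\<^sub>R x) \<le> a \<and> sgn (a *\<^sub>R x) \<in> B} = cball 0 1 \<inter> sgn -` B"
    using True by (auto simp: sgn_scaleR)
  also have "emeasure lborel (cball 0 1 \<inter> sgn -` B) = ?V * emeasure usphere B"
  proof -
    have [measurable]: "sgn -` B \<in> sets borel"
      using measurable_sets_borel[OF borel_measurable_sgn_vec assms] by simp
    have "emeasure usphere B = emeasure lborel (cball 0 1 \<inter> sgn -` B) / ?V"
      unfolding usphere_def by (subst emeasure_distr) (auto simp: measurable_cong_sets[OF sets_uniform_measure refl])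
    then have "?V * emeasure usphere B = emeasure lborel (cball 0 1 \<inter> sgn -` B) * ?V / ?V"
      by (simp add: ennreal_times_divide mult.commute)
    also have "\<dots> = emeasure lborel (cball 0 1 \<inter> sgn -` B)"
      by (rule ennreal_mult_divide_eq) (use emeasure_unit_cball in auto)
    finally show ?thesis by simp
  qed
  also have "ennreal (a ^ DIM('a)) * (?V * emeasure usphere B) = emeasure lborel (cball (0::'a) a) * emeasure usphere B"
    using True by (subst emeasure_lborel_scale[of "cball 0 a" a]) (auto simp: mult.assoc cball_def)
  finally show ?thesis .
next
  case False
  have zero: "x = 0" if "norm x \<le> a" for x :: 'a
    using order_trans[OF that, of 0] False by simp
  have "emeasure lborel (cball (0::'a) a) \<le> emeasure lborel {0 :: 'a}"
    using zero by (intro emeasure_mono) auto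
  moreover have "emeasure lborel {x. norm x \<le> a \<and> sgn x \<in> B} \<le> emeasure lborel {0 :: 'a}"
    using zero by (intro emeasure_mono) auto
  ultimately show ?thesis by simp
qed

text \<open>The radial part of Lebesgue measure, a multiple of \<open>r ^ (d - 1)\<close> on the
  positive axis; this density is never computed.\<close>

abbreviation norm_law :: "'a::euclidean_space itself \<Rightarrow> real measure" where
  "norm_law TYPE('a) \<equiv> distr lborel borel (norm :: 'a \<Rightarrow> real)"

lemma sigma_finite_norm_law: "sigma_finite_measure (norm_law TYPE('a::euclidean_space))"
proof
  have "emeasure (norm_law TYPE('a)) {..real n} \<noteq> \<infinity>" for n
  proof -
    have "norm -` {..real n} = cball (0::'a) n" by auto
    then show ?thesis by (simp add: emeasure_distr emeasure_cball)
  qed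
  moreover have "(\<Union>n. {..real n}) = UNIV" using real_arch_simple by auto
  ultimately show "\<exists>A. countable A \<and> A \<subseteq> sets (norm_law TYPE('a)) \<and> \<Union>A = space (norm_law TYPE('a)) 
      \<and> (\<forall>a\<in>A. emeasure (norm_law TYPE('a)) a \<noteq> \<infinity>)"
    by (intro exI[of _ "range (\<lambda>n. {..real n})"]) auto
qed

text \<open>Norm and direction split Lebesgue measure into a product. On rectangles with a fixed set
  \<open>B\<close> of directions, both sides are measures in the set of radii, and they agree on
  half-lines by \<open>emeasure_cone\<close>.\<close>

lemma polar_pair_measure:
  "norm_law TYPE('a::euclidean_space) \<Otimes>\<^sub>M (usphere :: 'a measure) 
    = distr lborel (borel \<Otimes>\<^sub>M borel) (\<lambda>x. (norm x, sgn x))"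
proof (rule pair_measure_eqI[OF sigma_finite_norm_law usphere.sigma_finite_measure_axioms])
  show "sets (norm_law TYPE('a) \<Otimes>\<^sub>M (usphere :: 'a measure)) 
      = sets (distr lborel (borel \<Otimes>\<^sub>M borel) (\<lambda>x::'a. (norm x, sgn x)))"
    by (simp cong: sets_pair_measure_cong)
  fix A :: "real set" and B :: "'a set"
  assume "A \<in> sets (norm_law TYPE('a))" "B \<in> sets usphere"
  then have [measurable]: "A \<in> sets borel" "B \<in> sets borel" by auto
  define M where "M = distr (density lborel (indicator (sgn -` B))) borel (norm :: 'a \<Rightarrow> real)"
  define N where "N = density (norm_law TYPE('a)) (\<lambda>_. emeasure usphere B)"
  have [measurable]: "sgn -` B \<in> sets borel"
    using measurable_sets_borel[OF borel_measurable_sgn_vec \<open>B \<in> sets borel\<close>] by simp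
  have M: "emeasure M X = emeasure lborel {x. norm x \<in> X \<and> sgn x \<in> B}" if [measurable]: "X \<in> sets borel" for X
  proof -
    have [measurable]: "norm -` X \<in> sets (borel :: 'a measure)"
      by (rule measurable_sets_borel) measurable
    have "emeasure M X = emeasure lborel (sgn -` B \<inter> norm -` X)"
      unfolding M_def by (subst emeasure_distr) (simp_all add: emeasure_density indicator_inter_arith[symmetric] sets.Int)
    also have "sgn -` B \<inter> norm -` X = {x. norm x \<in> X \<and> sgn x \<in> B}" by auto
    finally show ?thesis .
  qed
  have N: "emeasure N X = emeasure (norm_law TYPE('a)) X * emeasure usphere B" if [measurable]: "X \<in> sets borel" for X
    unfolding N_def by (simp add: emeasure_density_const mult.commute)
  have "M = N"
  proof (rule measure_eqI_generator_eq)
    let ?E = "range (\<lambda>a::real. {..a})"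
    show "Int_stable ?E" by (auto simp: Int_stable_def)
    show "sets M = sigma_sets UNIV ?E" "sets N = sigma_sets UNIV ?E"
      unfolding M_def N_def by (simp_all add: borel_eq_atMost sets_measure_of)
    show "emeasure M X = emeasure N X" if "X \<in> ?E" for X
    proof -
      obtain a where X: "X = {..a}" using \<open>X \<in> ?E\<close> by auto
      have "norm -` {..a} = cball (0::'a) a" by auto
      then show ?thesis
        using emeasure_cone[of B a] by (simp add: X M N emeasure_distr)
    qed
    show "range (\<lambda>n::nat. {..real n}) \<subseteq> ?E" by auto
    show "(\<Union>n::nat. {..real n}) = UNIV" using real_arch_simple by auto
    show "emeasure M {..real n} \<noteq> \<infinity>" for n
    proof -
      have "emeasure M {..real n} \<le> emeasure lborel (cball (0::'a) n)"
        unfolding M[OF atMost_borel] by (intro emeasure_mono) auto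
      also have "\<dots> < \<infinity>" by (simp add: emeasure_cball)
      finally show ?thesis by simp
    qed
  qed auto
  then show "emeasure (norm_law TYPE('a)) A * emeasure usphere B
    = emeasure (distr lborel (borel \<Otimes>\<^sub>M borel) (\<lambda>x::'a. (norm x, sgn x))) (A \<times> B)"
    using M[of A] N[of A] by (subst emeasure_distr) (auto simp: vimage_def)
qed

lemma nn_integral_polar:
  fixes g :: "'a::euclidean_space \<Rightarrow> ennreal"
  assumes [measurable]: "g \<in> borel_measurable borel"
  shows "(\<integral>\<^sup>+ x. g x \<partial>lborel) = (\<integral>\<^sup>+ r. (\<integral>\<^sup>+ u. g (r *\<^sub>R u) \<partial>usphere) \<partial>norm_law TYPE('a))"
proof -
  have [measurable]: "(\<lambda>p. g (fst p *\<^sub>R snd p)) \<in> borel_measurable (borel \<Otimes>\<^sub>M borel)" by measurable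
  have "(\<integral>\<^sup>+ x. g x \<partial>lborel) = (\<integral>\<^sup>+ x. g (norm x *\<^sub>R sgn x) \<partial>lborel)"
  proof (rule nn_integral_cong)
    show "g x = g (norm x *\<^sub>R sgn x)" for x by (cases "x = 0") (simp_all add: sgn_div_norm)
  qed
  also have "\<dots> = (\<integral>\<^sup>+ p. g (fst p *\<^sub>R snd p) \<partial>(norm_law TYPE('a) \<Otimes>\<^sub>M usphere))"
    unfolding polar_pair_measure by (subst nn_integral_distr) auto
  also have "\<dots> = (\<integral>\<^sup>+ r. (\<integral>\<^sup>+ u. g (r *\<^sub>R u) \<partial>usphere) \<partial>norm_law TYPE('a))"
    by (subst usphere.nn_integral_fst[symmetric]) auto
  finally show ?thesis .
qed

section \<open>Spherically symmetric densities\<close>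

locale spherical_density =
  fixes f :: "real \<Rightarrow> real" and dim :: "'n::finite itself"
  assumes density: "prob_density (\<lambda>x :: real ^ 'n. f ((norm x)\<^sup>2))"
begin

text \<open>The law of \<open>\<parallel>X - \<theta>\<parallel>\<close>, the same for every
  \<open>\<theta>\<close>. The locale argument \<open>dim\<close> supplies the dimension, which
  \<open>f\<close> alone does not determine.\<close>

definition \<mu> :: "real measure" where
  "\<mu> = density (norm_law TYPE(real ^ 'n)) (\<lambda>r. ennreal (f (r\<^sup>2)))"

lemma f_nonneg: "0 \<le> f (r\<^sup>2)"
proof -
  obtain b :: "real ^ 'n" where "b \<in> Basis" using nonempty_Basis by blast
  then show ?thesis
    using density[unfolded prob_density_def, THEN conjunct2, THEN conjunct1, THEN spec, of "r *\<^sub>R b"] by simp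
qed

lemma measurable_f_norm [measurable]: "(\<lambda>x :: real ^ 'n. f ((norm x)\<^sup>2)) \<in> borel_measurable borel"
  using density by (simp add: prob_density_def)

lemma measurable_f_sq [measurable]: "(\<lambda>r. f (r\<^sup>2)) \<in> borel_measurable borel"
proof -
  obtain b :: "real ^ 'n" where "b \<in> Basis" using nonempty_Basis by blast
  then have b: "norm b = 1" by simp
  have "(\<lambda>r. f ((norm (r *\<^sub>R b))\<^sup>2)) \<in> borel_measurable borel"
    by (rule measurable_compose[OF _ measurable_f_norm]) measurable
  then show ?thesis using b by simp
qed

lemma measurable_f_shift [measurable]: 
  "(\<lambda>x :: real ^ 'n. f ((norm (x - \<theta>))\<^sup>2)) \<in> borel_measurable borel"
  by (rule measurable_compose[OF _ measurable_f_norm]) measurable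

lemma sets_radial_law [simp, measurable_cong]: "sets \<mu> = sets borel"
  by (simp add: \<mu>_def)

lemma space_radial_law [simp]: "space \<mu> = UNIV"
  by (simp add: \<mu>_def)

lemma nn_integral_sph_law:
  fixes g :: "real ^ 'n \<Rightarrow> ennreal"
  assumes [measurable]: "g \<in> borel_measurable borel"
  shows "(\<integral>\<^sup>+ x. g x \<partial>sph_law f \<theta>) = (\<integral>\<^sup>+ r. (\<integral>\<^sup>+ u. g (\<theta> + r *\<^sub>R u) \<partial>usphere) \<partial>\<mu>)"
proof -
  have "(\<integral>\<^sup>+ x. g x \<partial>sph_law f \<theta>) = (\<integral>\<^sup>+ x. ennreal (f ((norm (x - \<theta>))\<^sup>2)) * g x \<partial>lborel)"
    unfolding sph_law_def by (subst nn_integral_density) auto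
  also have "\<dots> = (\<integral>\<^sup>+ x. ennreal (f ((norm x)\<^sup>2)) * g (\<theta> + x) \<partial>lborel)"
    by (subst nn_integral_lborel_translate[symmetric, where c = \<theta>]) auto
  also have "\<dots> = (\<integral>\<^sup>+ r. (\<integral>\<^sup>+ u. ennreal (f ((norm (r *\<^sub>R u))\<^sup>2)) * g (\<theta> + r *\<^sub>R u) \<partial>usphere) \<partial>norm_law TYPE(real ^ 'n))"
    by (subst nn_integral_polar) auto
  also have "\<dots> = (\<integral>\<^sup>+ r. ennreal (f (r\<^sup>2)) * (\<integral>\<^sup>+ u. g (\<theta> + r *\<^sub>R u) \<partial>usphere) \<partial>norm_law TYPE(real ^ 'n))"
  proof (intro nn_integral_cong)
    fix r
    have "(\<integral>\<^sup>+ u. ennreal (f ((norm (r *\<^sub>R u))\<^sup>2)) * g (\<theta> + r *\<^sub>R u) \<partial>usphere)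
        = (\<integral>\<^sup>+ u. ennreal (f (r\<^sup>2)) * g (\<theta> + r *\<^sub>R u) \<partial>usphere)"
      by (rule nn_integral_cong_AE) (auto intro!: eventually_mono[OF AE_usphere_norm])
    then show "(\<integral>\<^sup>+ u. ennreal (f ((norm (r *\<^sub>R u))\<^sup>2)) * g (\<theta> + r *\<^sub>R u) \<partial>usphere)
        = ennreal (f (r\<^sup>2)) * (\<integral>\<^sup>+ u. g (\<theta> + r *\<^sub>R u) \<partial>usphere)"
      by (simp add: nn_integral_cmult)
  qed
  also have "\<dots> = (\<integral>\<^sup>+ r. (\<integral>\<^sup>+ u. g (\<theta> + r *\<^sub>R u) \<partial>usphere) \<partial>\<mu>)"
    unfolding \<mu>_def by (subst nn_integral_density) auto
  finally show ?thesis .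
qed

lemma sets_sph_law [simp, measurable_cong]: "sets (sph_law f (\<theta> :: real ^ 'n)) = sets borel"
  by (simp add: sph_law_def)

lemma prob_space_radial_law: "prob_space \<mu>"
proof
  have "(\<integral>\<^sup>+ x. 1 \<partial>sph_law f (0 :: real ^ 'n)) = 1"
    unfolding sph_law_def using density by (subst nn_integral_density) (auto simp: prob_density_def)
  then show "emeasure \<mu> (space \<mu>) = 1"
    by (subst (asm) nn_integral_sph_law) (auto simp: usphere.emeasure_space_1[simplified])
qed

sublocale R: prob_space \<mu> by (rule prob_space_radial_law)
sublocale RU: pair_prob_space \<mu> "usphere :: (real ^ 'n) measure" ..

lemma AE_radial_law_pos: "AE r in \<mu>. 0 < r"
proof -
  have "AE x :: real ^ 'n in lborel. 0 < norm x" using AE_lborel_neq[of 0] by eventually_elim simp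
  then have "AE r in norm_law TYPE(real ^ 'n). 0 < r" by (subst AE_distr_iff) auto
  then show ?thesis unfolding \<mu>_def by (subst AE_density) (auto elim: eventually_mono)
qed

text \<open>The stochastic representation: \<open>X\<close> is \<open>\<theta>\<close> plus a radius
  times an independent uniform direction. It turns risks into iterated integrals over radius and
  direction.\<close>

lemma sph_law_eq_distr:
  "sph_law f \<theta> = distr (\<mu> \<Otimes>\<^sub>M (usphere :: (real ^ 'n) measure)) borel (\<lambda>p. \<theta> + fst p *\<^sub>R snd p)"
proof (rule measure_eqI)
  fix A assume "A \<in> sets (sph_law f \<theta>)"
  then have [measurable]: "A \<in> sets borel" by simp
  have "emeasure (sph_law f \<theta>) A = (\<integral>\<^sup>+ r. (\<integral>\<^sup>+ u. indicator A (\<theta> + r *\<^sub>R u) \<partial>usphere) \<partial>\<mu>)"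
    by (subst nn_integral_sph_law[symmetric]) auto
  also have "\<dots> = (\<integral>\<^sup>+ p. indicator A (\<theta> + fst p *\<^sub>R snd p) \<partial>(\<mu> \<Otimes>\<^sub>M (usphere :: (real ^ 'n) measure)))"
    by (subst usphere.nn_integral_fst[symmetric]) auto
  also have "\<dots> = emeasure (distr (\<mu> \<Otimes>\<^sub>M usphere) borel (\<lambda>p. \<theta> + fst p *\<^sub>R snd p)) A"
    using nn_integral_distr[of "\<lambda>p. \<theta> + fst p *\<^sub>R snd p" "\<mu> \<Otimes>\<^sub>M usphere" borel "indicator A"] by simp
  finally show "emeasure (sph_law f \<theta>) A = \<dots>" .
qed simp

lemma AE_pair_norm: "AE p in \<mu> \<Otimes>\<^sub>M (usphere :: (real ^ 'n) measure). 0 < fst p \<and> norm (snd p) = 1"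
proof (rule RU.AE_pair_measure)
  show "AE r in \<mu>. AE u in usphere. 0 < fst (r, u :: real ^ 'n) \<and> norm (snd (r, u)) = 1"
    using AE_radial_law_pos by eventually_elim (use AE_usphere_norm in auto)
qed measurable

lemma AE_pair_neq: 
  assumes "CARD('n) \<ge> 4"
  shows "AE p in \<mu> \<Otimes>\<^sub>M (usphere :: (real ^ 'n) measure). \<theta> + fst p *\<^sub>R snd p \<noteq> 0"
proof (rule RU.AE_pair_measure)
  show "AE r in \<mu>. AE u in usphere. \<theta> + fst (r, u :: real ^ 'n) *\<^sub>R snd (r, u) \<noteq> 0"
    using AE_radial_law_pos by eventually_elim (use AE_usphere_neq[of _ \<theta>] assms in auto)
qed measurable

lemma integral_radial:
  fixes g :: "real \<Rightarrow> real"
  assumes [measurable]: "(\<lambda>r. g (r\<^sup>2)) \<in> borel_measurable borel"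
  shows "sph_expectation f (0 :: real ^ 'n) (\<lambda>x. g ((norm x)\<^sup>2)) = (\<integral>r. g (r\<^sup>2) \<partial>\<mu>)"
    and "integrable (sph_law f (0 :: real ^ 'n)) (\<lambda>x. g ((norm x)\<^sup>2)) \<longleftrightarrow> integrable \<mu> (\<lambda>r. g (r\<^sup>2))"
proof -
  have [measurable]: "(\<lambda>x :: real ^ 'n. g ((norm x)\<^sup>2)) \<in> borel_measurable borel"
    by (rule measurable_compose[where f = norm, OF _ assms]) measurable
  let ?Q = "\<mu> \<Otimes>\<^sub>M (usphere :: (real ^ 'n) measure)"
  have ae: "AE p in ?Q. g ((norm (0 + fst p *\<^sub>R snd p))\<^sup>2) = g ((fst p)\<^sup>2)"
    using AE_pair_norm by eventually_elim simp
  have d: "distr ?Q \<mu> fst = \<mu>"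
    by (rule usphere.distr_pair_fst)
  have "sph_expectation f (0 :: real ^ 'n) (\<lambda>x. g ((norm x)\<^sup>2)) = (\<integral>p. g ((norm (0 + fst p *\<^sub>R snd p))\<^sup>2) \<partial>?Q)"
    unfolding sph_expectation_def sph_law_eq_distr by (subst integral_distr) auto
  also have "\<dots> = (\<integral>p. g ((fst p)\<^sup>2) \<partial>?Q)" using ae by (intro integral_cong_AE) auto
  also have "\<dots> = (\<integral>r. g (r\<^sup>2) \<partial>distr ?Q \<mu> fst)" by (subst integral_distr) auto
  finally show "sph_expectation f (0 :: real ^ 'n) (\<lambda>x. g ((norm x)\<^sup>2)) = (\<integral>r. g (r\<^sup>2) \<partial>\<mu>)" by (simp add: d)
  have "integrable (sph_law f (0 :: real ^ 'n)) (\<lambda>x. g ((norm x)\<^sup>2)) \<longleftrightarrow> integrable ?Q (\<lambda>p. g ((norm (0 + fst p *\<^sub>R snd p))\<^sup>2))"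
    unfolding sph_law_eq_distr by (subst integrable_distr_eq) auto
  also have "\<dots> \<longleftrightarrow> integrable ?Q (\<lambda>p. g ((fst p)\<^sup>2))" using ae by (intro integrable_cong_AE) auto
  also have "\<dots> \<longleftrightarrow> integrable (distr ?Q \<mu> fst) (\<lambda>r. g (r\<^sup>2))" by (subst integrable_distr_eq) auto
  finally show "integrable (sph_law f (0 :: real ^ 'n)) (\<lambda>x. g ((norm x)\<^sup>2)) \<longleftrightarrow> integrable \<mu> (\<lambda>r. g (r\<^sup>2))" by (simp add: d)
qed

end

text \<open>The double integral of \<open>w x * w y * (f x - f y) * (g x - g y)\<close> is
  nonnegative and expands to twice the difference of the two sides. It is taken one variable at a
  time, so that only the four given integrals occur.\<close>

lemma chebyshev_integral_inequality:
  fixes w f g :: "'a \<Rightarrow> real"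
  assumes int: "integrable M w" "integrable M (\<lambda>x. w x * f x)" "integrable M (\<lambda>x. w x * g x)" 
      "integrable M (\<lambda>x. w x * f x * g x)"
    and S: "AE x in M. x \<in> S"
    and w: "\<And>x. x \<in> S \<Longrightarrow> 0 \<le> w x"
    and similar: "\<And>x y. x \<in> S \<Longrightarrow> y \<in> S \<Longrightarrow> 0 \<le> (f x - f y) * (g x - g y)"
  shows "(\<integral>x. w x * f x \<partial>M) * (\<integral>x. w x * g x \<partial>M) \<le> (\<integral>x. w x \<partial>M) * (\<integral>x. w x * f x * g x \<partial>M)"
proof -
  let ?W = "\<integral>x. w x \<partial>M" and ?F = "\<integral>x. w x * f x \<partial>M" and ?G = "\<integral>x. w x * g x \<partial>M" and ?FG = "\<integral>x. w x * f x * g x \<partial>M"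
  have 1: "0 \<le> ?FG - f y * ?G - g y * ?F + f y * g y * ?W" if y: "y \<in> S" for y
  proof -
    have "0 \<le> (\<integral>x. w x * f x * g x - f y * (w x * g x) - g y * (w x * f x) + f y * g y * w x \<partial>M)"
    proof (rule integral_nonneg_AE)
      show "AE x in M. 0 \<le> w x * f x * g x - f y * (w x * g x) - g y * (w x * f x) + f y * g y * w x"
        using S
      proof eventually_elim
        case (elim x)
        have "0 \<le> w x * ((f x - f y) * (g x - g y))" using w similar elim y by simp
        then show ?case by (simp add: algebra_simps)
      qed
    qed
    also have "\<dots> = ?FG - f y * ?G - g y * ?F + f y * g y * ?W"
      using int by simp
    finally show ?thesis .
  qed
  have "0 \<le> (\<integral>y. ?FG * w y - ?G * (w y * f y) - ?F * (w y * g y) + ?W * (w y * f y * g y) \<partial>M)"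
  proof (rule integral_nonneg_AE)
    show "AE y in M. 0 \<le> ?FG * w y - ?G * (w y * f y) - ?F * (w y * g y) + ?W * (w y * f y * g y)"
      using S
    proof eventually_elim
      case (elim y)
      have "0 \<le> w y * (?FG - f y * ?G - g y * ?F + f y * g y * ?W)" using w[OF elim] 1[OF elim] by simp
      then show ?case by (simp add: algebra_simps)
    qed
  qed
  also have "\<dots> = 2 * (?W * ?FG - ?F * ?G)"
    using int by simp
  finally show ?thesis by simp
qed

section \<open>Comparison of the risks\<close>

locale concave_loss =
  fixes \<rho> \<rho>' :: "real \<Rightarrow> real"
  assumes rho_deriv: "t \<ge> 0 \<Longrightarrow> (\<rho> has_real_derivative \<rho>' t) (at t within {0..})"
    and rho_mono: "mono_on {0..} \<rho>"
    and rho_concave: "concave_on {0..} \<rho>"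
    and rho_0: "\<rho> 0 = 0"
begin

lemma rho_nonneg: "0 \<le> t \<Longrightarrow> 0 \<le> \<rho> t"
  using mono_onD[OF rho_mono, of 0 t] rho_0 by simp

lemma rho_tangent:
  assumes "0 < v" "0 \<le> u"
  shows "\<rho> u \<le> \<rho> v + \<rho>' v * (u - v)"
proof -
  have "- \<rho> u - - \<rho> v \<ge> - \<rho>' v * (u - v)"
  proof (rule convex_on_imp_above_tangent[where A = "{0..}"])
    show "convex_on {0..} (\<lambda>t. - \<rho> t)" using rho_concave by (simp add: concave_on_def)
    show "((\<lambda>t. - \<rho> t) has_real_derivative - \<rho>' v) (at v within {0..})"
      using rho_deriv[of v] assms by (auto intro: derivative_intros)
  qed (use assms in \<open>auto simp: interior_real_atLeast\<close>)
  then show ?thesis by simp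
qed

text \<open>The tangent inequality at the endpoint 0, outside the scope of
  \<open>rho_tangent\<close>: by concavity the chord slopes \<open>\<rho> y / y\<close> decrease in
  \<open>y\<close>, and their limit at 0 is the one-sided derivative.\<close>

lemma rho_le_linear:
  assumes "0 \<le> t"
  shows "\<rho> t \<le> \<rho>' 0 * t"
proof (cases "t = 0")
  case False
  with assms have t: "0 < t" by simp
  have "((\<lambda>y. (\<rho> y - \<rho> 0) / (y - 0)) \<longlongrightarrow> \<rho>' 0) (at 0 within {0..})"
    using rho_deriv[of 0] by (simp add: has_field_derivative_iff)
  then have lim: "((\<lambda>y. \<rho> y / y) \<longlongrightarrow> \<rho>' 0) (at_right 0)"
    using rho_0 by (auto dest: tendsto_within_subset[where T = "{0<..}"])
  have "\<rho> t / t \<le> \<rho> y / y" if y: "0 < y" "y < t" for y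
  proof -
    have "(1 - y / t) * \<rho> 0 + (y / t) * \<rho> t \<le> \<rho> ((1 - y / t) *\<^sub>R 0 + (y / t) *\<^sub>R t)"
      using t y by (intro concave_onD[OF rho_concave]) (auto simp: field_simps)
    then show ?thesis using t y rho_0 by (simp add: field_simps)
  qed
  then have "eventually (\<lambda>y. \<rho> t / t \<le> \<rho> y / y) (at_right 0)"
    using eventually_at_right_less[of 0] order_tendstoD(2)[OF tendsto_ident_at t, of "{0<..}"] by (auto elim: eventually_elim2)
  then have "\<rho> t / t \<le> \<rho>' 0"
    by (intro tendsto_lowerbound[OF lim]) auto
  then show ?thesis using t by (simp add: field_simps)
qed (simp add: rho_0)

lemma rho'_nonneg: 
  assumes "0 \<le> v" shows "0 \<le> \<rho>' v"
proof (cases "v = 0")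
  case True
  have "\<rho> 0 \<le> \<rho> 1" by (intro mono_onD[OF rho_mono]) auto
  then show ?thesis using rho_le_linear[of 1] True rho_0 by simp
next
  case False
  have "\<rho> v \<le> \<rho> (v + 1)" using assms by (intro mono_onD[OF rho_mono]) auto
  then show ?thesis using rho_tangent[of v "v + 1"] assms False by simp
qed

text \<open>Add the tangent inequalities at \<open>v\<close> and at \<open>w\<close>; at
  \<open>v = 0\<close> the linear bound replaces the first one.\<close>

lemma rho'_antimono:
  assumes "0 \<le> v" "v \<le> w" shows "\<rho>' w \<le> \<rho>' v"
proof (cases "v = w")
  case False
  then have w: "0 < w" "v < w" using assms by auto
  have "\<rho> v \<le> \<rho> w + \<rho>' w * (v - w)" using w assms by (intro rho_tangent)
  moreover have "\<rho> w \<le> \<rho> v + \<rho>' v * (w - v)"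
    using rho_tangent[of v w] rho_le_linear[of w] assms w rho_0 by (cases "v = 0") auto
  ultimately have "\<rho>' w * (w - v) \<le> \<rho>' v * (w - v)" by (simp add: algebra_simps)
  then show ?thesis using w by simp
qed simp

lemma measurable_rho_sq [measurable (raw)]:
  assumes [measurable]: "g \<in> borel_measurable M"
  shows "(\<lambda>x. \<rho> ((g x)\<^sup>2)) \<in> borel_measurable M"
proof -
  have [measurable]: "(\<lambda>t. \<rho> (max 0 t)) \<in> borel_measurable borel"
    by (rule borel_measurable_mono, rule monoI, rule mono_onD[OF rho_mono]) auto
  have "(\<lambda>x. \<rho> (max 0 ((g x)\<^sup>2))) \<in> borel_measurable M" by measurable
  then show ?thesis by simp
qed

lemma measurable_rho'_sq [measurable (raw)]:
  assumes [measurable]: "g \<in> borel_measurable M"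
  shows "(\<lambda>x. \<rho>' ((g x)\<^sup>2)) \<in> borel_measurable M"
proof -
  have "mono (\<lambda>t. - \<rho>' (max 0 t))"
    by (rule monoI) (auto intro!: rho'_antimono)
  then have "(\<lambda>t. - \<rho>' (max 0 t)) \<in> borel_measurable borel"
    by (rule borel_measurable_mono)
  then have [measurable]: "(\<lambda>t. \<rho>' (max 0 t)) \<in> borel_measurable borel" by simp
  have "(\<lambda>x. \<rho>' (max 0 ((g x)\<^sup>2))) \<in> borel_measurable M" by measurable
  then show ?thesis by simp
qed

end

section \<open>Mean bounds for the shrinkage factor\<close>

locale shrinkage = spherical_density f dim + concave_loss \<rho> \<rho>' + sp: concave_profile s
  for f :: "real \<Rightarrow> real" and dim :: "'n::finite itself" and \<rho> \<rho>' s :: "real \<Rightarrow> real" +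
  assumes dim_ge: "CARD('n) \<ge> 4"
    and s_le: "t \<ge> 0 \<Longrightarrow> s t \<le> 1"
    and int_sq: "integrable \<mu> (\<lambda>r. r\<^sup>2)"
    and int_inv_sq: "integrable \<mu> (\<lambda>r. 1 / r\<^sup>2)"
begin

lemma DIM_ge: "DIM(real ^ 'n) \<ge> 4" using dim_ge by simp

abbreviation "Q \<equiv> \<mu> \<Otimes>\<^sub>M (usphere :: (real ^ 'n) measure)"

definition h :: "real ^ 'n \<Rightarrow> real" where "h x = s ((norm x)\<^sup>2) / (norm x)\<^sup>2"

lemma measurable_h [measurable]: "h \<in> borel_measurable borel"
  unfolding h_def by measurable

lemma h_nonneg: "0 \<le> h x"
  by (simp add: h_def sp.nonneg)

lemma h_sq_le: "(h x)\<^sup>2 * (norm x)\<^sup>2 \<le> h x"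
proof (cases "x = 0")
  case False
  have "s ((norm x)\<^sup>2) * s ((norm x)\<^sup>2) \<le> s ((norm x)\<^sup>2) * 1"
    by (intro mult_left_mono s_le sp.nonneg) auto
  then have "s ((norm x)\<^sup>2) * s ((norm x)\<^sup>2) / (norm x)\<^sup>2 \<le> s ((norm x)\<^sup>2) / (norm x)\<^sup>2"
    by (intro divide_right_mono) auto
  then show ?thesis using False by (simp add: h_def power2_eq_square)
qed (simp add: h_def)

lemma measurable_sphere_mean [measurable]: "(\<lambda>r. sp.sphere_mean (\<theta> :: real ^ 'n) r) \<in> borel_measurable borel"
  unfolding sp.sphere_mean_def h_def[symmetric]
  by (rule usphere.borel_measurable_lebesgue_integral) measurable

lemma sphere_mean_eq: "sp.sphere_mean \<theta> r = (\<integral>u. h (\<theta> + r *\<^sub>R u) \<partial>usphere)"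
  by (simp add: sp.sphere_mean_def h_def)

lemma sphere_mean_nonneg: "0 \<le> sp.sphere_mean (\<theta> :: real ^ 'n) r"
  unfolding sp.sphere_mean_def by (intro integral_nonneg_AE AE_I2) (simp add: sp.nonneg)

lemma sphere_mean_le_inv_sq: 
  assumes "0 < r" shows "sp.sphere_mean (\<theta> :: real ^ 'n) r \<le> 1 / r\<^sup>2"
  using sp.sphere_mean_le[OF DIM_ge assms, of \<theta>] divide_right_mono[OF s_le, of "r\<^sup>2" "r\<^sup>2"] by simp

text \<open>The sphere means of \<open>h\<close> are at most \<open>1 / r\<^sup>2\<close>, which the
  finite inverse second moment makes integrable.\<close>

lemma integrable_h: "integrable Q (\<lambda>p. h (\<theta> + fst p *\<^sub>R snd p))"
proof (rule integrableI_nonneg)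
  have "(\<integral>\<^sup>+ p. h (\<theta> + fst p *\<^sub>R snd p) \<partial>Q) = (\<integral>\<^sup>+ r. (\<integral>\<^sup>+ u. h (\<theta> + r *\<^sub>R u) \<partial>usphere) \<partial>\<mu>)"
    by (subst usphere.nn_integral_fst[symmetric]) auto
  also have "\<dots> \<le> (\<integral>\<^sup>+ r. ennreal (1 / r\<^sup>2) \<partial>\<mu>)"
  proof (rule nn_integral_mono_AE)
    show "AE r in \<mu>. (\<integral>\<^sup>+ u. h (\<theta> + r *\<^sub>R u) \<partial>usphere) \<le> ennreal (1 / r\<^sup>2)"
      using AE_radial_law_pos
    proof eventually_elim
      case (elim r)
      have "(\<integral>\<^sup>+ u. h (\<theta> + r *\<^sub>R u) \<partial>usphere) = ennreal (sp.sphere_mean \<theta> r)"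
        unfolding sp.sphere_mean_def h_def
        by (intro nn_integral_eq_integral sp.integrable_sphere_mean DIM_ge elim) (simp add: sp.nonneg)
      then show ?case using sphere_mean_le_inv_sq[OF elim, of \<theta>] by (simp add: ennreal_leI)
    qed
  qed
  also have "\<dots> < \<infinity>"
    using int_inv_sq by (subst nn_integral_eq_integral) auto
  finally show "(\<integral>\<^sup>+ p. h (\<theta> + fst p *\<^sub>R snd p) \<partial>Q) < \<infinity>" .
qed (auto simp: h_nonneg)

lemma weighted_h:
  assumes [measurable]: "g \<in> borel_measurable borel" and g: "\<And>r. \<bar>g r\<bar> \<le> B"
  shows "integrable Q (\<lambda>p. g (fst p) * h (\<theta> + fst p *\<^sub>R snd p))"
    and "(\<integral>p. g (fst p) * h (\<theta> + fst p *\<^sub>R snd p) \<partial>Q) = (\<integral>r. g r * sp.sphere_mean \<theta> r \<partial>\<mu>)"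
    and "integrable \<mu> (\<lambda>r. g r * sp.sphere_mean \<theta> r)"
proof -
  have "norm (g (fst p) * h (\<theta> + fst p *\<^sub>R snd p)) \<le> norm (B * h (\<theta> + fst p *\<^sub>R snd p))" for p
    using g[of "fst p"] unfolding norm_mult by (intro mult_right_mono) auto
  then show i: "integrable Q (\<lambda>p. g (fst p) * h (\<theta> + fst p *\<^sub>R snd p))"
    by (intro Bochner_Integration.integrable_bound[OF integrable_mult_right[OF integrable_h[of \<theta>], of B]]) auto
  show "(\<integral>p. g (fst p) * h (\<theta> + fst p *\<^sub>R snd p) \<partial>Q) = (\<integral>r. g r * sp.sphere_mean \<theta> r \<partial>\<mu>)"
    unfolding sphere_mean_eq using RU.integral_fst'[OF i] by simp
  show "integrable \<mu> (\<lambda>r. g r * sp.sphere_mean \<theta> r)"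
    unfolding sphere_mean_eq using RU.integrable_fst'[OF i] by simp
qed

lemma rho'_sq_bound: "\<bar>\<rho>' (r\<^sup>2)\<bar> \<le> \<rho>' 0"
  using rho'_nonneg[of "r\<^sup>2"] rho'_antimono[of 0 "r\<^sup>2"] by simp

lemma integrable_rho'_mult:
  assumes "integrable \<mu> g"
  shows "integrable \<mu> (\<lambda>r. \<rho>' (r\<^sup>2) * g r)"
proof (rule Bochner_Integration.integrable_bound[OF integrable_mult_right[OF assms, of "\<rho>' 0"]])
  show "(\<lambda>r. \<rho>' (r\<^sup>2) * g r) \<in> borel_measurable \<mu>"
    using borel_measurable_integrable[OF assms] by measurable
  show "AE r in \<mu>. norm (\<rho>' (r\<^sup>2) * g r) \<le> norm (\<rho>' 0 * g r)"
    using rho'_sq_bound order_trans[OF rho'_sq_bound abs_ge_self] unfolding norm_mult 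
    by (intro AE_I2 mult_right_mono) auto
qed

text \<open>With \<open>x = \<theta> + r *\<^sub>R u\<close>, Cauchy-Schwarz and
  \<open>h_sq_le\<close> dominate the integrand by \<open>\<rho>' 0 * (r\<^sup>2 + h x)\<close>, so
  the finite second moment gives integrability. The inequality is \<open>sphere_flux_ge\<close>
  integrated over the radius.\<close>

lemma weighted_flux:
  shows "integrable Q (\<lambda>p. \<rho>' ((fst p)\<^sup>2) * (h (\<theta> + fst p *\<^sub>R snd p) * (fst p * (\<theta> \<bullet> snd p) + (fst p)\<^sup>2)))" (is "integrable Q ?F")
    and "(real CARD('n) - 2) / CARD('n) * (\<integral>r. \<rho>' (r\<^sup>2) * (r\<^sup>2 * sp.sphere_mean \<theta> r) \<partial>\<mu>)
      \<le> (\<integral>p. \<rho>' ((fst p)\<^sup>2) * (h (\<theta> + fst p *\<^sub>R snd p) * (fst p * (\<theta> \<bullet> snd p) + (fst p)\<^sup>2)) \<partial>Q)"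
    and "integrable \<mu> (\<lambda>r. \<rho>' (r\<^sup>2) * (r\<^sup>2 * sp.sphere_mean \<theta> r))"
proof -
  have fst_sq: "integrable Q (\<lambda>p. (fst p)\<^sup>2)"
  proof -
    have "integrable (distr Q \<mu> fst) (\<lambda>r. r\<^sup>2)" using int_sq by (simp add: usphere.distr_pair_fst)
    then show ?thesis by (subst (asm) integrable_distr_eq) auto
  qed
  have dom: "integrable Q (\<lambda>p. \<rho>' 0 * ((fst p)\<^sup>2 + h (\<theta> + fst p *\<^sub>R snd p)))"
    by (intro integrable_mult_right Bochner_Integration.integrable_add fst_sq integrable_h)
  show i: "integrable Q ?F"
  proof (rule Bochner_Integration.integrable_bound[OF dom])
    show "AE p in Q. norm (?F p) \<le> norm (\<rho>' 0 * ((fst p)\<^sup>2 + h (\<theta> + fst p *\<^sub>R snd p)))"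
      using AE_pair_norm
    proof eventually_elim
      case (elim p)
      define r u where "r = fst p" and "u = snd p"
      have ru: "0 < r" "norm u = 1" using elim by (auto simp: r_def u_def)
      define x where "x = \<theta> + r *\<^sub>R u"
      have "r * (\<theta> \<bullet> u) + r\<^sup>2 = (r *\<^sub>R u) \<bullet> x"
        using ru by (simp add: x_def inner_add power2_eq_square inner_commute norm_eq_1)
      then have "\<bar>r * (\<theta> \<bullet> u) + r\<^sup>2\<bar> \<le> r * norm x"
        using Cauchy_Schwarz_ineq2[of "r *\<^sub>R u" x] ru by simp
      then have "\<bar>h x * (r * (\<theta> \<bullet> u) + r\<^sup>2)\<bar> \<le> h x * (r * norm x)"
        unfolding abs_mult using h_nonneg[of x] by (intro mult_mono) auto
      also have "\<dots> \<le> r\<^sup>2 + (h x * norm x)\<^sup>2"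
      proof -
        define k where "k = h x * norm x"
        have "0 \<le> r * k" using h_nonneg[of x] ru by (simp add: k_def)
        moreover have "2 * (r * k) \<le> r\<^sup>2 + k\<^sup>2" using sum_squares_bound[of r k] by (simp add: mult.assoc)
        ultimately have "r * k \<le> r\<^sup>2 + k\<^sup>2" by linarith
        then show ?thesis by (simp add: k_def mult_ac)
      qed
      also have "(h x * norm x)\<^sup>2 \<le> h x"
        using h_sq_le[of x] by (simp add: power_mult_distrib)
      finally have *: "\<bar>h x * (r * (\<theta> \<bullet> u) + r\<^sup>2)\<bar> \<le> r\<^sup>2 + h x" by simp
      have "norm (\<rho>' (r\<^sup>2) * (h x * (r * (\<theta> \<bullet> u) + r\<^sup>2))) \<le> \<rho>' 0 * (r\<^sup>2 + h x)"
        unfolding real_norm_def abs_mult[of "\<rho>' (r\<^sup>2)"] using * rho'_sq_bound[of r] by (intro mult_mono) auto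
      then show ?case by (simp add: r_def u_def x_def)
    qed
  qed measurable
  have E: "(\<integral>p. ?F p \<partial>Q) = (\<integral>r. \<rho>' (r\<^sup>2) * (\<integral>u. h (\<theta> + r *\<^sub>R u) * (r * (\<theta> \<bullet> u) + r\<^sup>2) \<partial>usphere) \<partial>\<mu>)"
    using RU.integral_fst'[OF i] by simp
  have iE: "integrable \<mu> (\<lambda>r. \<rho>' (r\<^sup>2) * (\<integral>u. h (\<theta> + r *\<^sub>R u) * (r * (\<theta> \<bullet> u) + r\<^sup>2) \<partial>usphere))"
    using RU.integrable_fst'[OF i] by simp
  show iM: "integrable \<mu> (\<lambda>r. \<rho>' (r\<^sup>2) * (r\<^sup>2 * sp.sphere_mean \<theta> r))"
  proof (intro integrable_rho'_mult R.integrable_const_bound[of _ 1])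
    show "AE r in \<mu>. norm (r\<^sup>2 * sp.sphere_mean \<theta> r) \<le> 1"
      using AE_radial_law_pos
    proof eventually_elim
      case (elim r)
      then show ?case using sphere_mean_le_inv_sq[OF elim, of \<theta>] sphere_mean_nonneg[of \<theta> r]
        by (simp add: field_simps)
    qed
  qed measurable
  have "(real CARD('n) - 2) / CARD('n) * (\<integral>r. \<rho>' (r\<^sup>2) * (r\<^sup>2 * sp.sphere_mean \<theta> r) \<partial>\<mu>)
    = (\<integral>r. (real CARD('n) - 2) / CARD('n) * (\<rho>' (r\<^sup>2) * (r\<^sup>2 * sp.sphere_mean \<theta> r)) \<partial>\<mu>)"
    by simp
  also have "\<dots> \<le> (\<integral>p. ?F p \<partial>Q)"
    unfolding E
  proof (rule integral_mono_AE[OF _ iE])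
    show "integrable \<mu> (\<lambda>r. (real CARD('n) - 2) / CARD('n) * (\<rho>' (r\<^sup>2) * (r\<^sup>2 * sp.sphere_mean \<theta> r)))"
      by (intro integrable_mult_right iM)
    show "AE r in \<mu>. (real CARD('n) - 2) / CARD('n) * (\<rho>' (r\<^sup>2) * (r\<^sup>2 * sp.sphere_mean \<theta> r))
       \<le> \<rho>' (r\<^sup>2) * (\<integral>u. h (\<theta> + r *\<^sub>R u) * (r * (\<theta> \<bullet> u) + r\<^sup>2) \<partial>usphere)"
      using AE_radial_law_pos
    proof eventually_elim
      case (elim r)
      have "\<rho>' (r\<^sup>2) * ((real CARD('n) - 2) / CARD('n) * r\<^sup>2 * sp.sphere_mean \<theta> r)
        \<le> \<rho>' (r\<^sup>2) * (\<integral>u. h (\<theta> + r *\<^sub>R u) * (r * (\<theta> \<bullet> u) + r\<^sup>2) \<partial>usphere)"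
        using sp.sphere_flux_ge[OF DIM_ge elim, of \<theta>] 
        by (intro mult_left_mono rho'_nonneg) (auto simp: h_def)
      then show ?case by (simp only: mult_ac)
    qed
  qed
  finally show "(real CARD('n) - 2) / CARD('n) * (\<integral>r. \<rho>' (r\<^sup>2) * (r\<^sup>2 * sp.sphere_mean \<theta> r) \<partial>\<mu>) \<le> (\<integral>p. ?F p \<partial>Q)" .
qed

text \<open>In radial form, \<open>K\<^sub>\<rho>\<close> is the constant \<open>K\<close> of the
  theorem and \<open>I\<^sub>\<rho>\<close> the expectation in its second bound.
  \<open>P \<theta>\<close> is the common scale to which all terms of the risk difference are
  reduced.\<close>

definition "K\<^sub>\<rho> = (\<integral>r. \<rho>' (r\<^sup>2) \<partial>\<mu>)"
definition "I\<^sub>\<rho> = (\<integral>r. \<rho>' (r\<^sup>2) / r\<^sup>2 \<partial>\<mu>)"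
definition "P \<theta> = (\<integral>r. \<rho>' (r\<^sup>2) * sp.sphere_mean (\<theta> :: real ^ 'n) r \<partial>\<mu>)"

lemma integrable_rho': "integrable \<mu> (\<lambda>r. \<rho>' (r\<^sup>2))"
  using integrable_rho'_mult[of "\<lambda>_. 1"] by simp

lemma integrable_rho'_mean: "integrable \<mu> (\<lambda>r. \<rho>' (r\<^sup>2) * sp.sphere_mean (\<theta> :: real ^ 'n) r)"
  by (rule weighted_h(3)[OF _ rho'_sq_bound]) measurable

text \<open>Chebyshev's inequality under \<open>\<mu>\<close>: \<open>\<rho>' (r\<^sup>2)\<close>
  and the sphere mean both decrease with \<open>r\<close>.\<close>

lemma K_mean_le: "K\<^sub>\<rho> * (\<integral>r. sp.sphere_mean (\<theta> :: real ^ 'n) r \<partial>\<mu>) \<le> P \<theta>"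
proof -
  have "(\<integral>r. 1 * \<rho>' (r\<^sup>2) \<partial>\<mu>) * (\<integral>r. 1 * sp.sphere_mean \<theta> r \<partial>\<mu>) 
    \<le> (\<integral>r. 1 \<partial>\<mu>) * (\<integral>r. 1 * \<rho>' (r\<^sup>2) * sp.sphere_mean \<theta> r \<partial>\<mu>)"
  proof (rule chebyshev_integral_inequality[where S = "{0<..}"])
    show "integrable \<mu> (\<lambda>r. 1 * sp.sphere_mean \<theta> r)"
      by (rule weighted_h(3)[of _ 1]) auto
    show "0 \<le> (\<rho>' (x\<^sup>2) - \<rho>' (y\<^sup>2)) * (sp.sphere_mean \<theta> x - sp.sphere_mean \<theta> y)"
      if "x \<in> {0<..}" "y \<in> {0<..}" for x y
    proof (cases "x \<le> y")
      case True
      then show ?thesis using that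
        by (intro mult_nonneg_nonneg) (auto intro!: rho'_antimono power_mono sp.sphere_mean_antimono DIM_ge)
    next
      case False
      then show ?thesis using that
        by (intro mult_nonpos_nonpos) (auto intro!: rho'_antimono power_mono sp.sphere_mean_antimono DIM_ge)
    qed
  qed (use AE_radial_law_pos integrable_rho' integrable_rho'_mean in auto)
  then show ?thesis by (simp add: K\<^sub>\<rho>_def P_def R.prob_space[simplified])
qed

text \<open>Under the weight \<open>\<rho>' (r\<^sup>2)\<close>, the factor
  \<open>1 / r\<^sup>2\<close> decreases and \<open>r\<^sup>2\<close> times the sphere mean
  increases. Negating the latter makes the pair similarly ordered, as Chebyshev's inequality
  requires.\<close>

lemma K_P_le: "K\<^sub>\<rho> * P \<theta> \<le> I\<^sub>\<rho> * (\<integral>r. \<rho>' (r\<^sup>2) * (r\<^sup>2 * sp.sphere_mean (\<theta> :: real ^ 'n) r) \<partial>\<mu>)"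
proof -
  have eq: "AE r in \<mu>. \<rho>' (r\<^sup>2) * (1 / r\<^sup>2) * - (r\<^sup>2 * sp.sphere_mean \<theta> r) = - (\<rho>' (r\<^sup>2) * sp.sphere_mean \<theta> r)"
    using AE_radial_law_pos by eventually_elim simp
  have "(\<integral>r. \<rho>' (r\<^sup>2) * (1 / r\<^sup>2) \<partial>\<mu>) * (\<integral>r. \<rho>' (r\<^sup>2) * - (r\<^sup>2 * sp.sphere_mean \<theta> r) \<partial>\<mu>) 
    \<le> (\<integral>r. \<rho>' (r\<^sup>2) \<partial>\<mu>) * (\<integral>r. \<rho>' (r\<^sup>2) * (1 / r\<^sup>2) * - (r\<^sup>2 * sp.sphere_mean \<theta> r) \<partial>\<mu>)"
  proof (rule chebyshev_integral_inequality[where S = "{0<..}"])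
    show "integrable \<mu> (\<lambda>r. \<rho>' (r\<^sup>2) * (1 / r\<^sup>2))" by (intro integrable_rho'_mult int_inv_sq)
    show "integrable \<mu> (\<lambda>r. \<rho>' (r\<^sup>2) * - (r\<^sup>2 * sp.sphere_mean \<theta> r))"
      using weighted_flux(3)[of \<theta>] by simp
    have "integrable \<mu> (\<lambda>r. - (\<rho>' (r\<^sup>2) * sp.sphere_mean \<theta> r))" using integrable_rho'_mean by simp
    then show "integrable \<mu> (\<lambda>r. \<rho>' (r\<^sup>2) * (1 / r\<^sup>2) * - (r\<^sup>2 * sp.sphere_mean \<theta> r))"
    proof (rule integrable_cong_AE_imp)
      show "AE r in \<mu>. - (\<rho>' (r\<^sup>2) * sp.sphere_mean \<theta> r) = \<rho>' (r\<^sup>2) * (1 / r\<^sup>2) * - (r\<^sup>2 * sp.sphere_mean \<theta> r)"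
        using eq by eventually_elim (rule sym)
    qed measurable
    show "0 \<le> (1 / x\<^sup>2 - 1 / y\<^sup>2) * (- (x\<^sup>2 * sp.sphere_mean \<theta> x) - - (y\<^sup>2 * sp.sphere_mean \<theta> y))"
      if "x \<in> {0<..}" "y \<in> {0<..}" for x y
    proof (cases "x \<le> y")
      case True
      then show ?thesis using that sp.sq_sphere_mean_mono[OF DIM_ge, of x y \<theta>]
        by (intro mult_nonneg_nonneg) (auto intro!: frac_le power_mono)
    next
      case False
      then show ?thesis using that sp.sq_sphere_mean_mono[OF DIM_ge, of y x \<theta>]
        by (intro mult_nonpos_nonpos) (auto intro!: frac_le power_mono)
    qed
  qed (use AE_radial_law_pos integrable_rho' rho'_nonneg in auto)
  also have "(\<integral>r. \<rho>' (r\<^sup>2) * (1 / r\<^sup>2) * - (r\<^sup>2 * sp.sphere_mean \<theta> r) \<partial>\<mu>) = - P \<theta>"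
    unfolding P_def integral_minus[symmetric] by (rule integral_cong_AE[OF _ _ eq]) measurable
  finally show ?thesis by (simp add: K\<^sub>\<rho>_def I\<^sub>\<rho>_def)
qed

lemma P_nonneg: "0 \<le> P \<theta>"
  unfolding P_def by (intro integral_nonneg_AE AE_I2 mult_nonneg_nonneg rho'_nonneg sphere_mean_nonneg) auto

text \<open>One positive value of \<open>s\<close> makes \<open>s\<close> positive on the whole
  positive axis: to the right by monotonicity, to the left by \<open>ratio_antimono\<close>. At
  center 0 the sphere mean is \<open>s (r\<^sup>2) / r\<^sup>2\<close>, so \<open>P 0 = 0\<close>
  would force \<open>\<rho>' (r\<^sup>2)\<close> to vanish almost everywhere, against
  \<open>0 < K\<^sub>\<rho>\<close>.\<close>

lemma P_0_pos:
  assumes "0 < K\<^sub>\<rho>" and nz: "0 \<le> t" "s t \<noteq> 0"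
  shows "0 < P (0 :: real ^ 'n)"
proof (rule ccontr)
  assume "\<not> 0 < P 0"
  then have "P 0 = 0" using P_nonneg[of 0] by simp
  then have "AE r in \<mu>. \<rho>' (r\<^sup>2) * sp.sphere_mean (0 :: real ^ 'n) r = 0"
    unfolding P_def
    by (subst (asm) integral_nonneg_eq_0_iff_AE[OF integrable_rho'_mean])
       (auto intro!: AE_I2 mult_nonneg_nonneg rho'_nonneg sphere_mean_nonneg)
  then have "AE r in \<mu>. \<rho>' (r\<^sup>2) = 0"
    using AE_radial_law_pos
  proof eventually_elim
    case (elim r)
    have st: "0 < s t" using nz sp.nonneg[of t] by simp
    have "0 < s (r\<^sup>2)"
    proof (cases "t \<le> r\<^sup>2")
      case True
      then show ?thesis using st nz mono_onD[OF sp.mono, of t "r\<^sup>2"] by simp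
    next
      case False
      have "0 < s t / t" using st False elim by (intro divide_pos_pos) (auto intro: order_less_trans[of 0 "r\<^sup>2"])
      also have "\<dots> \<le> s (r\<^sup>2) / r\<^sup>2" using False elim by (intro sp.ratio_antimono) auto
      finally show ?thesis using elim by (simp add: zero_less_divide_iff)
    qed
    moreover have "sp.sphere_mean (0 :: real ^ 'n) r = s (r\<^sup>2) / r\<^sup>2"
    proof -
      have "sp.sphere_mean (0 :: real ^ 'n) r = (\<integral>u. s (r\<^sup>2) / r\<^sup>2 \<partial>(usphere :: (real ^ 'n) measure))"
        unfolding sp.sphere_mean_def
      proof (rule integral_cong_AE)
        show "AE u :: real ^ 'n in usphere. s ((norm (0 + r *\<^sub>R u))\<^sup>2) / (norm (0 + r *\<^sub>R u))\<^sup>2 = s (r\<^sup>2) / r\<^sup>2"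
          using AE_usphere_norm by eventually_elim simp
      qed measurable
      then show ?thesis by simp
    qed
    ultimately show ?case using elim by simp
  qed
  then have "K\<^sub>\<rho> = 0" unfolding K\<^sub>\<rho>_def by (intro integral_eq_zero_AE)
  then show False using assms by simp
qed

text \<open>An upper bound for the difference of the losses at \<open>\<theta> + r *\<^sub>R u\<close>, where \<open>p = (r, u)\<close> and \<open>b = a (1 - \<omega>)\<close>.\<close>

definition excess :: "real \<Rightarrow> real \<Rightarrow> real ^ 'n \<Rightarrow> real \<times> (real ^ 'n) \<Rightarrow> real" where
  "excess \<omega> b \<theta> p = 
    \<omega> * (\<rho>' 0 * (b\<^sup>2 * h (\<theta> + fst p *\<^sub>R snd p))) 
    + (1 - \<omega>) * (b\<^sup>2 * (\<rho>' ((fst p)\<^sup>2) * h (\<theta> + fst p *\<^sub>R snd p))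
      - 2 * b * (\<rho>' ((fst p)\<^sup>2) * (h (\<theta> + fst p *\<^sub>R snd p) * (fst p * (\<theta> \<bullet> snd p) + (fst p)\<^sup>2))))"

lemma integrable_excess: "integrable Q (excess \<omega> b \<theta>)"
  unfolding excess_def[abs_def]
  by (intro Bochner_Integration.integrable_add Bochner_Integration.integrable_diff integrable_mult_right 
      integrable_h weighted_flux(1) weighted_h(1)[OF _ rho'_sq_bound]) measurable

text \<open>After multiplication by \<open>K\<^sub>\<rho> * I\<^sub>\<rho>\<close>, the two
  Chebyshev bounds and the flux bound turn every term into a multiple of
  \<open>P \<theta>\<close>.\<close>

lemma integral_excess_le:
  assumes w: "0 \<le> \<omega>" "\<omega> < 1" and "0 < K\<^sub>\<rho>" and a: "0 < a"
    and bound: "a * ((\<omega> * \<rho>' 0 + K\<^sub>\<rho> * (1 - \<omega>)) * I\<^sub>\<rho>) < 2 * K\<^sub>\<rho>\<^sup>2 * (real CARD('n) - 2) / CARD('n)"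
    and "0 < I\<^sub>\<rho>"
  shows "\<exists>c>0. (\<integral>p. excess \<omega> (a * (1 - \<omega>)) \<theta> p \<partial>Q) \<le> - c * P \<theta>"
proof -
  define b where "b = a * (1 - \<omega>)"
  have b: "0 < b" using a w by (simp add: b_def)
  define m where "m = (\<integral>r. sp.sphere_mean \<theta> r \<partial>\<mu>)"
  define q where "q = (\<integral>r. \<rho>' (r\<^sup>2) * (r\<^sup>2 * sp.sphere_mean \<theta> r) \<partial>\<mu>)"
  define N where "N = (\<integral>p. \<rho>' ((fst p)\<^sup>2) * (h (\<theta> + fst p *\<^sub>R snd p) * (fst p * (\<theta> \<bullet> snd p) + (fst p)\<^sup>2)) \<partial>Q)"
  define \<kappa> where "\<kappa> = (real CARD('n) - 2) / CARD('n)"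
  have \<kappa>: "0 \<le> \<kappa>" using dim_ge by (simp add: \<kappa>_def)
  have r0: "0 \<le> \<rho>' 0" by (rule rho'_nonneg) simp
  have m: "(\<integral>p. h (\<theta> + fst p *\<^sub>R snd p) \<partial>Q) = m"
    using weighted_h(2)[of "\<lambda>_. 1" 1 \<theta>] by (simp add: m_def)
  have P: "(\<integral>p. \<rho>' ((fst p)\<^sup>2) * h (\<theta> + fst p *\<^sub>R snd p) \<partial>Q) = P \<theta>"
    unfolding P_def by (rule weighted_h(2)[OF _ rho'_sq_bound]) measurable
  have iP: "integrable Q (\<lambda>p. \<rho>' ((fst p)\<^sup>2) * h (\<theta> + fst p *\<^sub>R snd p))"
    by (rule weighted_h(1)[OF _ rho'_sq_bound]) measurable
  have T: "(\<integral>p. excess \<omega> b \<theta> p \<partial>Q) = \<omega> * (\<rho>' 0 * (b\<^sup>2 * m)) + (1 - \<omega>) * (b\<^sup>2 * P \<theta> - 2 * b * N)"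
    unfolding excess_def N_def using integrable_h[of \<theta>] weighted_flux(1)[of \<theta>] iP
    by (simp add: m P)
  have Km: "K\<^sub>\<rho> * m \<le> P \<theta>" using K_mean_le[of \<theta>] by (simp add: m_def)
  have KP: "K\<^sub>\<rho> * P \<theta> \<le> I\<^sub>\<rho> * q" using K_P_le[of \<theta>] by (simp add: q_def)
  have Nq: "\<kappa> * q \<le> N" using weighted_flux(2)[of \<theta>] by (simp add: \<kappa>_def q_def N_def)
  \<comment> \<open>The coefficient of \<open>- P \<theta>\<close> in the final bound. Its last
    factor is positive exactly by the condition on \<open>a\<close>, cleared of
    denominators.\<close>
  define g where "g = b * (1 - \<omega>) * (2 * K\<^sub>\<rho>\<^sup>2 * \<kappa> - a * ((\<omega> * \<rho>' 0 + K\<^sub>\<rho> * (1 - \<omega>)) * I\<^sub>\<rho>))"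
  have g: "0 < g" using b w bound by (simp add: g_def \<kappa>_def)
  have "K\<^sub>\<rho> * I\<^sub>\<rho> * (\<integral>p. excess \<omega> b \<theta> p \<partial>Q) = (\<omega> * \<rho>' 0 * b\<^sup>2 * I\<^sub>\<rho>) * (K\<^sub>\<rho> * m) + (1 - \<omega>) * b\<^sup>2 * K\<^sub>\<rho> * I\<^sub>\<rho> * P \<theta>
      - 2 * b * (1 - \<omega>) * K\<^sub>\<rho> * (I\<^sub>\<rho> * N)"
    unfolding T by (simp add: algebra_simps)
  also have "\<dots> \<le> (\<omega> * \<rho>' 0 * b\<^sup>2 * I\<^sub>\<rho>) * P \<theta> + (1 - \<omega>) * b\<^sup>2 * K\<^sub>\<rho> * I\<^sub>\<rho> * P \<theta> - 2 * b * (1 - \<omega>) * K\<^sub>\<rho> * (\<kappa> * (K\<^sub>\<rho> * P \<theta>))"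
  proof (intro diff_mono add_right_mono mult_left_mono Km)
    have "\<kappa> * (K\<^sub>\<rho> * P \<theta>) \<le> \<kappa> * (I\<^sub>\<rho> * q)" using KP \<kappa> by (rule mult_left_mono)
    also have "\<dots> = I\<^sub>\<rho> * (\<kappa> * q)" by simp
    also have "\<dots> \<le> I\<^sub>\<rho> * N" using Nq \<open>0 < I\<^sub>\<rho>\<close> by (intro mult_left_mono) auto
    finally show "\<kappa> * (K\<^sub>\<rho> * P \<theta>) \<le> I\<^sub>\<rho> * N" .
  qed (use w b r0 \<open>0 < I\<^sub>\<rho>\<close> \<open>0 < K\<^sub>\<rho>\<close> in auto)
  also have "\<dots> = - g * P \<theta>"
    unfolding g_def b_def by (simp add: algebra_simps power2_eq_square)
  finally have "(\<integral>p. excess \<omega> b \<theta> p \<partial>Q) \<le> - (g / (K\<^sub>\<rho> * I\<^sub>\<rho>)) * P \<theta>"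
    using \<open>0 < I\<^sub>\<rho>\<close> \<open>0 < K\<^sub>\<rho>\<close> by (simp add: field_simps)
  then show ?thesis using g \<open>0 < I\<^sub>\<rho>\<close> \<open>0 < K\<^sub>\<rho>\<close> by (intro exI[of _ "g / (K\<^sub>\<rho> * I\<^sub>\<rho>)"]) (auto simp: b_def)
qed

end

section \<open>Risks of the two estimators\<close>

context shrinkage
begin

lemma integrable_rho: "integrable Q (\<lambda>p. \<rho> ((fst p)\<^sup>2))"
proof -
  have "integrable \<mu> (\<lambda>r. \<rho> (r\<^sup>2))"
    by (rule Bochner_Integration.integrable_bound[OF integrable_mult_right[OF int_sq, of "\<rho>' 0"]])
       (auto intro!: AE_I2 rho_le_linear order_trans[OF _ abs_ge_self] simp: rho_nonneg)
  then have "integrable (distr Q \<mu> fst) (\<lambda>r. \<rho> (r\<^sup>2))" by (simp add: usphere.distr_pair_fst)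
  then show ?thesis by (subst (asm) integrable_distr_eq) auto
qed

lemma risk_eq:
  assumes [measurable]: "(\<lambda>x. L x \<theta> (\<delta> x)) \<in> borel_measurable borel"
  shows "risk f L \<theta> \<delta> = (\<integral>\<^sup>+ p. ennreal (L (\<theta> + fst p *\<^sub>R snd p) \<theta> (\<delta> (\<theta> + fst p *\<^sub>R snd p))) \<partial>Q)"
  unfolding risk_def sph_law_eq_distr by (subst nn_integral_distr) auto

lemma risk_identity:
  fixes \<theta> :: "real ^ 'n"
  assumes w: "0 \<le> \<omega>" "\<omega> < 1"
  shows "risk f (balanced_loss \<omega> \<rho> (\<lambda>x. x)) \<theta> (\<lambda>x. x) = ennreal ((1 - \<omega>) * (\<integral>p. \<rho> ((fst p)\<^sup>2) \<partial>Q))"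
proof -
  have m: "(\<lambda>x. balanced_loss \<omega> \<rho> (\<lambda>x. x) x \<theta> x) \<in> borel_measurable borel"
    unfolding balanced_loss_def by measurable
  have "risk f (balanced_loss \<omega> \<rho> (\<lambda>x. x)) \<theta> (\<lambda>x. x)
     = (\<integral>\<^sup>+ p. ennreal ((1 - \<omega>) * \<rho> ((norm (fst p *\<^sub>R snd p))\<^sup>2)) \<partial>Q)"
    unfolding risk_eq[of "balanced_loss \<omega> \<rho> (\<lambda>x. x)" \<theta> "\<lambda>x. x", OF m] by (simp add: balanced_loss_def rho_0)
  also have "\<dots> = (\<integral>\<^sup>+ p. ennreal ((1 - \<omega>) * \<rho> ((fst p)\<^sup>2)) \<partial>Q)"
  proof (rule nn_integral_cong_AE)
    show "AE p in Q. ennreal ((1 - \<omega>) * \<rho> ((norm (fst p *\<^sub>R snd p))\<^sup>2)) = ennreal ((1 - \<omega>) * \<rho> ((fst p)\<^sup>2))"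
      using AE_pair_norm by eventually_elim simp
  qed
  also have "\<dots> = ennreal (\<integral>p. (1 - \<omega>) * \<rho> ((fst p)\<^sup>2) \<partial>Q)"
    using w by (intro nn_integral_eq_integral integrable_mult_right integrable_rho AE_I2) (auto simp: rho_nonneg)
  finally show ?thesis by simp
qed

text \<open>The target term is bounded by the tangent of \<open>\<rho>\<close> at 0, which is where
  \<open>\<rho>' 0\<close> comes from; the estimation term is bounded by the tangent at
  \<open>r\<^sup>2\<close>. The bound \<open>h_sq_le\<close> makes the quadratic terms linear in
  \<open>h\<close>.\<close>

lemma shrink_loss_le:
  fixes x \<theta> :: "real ^ 'n"
  assumes w: "0 \<le> \<omega>" "\<omega> < 1" and r: "0 < r" and u: "norm u = 1" and x: "x = \<theta> + r *\<^sub>R u" "x \<noteq> 0"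
  shows "balanced_loss \<omega> \<rho> (\<lambda>x. x) x \<theta> (shrink_est \<omega> a s x) 
    \<le> (1 - \<omega>) * \<rho> (r\<^sup>2) + excess \<omega> (a * (1 - \<omega>)) \<theta> (r, u)"
proof -
  define b where "b = a * (1 - \<omega>)"
  define k where "k = h x"
  have \<delta>: "shrink_est \<omega> a s x = x - (b * k) *\<^sub>R x"
    by (simp add: shrink_est_def b_def k_def h_def scaleR_left_diff_distrib)
  have k: "k\<^sup>2 * (norm x)\<^sup>2 \<le> k"
    unfolding k_def by (rule h_sq_le)
  have bk: "(norm ((b * k) *\<^sub>R x))\<^sup>2 \<le> b\<^sup>2 * k"
    using mult_left_mono[OF k, of "b\<^sup>2"] by (simp add: power_mult_distrib mult_ac)
  have r0: "0 \<le> \<rho>' 0" by (rule rho'_nonneg) simp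
  have 1: "\<rho> ((norm (shrink_est \<omega> a s x - x))\<^sup>2) \<le> \<rho>' 0 * (b\<^sup>2 * k)"
  proof -
    have "\<rho> ((norm (shrink_est \<omega> a s x - x))\<^sup>2) \<le> \<rho>' 0 * (norm ((b * k) *\<^sub>R x))\<^sup>2"
      using rho_le_linear[of "(norm ((b * k) *\<^sub>R x))\<^sup>2"] by (simp add: \<delta>)
    also have "\<dots> \<le> \<rho>' 0 * (b\<^sup>2 * k)" using bk r0 by (rule mult_left_mono)
    finally show ?thesis .
  qed
  have inner: "(r *\<^sub>R u) \<bullet> x = r * (\<theta> \<bullet> u) + r\<^sup>2"
    using u by (simp add: x inner_add power2_eq_square inner_commute norm_eq_1)
  have "shrink_est \<omega> a s x - \<theta> = r *\<^sub>R u + - ((b * k) *\<^sub>R x)" by (simp add: \<delta>) (simp add: x)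
  then have "(norm (shrink_est \<omega> a s x - \<theta>))\<^sup>2 = r\<^sup>2 - 2 * (b * k * ((r *\<^sub>R u) \<bullet> x)) + (norm ((b * k) *\<^sub>R x))\<^sup>2"
    using u by (simp only: norm_add_sq) (simp add: power_mult_distrib)
  then have "(norm (shrink_est \<omega> a s x - \<theta>))\<^sup>2 - r\<^sup>2 \<le> b\<^sup>2 * k - 2 * b * (k * (r * (\<theta> \<bullet> u) + r\<^sup>2))"
    using bk unfolding inner by (simp add: algebra_simps)
  then have "\<rho>' (r\<^sup>2) * ((norm (shrink_est \<omega> a s x - \<theta>))\<^sup>2 - r\<^sup>2)
      \<le> \<rho>' (r\<^sup>2) * (b\<^sup>2 * k - 2 * b * (k * (r * (\<theta> \<bullet> u) + r\<^sup>2)))"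
    by (intro mult_left_mono rho'_nonneg) auto
  moreover have "\<rho> ((norm (shrink_est \<omega> a s x - \<theta>))\<^sup>2) 
      \<le> \<rho> (r\<^sup>2) + \<rho>' (r\<^sup>2) * ((norm (shrink_est \<omega> a s x - \<theta>))\<^sup>2 - r\<^sup>2)"
    using r by (intro rho_tangent) auto
  ultimately have 2: "\<rho> ((norm (shrink_est \<omega> a s x - \<theta>))\<^sup>2) 
      \<le> \<rho> (r\<^sup>2) + \<rho>' (r\<^sup>2) * (b\<^sup>2 * k - 2 * b * (k * (r * (\<theta> \<bullet> u) + r\<^sup>2)))"
    by linarith
  have "balanced_loss \<omega> \<rho> (\<lambda>x. x) x \<theta> (shrink_est \<omega> a s x)
     \<le> \<omega> * (\<rho>' 0 * (b\<^sup>2 * k)) + (1 - \<omega>) * (\<rho> (r\<^sup>2) + \<rho>' (r\<^sup>2) * (b\<^sup>2 * k - 2 * b * (k * (r * (\<theta> \<bullet> u) + r\<^sup>2))))"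
    unfolding balanced_loss_def using w by (intro add_mono mult_left_mono 1 2) auto
  also have "\<dots> = (1 - \<omega>) * \<rho> (r\<^sup>2) + excess \<omega> b \<theta> (r, u)"
    unfolding excess_def by (simp add: k_def x(1) algebra_simps)
  finally show ?thesis by (simp add: b_def)
qed

text \<open>The second claim guards against \<open>ennreal\<close>, which sends negative reals to 0:
  together with a negative mean excess it makes the risk of the identity positive, so that a strict
  comparison of reals survives.\<close>

lemma risk_shrink_le:
  assumes w: "0 \<le> \<omega>" "\<omega> < 1"
  shows "risk f (balanced_loss \<omega> \<rho> (\<lambda>x. x)) \<theta> (shrink_est \<omega> a s) 
    \<le> ennreal ((1 - \<omega>) * (\<integral>p. \<rho> ((fst p)\<^sup>2) \<partial>Q) + (\<integral>p. excess \<omega> (a * (1 - \<omega>)) \<theta> p \<partial>Q))"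
    and "0 \<le> (1 - \<omega>) * (\<integral>p. \<rho> ((fst p)\<^sup>2) \<partial>Q) + (\<integral>p. excess \<omega> (a * (1 - \<omega>)) \<theta> p \<partial>Q)"
proof -
  let ?L = "balanced_loss \<omega> \<rho> (\<lambda>x. x)" and ?\<delta> = "shrink_est \<omega> a s :: real ^ 'n \<Rightarrow> real ^ 'n"
  let ?B = "\<lambda>p. (1 - \<omega>) * \<rho> ((fst p)\<^sup>2) + excess \<omega> (a * (1 - \<omega>)) \<theta> p"
  have [measurable]: "?\<delta> \<in> borel_measurable borel"
    unfolding shrink_est_def[abs_def] by measurable
  have m: "(\<lambda>x. ?L x \<theta> (?\<delta> x)) \<in> borel_measurable borel"
    unfolding balanced_loss_def by measurable
  have le: "AE p in Q. ?L (\<theta> + fst p *\<^sub>R snd p) \<theta> (?\<delta> (\<theta> + fst p *\<^sub>R snd p)) \<le> ?B p"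
    using AE_pair_norm AE_pair_neq[OF dim_ge, of \<theta>]
  proof eventually_elim
    case (elim p)
    then show ?case using shrink_loss_le[OF w, of "fst p" "snd p" "\<theta> + fst p *\<^sub>R snd p" \<theta> a] by simp
  qed
  have pos: "AE p in Q. 0 \<le> ?B p"
    using le
  proof eventually_elim
    case (elim p)
    have "0 \<le> ?L (\<theta> + fst p *\<^sub>R snd p) \<theta> (?\<delta> (\<theta> + fst p *\<^sub>R snd p))"
      unfolding balanced_loss_def using w by (intro add_nonneg_nonneg mult_nonneg_nonneg rho_nonneg) auto
    then show ?case using elim by simp
  qed
  have iB: "integrable Q ?B"
    by (intro Bochner_Integration.integrable_add integrable_mult_right integrable_rho integrable_excess)
  have eq: "(\<integral>p. ?B p \<partial>Q) = (1 - \<omega>) * (\<integral>p. \<rho> ((fst p)\<^sup>2) \<partial>Q) + (\<integral>p. excess \<omega> (a * (1 - \<omega>)) \<theta> p \<partial>Q)"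
    by (subst Bochner_Integration.integral_add) (auto intro: integrable_rho integrable_excess)
  have "risk f ?L \<theta> ?\<delta> \<le> (\<integral>\<^sup>+ p. ennreal (?B p) \<partial>Q)"
    unfolding risk_eq[of ?L, OF m] using le by (intro nn_integral_mono_AE) (auto elim!: eventually_mono intro: ennreal_leI)
  also have "\<dots> = ennreal (\<integral>p. ?B p \<partial>Q)"
    using iB pos by (rule nn_integral_eq_integral)
  finally show "risk f ?L \<theta> ?\<delta> 
    \<le> ennreal ((1 - \<omega>) * (\<integral>p. \<rho> ((fst p)\<^sup>2) \<partial>Q) + (\<integral>p. excess \<omega> (a * (1 - \<omega>)) \<theta> p \<partial>Q))"
    by (simp only: eq)
  show "0 \<le> (1 - \<omega>) * (\<integral>p. \<rho> ((fst p)\<^sup>2) \<partial>Q) + (\<integral>p. excess \<omega> (a * (1 - \<omega>)) \<theta> p \<partial>Q)"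
    using integral_nonneg_AE[OF pos] by (simp only: eq)
qed

lemma K_nonneg: "0 \<le> K\<^sub>\<rho>"
  unfolding K\<^sub>\<rho>_def by (intro integral_nonneg_AE AE_I2 rho'_nonneg) simp

lemma I_nonneg: "0 \<le> I\<^sub>\<rho>"
  unfolding I\<^sub>\<rho>_def by (intro integral_nonneg_AE AE_I2 divide_nonneg_nonneg rho'_nonneg) auto

lemma shrink_est_dominates:
  assumes w: "0 \<le> \<omega>" "\<omega> < 1" and nz: "\<exists>t\<ge>0. s t \<noteq> 0" and rho'_0: "0 < \<rho>' 0"
    and a: "0 < a" "a < (2 * K\<^sub>\<rho>\<^sup>2 * (real CARD('n) - 2) / CARD('n)) / ((\<omega> * \<rho>' 0 + K\<^sub>\<rho> * (1 - \<omega>)) * I\<^sub>\<rho>)"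
  shows "dominates f (balanced_loss \<omega> \<rho> (\<lambda>x. x)) (shrink_est \<omega> a s) (\<lambda>x :: real ^ 'n. x)"
proof -
  \<comment> \<open>If either constant were 0, the upper bound on \<open>a\<close> would evaluate to
    0, through its numerator or by the convention for division by 0, against
    \<open>0 < a\<close>.\<close>
  have "K\<^sub>\<rho> \<noteq> 0" "I\<^sub>\<rho> \<noteq> 0" using a by auto
  then have KI: "0 < K\<^sub>\<rho>" "0 < I\<^sub>\<rho>" using K_nonneg I_nonneg by auto
  have "0 < \<omega> * \<rho>' 0 + K\<^sub>\<rho> * (1 - \<omega>)"
    using w rho'_0 KI by (intro add_nonneg_pos) auto
  then have "a * ((\<omega> * \<rho>' 0 + K\<^sub>\<rho> * (1 - \<omega>)) * I\<^sub>\<rho>) < 2 * K\<^sub>\<rho>\<^sup>2 * (real CARD('n) - 2) / CARD('n)"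
    using a(2) KI by (subst (asm) pos_less_divide_eq) auto
  note ex = integral_excess_le[OF w KI(1) a(1) this KI(2)]
  define A where "A = (1 - \<omega>) * (\<integral>p. \<rho> ((fst p)\<^sup>2) \<partial>Q)"
  define D where "D \<theta> = (\<integral>p. excess \<omega> (a * (1 - \<omega>)) \<theta> p \<partial>Q)" for \<theta>
  have id: "risk f (balanced_loss \<omega> \<rho> (\<lambda>x. x)) \<theta> (\<lambda>x :: real ^ 'n. x) = ennreal A" for \<theta>
    unfolding A_def by (rule risk_identity[OF w])
  have sh: "risk f (balanced_loss \<omega> \<rho> (\<lambda>x. x)) \<theta> (shrink_est \<omega> a s) \<le> ennreal (A + D \<theta>)" "0 \<le> A + D \<theta>" 
    for \<theta> :: "real ^ 'n"
    unfolding A_def D_def by (rule risk_shrink_le[OF w])+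
  show ?thesis
    unfolding dominates_def
  \<comment> \<open>Strict improvement is shown at \<open>\<theta> = 0\<close>, where
    \<open>P\<close> is positive by \<open>P_0_pos\<close>.\<close>
  proof (intro conjI allI exI[of _ 0])
    fix \<theta> :: "real ^ 'n"
    obtain c where "0 < c" "D \<theta> \<le> - c * P \<theta>" using ex[of \<theta>] by (auto simp: D_def)
    moreover from this have "0 \<le> c * P \<theta>" using P_nonneg[of \<theta>] by simp
    ultimately have "D \<theta> \<le> 0" by simp
    then show "risk f (balanced_loss \<omega> \<rho> (\<lambda>x. x)) \<theta> (shrink_est \<omega> a s) \<le> risk f (balanced_loss \<omega> \<rho> (\<lambda>x. x)) \<theta> (\<lambda>x. x)"
      unfolding id by (intro order_trans[OF sh(1)] ennreal_leI) simp
  next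
    obtain c where "0 < c" "D 0 \<le> - c * P 0" using ex[of 0] by (auto simp: D_def)
    moreover obtain t where "0 \<le> t" "s t \<noteq> 0" using nz by blast
    ultimately have "0 < c * P 0" using P_0_pos[OF KI(1), of t] by simp
    with \<open>D 0 \<le> - c * P 0\<close> have "D 0 < 0" by simp
    then have "ennreal (A + D 0) < ennreal A" using sh(2)[of 0] by (intro ennreal_lessI) auto
    with sh(1)[of 0] show "risk f (balanced_loss \<omega> \<rho> (\<lambda>x. x)) (0 :: real ^ 'n) (shrink_est \<omega> a s)
      < risk f (balanced_loss \<omega> \<rho> (\<lambda>x. x)) (0 :: real ^ 'n) (\<lambda>x. x)"
      unfolding id by (rule le_less_trans)
  qed
qed

text \<open>The factor \<open>\<rho>' / c\<close> moves from the density into the integrand. For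
  \<open>c = 0\<close> both sides are 0.\<close>

lemma sph_expectation_tilted:
  fixes g :: "real ^ 'n \<Rightarrow> real"
  assumes "0 \<le> c" and [measurable]: "g \<in> borel_measurable borel"
  shows "sph_expectation (\<lambda>t. \<rho>' t * f t / c) (0 :: real ^ 'n) g
    = sph_expectation f 0 (\<lambda>x. \<rho>' ((norm x)\<^sup>2) * g x) / c"
proof -
  have "sph_expectation (\<lambda>t. \<rho>' t * f t / c) (0 :: real ^ 'n) g
    = (\<integral>x. (\<rho>' ((norm x)\<^sup>2) * f ((norm x)\<^sup>2) / c) *\<^sub>R g x \<partial>lborel)"
    unfolding sph_expectation_def sph_law_def using assms(1) f_nonneg
    by (subst integral_density) (auto intro!: AE_I2 divide_nonneg_nonneg mult_nonneg_nonneg rho'_nonneg)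
  also have "\<dots> = (\<integral>x. (f ((norm x)\<^sup>2) *\<^sub>R (\<rho>' ((norm x)\<^sup>2) * g x)) / c \<partial>lborel)"
    by (intro Bochner_Integration.integral_cong) auto
  also have "\<dots> = sph_expectation f 0 (\<lambda>x. \<rho>' ((norm x)\<^sup>2) * g x) / c"
    unfolding sph_expectation_def sph_law_def using f_nonneg
    by (subst integral_density) auto
  finally show ?thesis .
qed

end

theorem theorem2p1:
  fixes f \<rho> \<rho>' s fstar :: "real \<Rightarrow> real"
    and \<omega> a d K :: real
  assumes d: "d = real CARD('n::finite)" and d_ge: "CARD('n) \<ge> 4"
    and omega: "0 \<le> \<omega>" "\<omega> < 1"
    and f_density: "\<And>\<theta> :: real ^ 'n. prob_density (\<lambda>x. f ((norm (x - \<theta>))\<^sup>2))"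
    and E_sq: "integrable (sph_law f (0 :: real ^ 'n)) (\<lambda>x. (norm x)\<^sup>2)"
    and E_inv_sq: "integrable (sph_law f (0 :: real ^ 'n)) (\<lambda>x. 1 / (norm x)\<^sup>2)"
    and rho_nonneg: "\<And>t. t \<ge> 0 \<Longrightarrow> \<rho> t \<ge> 0"
    and rho_deriv: "\<And>t. t \<ge> 0 \<Longrightarrow> (\<rho> has_real_derivative \<rho>' t) (at t within {0..})"
    and rho_mono: "mono_on {0..} \<rho>"
    and rho_concave: "concave_on {0..} \<rho>"
    and rho_0: "\<rho> 0 = 0" and rho'_0: "\<rho>' 0 > 0"
    and s_range: "\<And>t. t \<ge> 0 \<Longrightarrow> s t \<in> {0..1}"
    and s_mono: "mono_on {0..} s"
    and s_concave: "concave_on {0..} s"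
    and s_diff: "AE t in lborel. t > 0 \<longrightarrow> twice_differentiable_at s t"
    and s_nonzero: "\<exists>t\<ge>0. s t \<noteq> 0"
    and K: "K = sph_expectation f (0 :: real ^ 'n) (\<lambda>x. \<rho>' ((norm x)\<^sup>2))"
    and fstar: "fstar = (\<lambda>t. \<rho>' t * f t / K)"
  shows "(0 < a \<and>
          a < (2 * K * (d - 2) / d) /
              ((\<omega> * \<rho>' 0 + K * (1 - \<omega>)) *
                sph_expectation fstar (0 :: real ^ 'n) (\<lambda>y. 1 / (norm y)\<^sup>2))
          \<longrightarrow> dominates f (balanced_loss \<omega> \<rho> (\<lambda>x. x)) (shrink_est \<omega> a s) (\<lambda>x :: real ^ 'n. x))
       \<and> (0 < a \<and>
          a < (2 * K * (d - 2) / d) /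
              ((\<omega> * \<rho>' 0 + K * (1 - \<omega>)) *
                sph_expectation fstar (0 :: real ^ 'n) (\<lambda>y. 1 / (norm y)\<^sup>2))
          \<longleftrightarrow>
          0 < a \<and>
          a < (2 * K\<^sup>2 * (d - 2) / d) /
              ((\<omega> * \<rho>' 0 + K * (1 - \<omega>)) *
                sph_expectation f (0 :: real ^ 'n) (\<lambda>x. \<rho>' ((norm x)\<^sup>2) / (norm x)\<^sup>2)))"
proof -
  interpret sd: spherical_density f "TYPE('n)"
    using f_density[of 0] by unfold_locales simp
  interpret shrinkage f "TYPE('n)" \<rho> \<rho>' s
  proof unfold_locales
    show "integrable sd.\<mu> (\<lambda>r. r\<^sup>2)"
      using E_sq sd.integral_radial(2)[of "\<lambda>t. t"] by simp
    show "integrable sd.\<mu> (\<lambda>r. 1 / r\<^sup>2)"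
      using E_inv_sq sd.integral_radial(2)[of "\<lambda>t. 1 / t"] by simp
  qed (use assms in auto)
  define B where "B = (2 * K\<^sup>2 * (d - 2) / d) /
    ((\<omega> * \<rho>' 0 + K * (1 - \<omega>)) * sph_expectation f (0 :: real ^ 'n) (\<lambda>x. \<rho>' ((norm x)\<^sup>2) / (norm x)\<^sup>2))"
  have K_eq: "K = K\<^sub>\<rho>"
    unfolding K K\<^sub>\<rho>_def by (rule sd.integral_radial(1)) measurable
  have I_eq: "sph_expectation f (0 :: real ^ 'n) (\<lambda>x. \<rho>' ((norm x)\<^sup>2) / (norm x)\<^sup>2) = I\<^sub>\<rho>"
    unfolding I\<^sub>\<rho>_def by (rule sd.integral_radial(1)[of "\<lambda>t. \<rho>' t / t"]) measurable
  have "sph_expectation fstar (0 :: real ^ 'n) (\<lambda>y. 1 / (norm y)\<^sup>2)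
      = sph_expectation f 0 (\<lambda>x :: real ^ 'n. \<rho>' ((norm x)\<^sup>2) / (norm x)\<^sup>2) / K"
    unfolding fstar using K_nonneg by (subst sph_expectation_tilted) (simp_all add: K_eq)
  \<comment> \<open>The two upper bounds are the same number: the normalizing \<open>K\<close> of
    \<open>fstar\<close> moves to the numerator. This includes \<open>K = 0\<close>, where both are
    0.\<close>
  then have B_eq: "(2 * K * (d - 2) / d) / ((\<omega> * \<rho>' 0 + K * (1 - \<omega>)) *
      sph_expectation fstar (0 :: real ^ 'n) (\<lambda>y. 1 / (norm y)\<^sup>2)) = B"
    by (simp add: B_def power2_eq_square mult_ac)
  have "dominates f (balanced_loss \<omega> \<rho> (\<lambda>x. x)) (shrink_est \<omega> a s) (\<lambda>x :: real ^ 'n. x)" if "0 < a" "a < B"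
    using that unfolding B_def I_eq K_eq d by (intro shrink_est_dominates omega s_nonzero rho'_0)
  then show ?thesis
    unfolding B_eq B_def[symmetric] by blast
qed

end
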